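(* Let $\Omega\subset\mathbb{R}^N$, $N\ge 2$, be either a ball or an annulus centered at the origin $O$. Let $f$ be a Carathéodory function on $\Omega\times\mathbb{R}$ such that $f(\cdot,t)$ is radial for all $t\in\mathbb{R}$ (write $f(x,t)=f(|x|,t)$), and assume: (i) there are $C>0$, $r>1$, with $r<2N/(N-2)$ if $N\ge3$, such that $|f(x,t)|\le C(|t|^{r-1}+1)$ for a.a. $x\in\Omega$ and all $t\in\mathbb{R}$; (ii) for each $M>0$ there is a constant $C_M>0$ such that $|f(x,s)-f(x,t)|\le C_M|s-t|$ for a.a. $x\in\Omega$ and all $s,t\in[-M,M]$; (iii) $f(|x|,\cdot)$ is convex for a.a. $x\in\Omega$. Let $u_0\in C^2(\Omega)\cap C(\overline{\Omega})$, $u_0\ne0$, be a classical solution of $-\Delta u=f(x,u)$ in $\Omega$, $u=0$ on $\partial\Omega$, and let $P\in\Omega$ be a critical point of $u_0$. If $P\neq O$ and $u_0$ is not axially symmetric with respect to the line $OP$, or if $P=O$ and $u_0$ is not radially symmetric, then there is a $2$-dimensional subspace $V\subset H^1_0(\Omega)$ containing sign-definite functions such that $u_0$ is a local maximizer of $\Phi|_{u_0+V}$. If, in addition, $f(|x|,\cdot)$ is strictly convex for a.a. $x\in\Omega$, then $u_0$ is a strict local maximizer of $\Phi|_{u_0+V}$. If $u_0\ge0$, the convexity (respectively strict convexity) assumption on $f(|x|,\cdot)$ is needed only on $[0,\infty)$.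
   Context: $\Phi(u)=\int_\Omega\frac12|\nabla u|^2-F(x,u)$ for $u\in H^1_0(\Omega)$, where $F(x,t)=\int_0^t f(x,s)\,ds$. $u_0+V=\{u_0+v:v\in V\}$. A function on $\Omega$ is axially symmetric with respect to the line $OP$ if it is invariant under every orthogonal transformation of $\mathbb{R}^N$ that fixes $P$ (equivalently, it is symmetric with respect to every hyperplane containing $O$ and $P$). "Sign-definite function" means a function, not identically zero, that does not change sign (is a.e. $\ge0$ or a.e. $\le0$). *)

theory Defs
  imports "HOL-Analysis.Analysis"
begin

definition ball_centered_at_origin :: "'a::euclidean_space set \<Rightarrow> bool" where
  "ball_centered_at_origin \<Omega> \<longleftrightarrow> (\<exists>R>0. \<Omega> = ball 0 R)"

definition annulus_centered_at_origin :: "'a::euclidean_space set \<Rightarrow> bool" where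
  "annulus_centered_at_origin \<Omega> \<longleftrightarrow> (\<exists>a b. 0 < a \<and> a < b \<and> \<Omega> = {x. a < norm x \<and> norm x < b})"

definition radially_symmetric_on :: "'a::euclidean_space set \<Rightarrow> ('a \<Rightarrow> 'b) \<Rightarrow> bool" where
  "radially_symmetric_on \<Omega> u \<longleftrightarrow> (\<forall>x\<in>\<Omega>. \<forall>y\<in>\<Omega>. norm x = norm y \<longrightarrow> u x = u y)"

(* Symmetry with respect to the line through 0 and P; meant for P different from 0 and for
   sets that are invariant under orthogonal transformations. *)
definition axially_symmetric_on :: "'a::euclidean_space set \<Rightarrow> ('a \<Rightarrow> 'b) \<Rightarrow> 'a \<Rightarrow> bool" where
  "axially_symmetric_on \<Omega> u P \<longleftrightarrow>
     (\<forall>T. orthogonal_transformation T \<and> T P = P \<longrightarrow> (\<forall>x\<in>\<Omega>. u (T x) = u x))"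

definition strictly_convex_on :: "real set \<Rightarrow> (real \<Rightarrow> real) \<Rightarrow> bool" where
  "strictly_convex_on S g \<longleftrightarrow> convex S \<and>
     (\<forall>s\<in>S. \<forall>t\<in>S. \<forall>a>0. \<forall>b>0. s \<noteq> t \<and> a + b = 1 \<longrightarrow> g (a * s + b * t) < a * g s + b * g t)"

definition caratheodory_on :: "'a::euclidean_space set \<Rightarrow> ('a \<Rightarrow> real \<Rightarrow> real) \<Rightarrow> bool" where
  "caratheodory_on \<Omega> f \<longleftrightarrow>
     (\<forall>t. (\<lambda>x. f x t) \<in> borel_measurable (lebesgue_on \<Omega>)) \<and>
     (AE x in lebesgue_on \<Omega>. continuous_on UNIV (f x))"

definition partial_deriv :: "'a::euclidean_space \<Rightarrow> ('a \<Rightarrow> real) \<Rightarrow> 'a \<Rightarrow> real" where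
  "partial_deriv i u = (\<lambda>x. frechet_derivative u (at x) i)"

(* The class C^k on an open set S. *)
primrec Ck_on :: "nat \<Rightarrow> 'a::euclidean_space set \<Rightarrow> ('a \<Rightarrow> real) \<Rightarrow> bool" where
  "Ck_on 0 S u \<longleftrightarrow> continuous_on S u"
| "Ck_on (Suc k) S u \<longleftrightarrow>
     (\<forall>x\<in>S. u differentiable (at x)) \<and> (\<forall>i\<in>Basis. Ck_on k S (partial_deriv i u))"

definition laplacian :: "('a::euclidean_space \<Rightarrow> real) \<Rightarrow> 'a \<Rightarrow> real" where
  "laplacian u x = (\<Sum>i\<in>Basis. partial_deriv i (partial_deriv i u) x)"

definition critical_point :: "('a::euclidean_space \<Rightarrow> real) \<Rightarrow> 'a \<Rightarrow> bool" where
  "critical_point u P \<longleftrightarrow> (u has_derivative (\<lambda>_. 0)) (at P)"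

definition classical_dirichlet_solution ::
    "'a::euclidean_space set \<Rightarrow> ('a \<Rightarrow> real \<Rightarrow> real) \<Rightarrow> ('a \<Rightarrow> real) \<Rightarrow> bool" where
  "classical_dirichlet_solution \<Omega> f u \<longleftrightarrow>
     Ck_on 2 \<Omega> u \<and> continuous_on (closure \<Omega>) u \<and>
     (\<forall>x\<in>\<Omega>. - laplacian u x = f x (u x)) \<and> (\<forall>x\<in>frontier \<Omega>. u x = 0)"

definition test_functions :: "'a::euclidean_space set \<Rightarrow> ('a \<Rightarrow> real) set" where
  "test_functions \<Omega> = {\<phi>. (\<forall>k. Ck_on k UNIV \<phi>) \<and>
     compact (closure {x. \<phi> x \<noteq> 0}) \<and> closure {x. \<phi> x \<noteq> 0} \<subseteq> \<Omega>}"

(* Elements of L^2, H^1 and H^1_0 are represented by functions on the whole space, of which only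
   the values on \<Omega> matter; functions that agree a.e. in \<Omega> represent the same element. *)
definition L2 :: "'a::euclidean_space set \<Rightarrow> ('a \<Rightarrow> 'b::euclidean_space) set" where
  "L2 \<Omega> = {u. u \<in> borel_measurable (lebesgue_on \<Omega>) \<and>
     integrable (lebesgue_on \<Omega>) (\<lambda>x. (norm (u x))\<^sup>2)}"

definition has_weak_gradient ::
    "'a::euclidean_space set \<Rightarrow> ('a \<Rightarrow> real) \<Rightarrow> ('a \<Rightarrow> 'a) \<Rightarrow> bool" where
  "has_weak_gradient \<Omega> u g \<longleftrightarrow> u \<in> L2 \<Omega> \<and> g \<in> L2 \<Omega> \<and>
     (\<forall>\<phi>\<in>test_functions \<Omega>. \<forall>i\<in>Basis.
        integral\<^sup>L (lebesgue_on \<Omega>) (\<lambda>x. u x * partial_deriv i \<phi> x) =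
        - integral\<^sup>L (lebesgue_on \<Omega>) (\<lambda>x. (g x \<bullet> i) * \<phi> x))"

definition H1 :: "'a::euclidean_space set \<Rightarrow> ('a \<Rightarrow> real) set" where
  "H1 \<Omega> = {u. \<exists>g. has_weak_gradient \<Omega> u g}"

(* Determined up to a.e. equality in \<Omega>, for u in H1 \<Omega>. *)
definition weak_gradient :: "'a::euclidean_space set \<Rightarrow> ('a \<Rightarrow> real) \<Rightarrow> 'a \<Rightarrow> 'a" where
  "weak_gradient \<Omega> u = (SOME g. has_weak_gradient \<Omega> u g)"

definition H1_norm :: "'a::euclidean_space set \<Rightarrow> ('a \<Rightarrow> real) \<Rightarrow> real" where
  "H1_norm \<Omega> u = sqrt (integral\<^sup>L (lebesgue_on \<Omega>)
     (\<lambda>x. (u x)\<^sup>2 + (norm (weak_gradient \<Omega> u x))\<^sup>2))"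

(* The closure of the test functions in the H^1 norm. *)
definition H10 :: "'a::euclidean_space set \<Rightarrow> ('a \<Rightarrow> real) set" where
  "H10 \<Omega> = {u \<in> H1 \<Omega>. \<forall>\<epsilon>>0. \<exists>\<phi>\<in>test_functions \<Omega>. H1_norm \<Omega> (\<lambda>x. u x - \<phi> x) < \<epsilon>}"

(* The interval integral is signed, so F(x,t) = - (integral of f(x,.) over [t,0]) for t < 0. *)
definition primitive :: "('a \<Rightarrow> real \<Rightarrow> real) \<Rightarrow> 'a \<Rightarrow> real \<Rightarrow> real" where
  "primitive f x t = (LBINT s=ereal 0..ereal t. f x s)"

definition energy ::
    "'a::euclidean_space set \<Rightarrow> ('a \<Rightarrow> real \<Rightarrow> real) \<Rightarrow> ('a \<Rightarrow> real) \<Rightarrow> real" where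
  "energy \<Omega> f u = integral\<^sup>L (lebesgue_on \<Omega>)
     (\<lambda>x. 1 / 2 * (norm (weak_gradient \<Omega> u x))\<^sup>2 - primitive f x (u x))"

(* V is the set of all representatives of the elements of a d-dimensional linear subspace of
   H^1_0, the functions b 0, ..., b (d - 1) representing a basis. *)
definition H10_subspace_of_dim ::
    "'a::euclidean_space set \<Rightarrow> ('a \<Rightarrow> real) set \<Rightarrow> nat \<Rightarrow> bool" where
  "H10_subspace_of_dim \<Omega> V d \<longleftrightarrow>
     (\<exists>b :: nat \<Rightarrow> 'a \<Rightarrow> real.
        (\<forall>i<d. b i \<in> H10 \<Omega>) \<and>
        (\<forall>c :: nat \<Rightarrow> real. (AE x in lebesgue_on \<Omega>. (\<Sum>i<d. c i * b i x) = 0) \<longrightarrow> (\<forall>i<d. c i = 0)) \<and>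
        V = {v. \<exists>c :: nat \<Rightarrow> real. AE x in lebesgue_on \<Omega>. v x = (\<Sum>i<d. c i * b i x)})"

definition translate_by :: "('a \<Rightarrow> real) \<Rightarrow> ('a \<Rightarrow> real) set \<Rightarrow> ('a \<Rightarrow> real) set" where
  "translate_by u V = {\<lambda>x. u x + v x | v. v \<in> V}"

definition sign_definite_on :: "'a::euclidean_space set \<Rightarrow> ('a \<Rightarrow> real) \<Rightarrow> bool" where
  "sign_definite_on \<Omega> v \<longleftrightarrow> \<not> (AE x in lebesgue_on \<Omega>. v x = 0) \<and>
     ((AE x in lebesgue_on \<Omega>. v x \<ge> 0) \<or> (AE x in lebesgue_on \<Omega>. v x \<le> 0))"

(* J is a functional on H^1_0, so its restriction to A only makes sense for A \<subseteq> H10 \<Omega>. *)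
definition local_maximizer_on ::
    "'a::euclidean_space set \<Rightarrow> (('a \<Rightarrow> real) \<Rightarrow> real) \<Rightarrow> ('a \<Rightarrow> real) set \<Rightarrow> ('a \<Rightarrow> real) \<Rightarrow> bool" where
  "local_maximizer_on \<Omega> J A u \<longleftrightarrow> A \<subseteq> H10 \<Omega> \<and> u \<in> A \<and>
     (\<exists>\<epsilon>>0. \<forall>w\<in>A. H1_norm \<Omega> (\<lambda>x. w x - u x) < \<epsilon> \<longrightarrow> J w \<le> J u)"

definition strict_local_maximizer_on ::
    "'a::euclidean_space set \<Rightarrow> (('a \<Rightarrow> real) \<Rightarrow> real) \<Rightarrow> ('a \<Rightarrow> real) set \<Rightarrow> ('a \<Rightarrow> real) \<Rightarrow> bool" where
  "strict_local_maximizer_on \<Omega> J A u \<longleftrightarrow> A \<subseteq> H10 \<Omega> \<and> u \<in> A \<and>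
     (\<exists>\<epsilon>>0. \<forall>w\<in>A. H1_norm \<Omega> (\<lambda>x. w x - u x) < \<epsilon> \<and> \<not> (AE x in lebesgue_on \<Omega>. w x = u x)
        \<longrightarrow> J w < J u)"

end

theory Submission
  imports Defs
begin

text \<open>
  The proof is a reflection argument. If \<open>u\<close> lacks the
  symmetry in question, there are points \<open>x\<close>, \<open>y\<close> of equal norm with \<open>u x \<noteq> u y\<close> and with
  \<open>y - x\<close> orthogonal to \<open>P\<close>. Let \<open>s\<close> be the reflection that swaps \<open>x\<close> and \<open>y\<close>; its mirror contains
  \<open>0\<close> and \<open>P\<close>. The difference \<open>v = u - u \<circ> s\<close> is odd under \<open>s\<close>, is not identically zero, and satisfies
  \<open>- \<Delta>v = f(x, u) - f(x, u \<circ> s)\<close> since \<open>f(\<cdot>, t)\<close> is radial; by the Lipschitz condition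
  \<open>\<bar>\<Delta>v\<bar> \<le> L \<bar>v\<bar>\<close>. As \<open>P\<close> is critical and lies on the mirror, the gradient of \<open>v\<close> vanishes at \<open>P\<close>.
  If \<open>v\<close> had one sign on the part of \<open>\<Omega>\<close> on one side of the mirror, the strong maximum principle and
  Hopf's boundary point lemma would give \<open>v\<close> a nonzero normal derivative at \<open>P\<close>. So \<open>v\<close> takes both
  signs on each side (\<^verbatim>\<open>antisymmetric_sign_change\<close>), and the restrictions of the positive part of \<open>v\<close>
  to the two sides are nonzero, nonnegative functions \<open>z\<^sub>0\<close>, \<open>z\<^sub>1\<close> with disjoint supports. They
  span \<open>V\<close>.

  Green's identity gives \<open>\<integral> \<nabla>u \<bullet> \<nabla>z\<^sub>i = \<integral> f(x, u) z\<^sub>i\<close> and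
  \<open>\<integral> \<bar>\<nabla>z\<^sub>i\<bar>\<^sup>2 = \<integral> (f(x, u) - f(x, u \<circ> s)) z\<^sub>i\<close>. As the supports are disjoint, the energy of
  \<open>u + c\<^sub>0 z\<^sub>0 + c\<^sub>1 z\<^sub>1\<close> minus that of \<open>u\<close> is the sum over \<open>i\<close> of the integrals of
  \<open>f(x, u) c\<^sub>i z\<^sub>i + c\<^sub>i\<^sup>2 (f(x, u) - f(x, u \<circ> s)) z\<^sub>i / 2 - (F(x, u + c\<^sub>i z\<^sub>i) - F(x, u))\<close>.
  On the support of \<open>z\<^sub>i\<close> one has \<open>z\<^sub>i = u - u \<circ> s > 0\<close>, so the middle term contains the increment of the
  convex function \<open>f(x, \<cdot>)\<close> over \<open>[u \<circ> s, u]\<close>, and the integrand is nonpositive for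
  \<open>\<bar>c\<^sub>i\<bar> \<le> 1\<close> (\<^verbatim>\<open>convex_primitive_gap\<close>, \<^verbatim>\<open>disjoint_bumps_local_maximizer\<close>). In the strictly
  convex case it is negative where \<open>c\<^sub>i z\<^sub>i \<noteq> 0\<close>. The argument uses \<open>f(x, \<cdot>)\<close> only at values between \<open>u \<circ> s\<close> and \<open>2 u - u \<circ> s\<close>, which are
  nonnegative if \<open>u\<close> is. The comparison is exact and not a second order expansion of the energy.

  The functional analytic part places \<open>u\<close> and the \<open>z\<^sub>i\<close> in the closure of the test functions and
  identifies their weak gradients. Weak gradients are unique almost everywhere by the fundamental lemma
  of the calculus of variations, which rests on mollification. A continuous function \<open>z\<close> that is \<open>C\<^sup>2\<close> where it does
  not vanish, with bounded Laplacian there, is approximated by the \<open>C\<^sup>1\<close> functions \<open>T\<^sub>\<epsilon> z\<close>, where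
  \<open>T\<^sub>\<epsilon>\<close> vanishes on \<open>[- \<epsilon>, \<epsilon>]\<close>. These have compact support in the open set where \<open>z \<noteq> 0\<close>, so that
  integration by parts takes place away from the boundary of that set (locale \<^verbatim>\<open>truncation\<close>).
\<close>

section \<open>Gradients and smooth functions\<close>

definition grad :: "('a::euclidean_space \<Rightarrow> real) \<Rightarrow> 'a \<Rightarrow> 'a" where
  "grad u x = (\<Sum>i\<in>Basis. partial_deriv i u x *\<^sub>R i)"

lemma partial_deriv_eq:
  assumes "(u has_derivative D) (at x)"
  shows "partial_deriv i u x = D i"
  using frechet_derivative_at[OF assms] by (simp add: partial_deriv_def)

lemma grad_inner_Basis: "i \<in> Basis \<Longrightarrow> grad u x \<bullet> i = partial_deriv i u x"
  by (simp add: grad_def)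

lemma grad_eqI:
  assumes "(u has_derivative (\<lambda>h. g \<bullet> h)) (at x)"
  shows "grad u x = g"
  by (rule euclidean_eqI) (simp add: grad_inner_Basis partial_deriv_eq[OF assms])

lemma differentiable_has_grad:
  assumes "u differentiable (at x)"
  shows "(u has_derivative (\<lambda>h. grad u x \<bullet> h)) (at x)"
proof -
  obtain D where D: "(u has_derivative D) (at x)"
    using assms by (auto simp: differentiable_def)
  have "D h = grad u x \<bullet> h" for h
  proof -
    interpret linear D using D by (rule has_derivative_linear)
    have "D h = D (\<Sum>i\<in>Basis. (h \<bullet> i) *\<^sub>R i)" by (simp add: euclidean_representation)
    also have "\<dots> = (\<Sum>i\<in>Basis. (h \<bullet> i) * D i)" by (simp add: sum scale)
    finally show ?thesis
      by (simp add: grad_def inner_sum_left inner_sum_right partial_deriv_eq[OF D] inner_commute mult.commute)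
  qed
  then have "D = (\<lambda>h. grad u x \<bullet> h)" by auto
  with D show ?thesis by simp
qed

definition smooth :: "('a::euclidean_space \<Rightarrow> real) \<Rightarrow> bool" where
  "smooth u \<longleftrightarrow> (\<forall>k. Ck_on k UNIV u)"

lemma smooth_differentiable: "smooth u \<Longrightarrow> u differentiable (at x)"
  unfolding smooth_def by (metis Ck_on.simps(2) UNIV_I)

lemma smooth_partial_deriv: "smooth u \<Longrightarrow> i \<in> Basis \<Longrightarrow> smooth (partial_deriv i u)"
  unfolding smooth_def by (metis Ck_on.simps(2))

lemma smooth_continuous: "smooth u \<Longrightarrow> continuous_on UNIV u"
  unfolding smooth_def by (metis Ck_on.simps(1))

text \<open>
  A family of differentiable functions that is closed under partial derivatives consists of smooth
  functions. All smoothness proofs below exhibit such a family; this replaces higher order product and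
  chain rules.
\<close>

lemma smooth_coinduct:
  fixes u :: "'a::euclidean_space \<Rightarrow> real"
  assumes "Q u"
    and diff: "\<And>w x. Q w \<Longrightarrow> w differentiable (at x)"
    and part: "\<And>w i. Q w \<Longrightarrow> i \<in> Basis \<Longrightarrow> Q (partial_deriv i w)"
  shows "smooth u"
proof -
  have "Q w \<Longrightarrow> Ck_on k UNIV w" for k w
  proof (induction k arbitrary: w)
    case 0
    then show ?case using diff
      by (simp add: continuous_on_eq_continuous_at differentiable_imp_continuous_within)
  next
    case (Suc k)
    then show ?case using diff part by simp
  qed
  then show ?thesis using \<open>Q u\<close> by (simp add: smooth_def)
qed

lemma smooth_lincomb:
  assumes "smooth u" "smooth v"
  shows "smooth (\<lambda>x. a * u x + b * v x)"
proof (rule smooth_coinduct[where Q = "\<lambda>w. \<exists>u v. smooth u \<and> smooth v \<and> w = (\<lambda>x. a * u x + b * v x)"])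
  show "\<exists>u' v'. smooth u' \<and> smooth v' \<and> (\<lambda>x. a * u x + b * v x) = (\<lambda>x. a * u' x + b * v' x)"
    using assms by blast
next
  fix w :: "'a \<Rightarrow> real" and x
  assume "\<exists>u v. smooth u \<and> smooth v \<and> w = (\<lambda>x. a * u x + b * v x)"
  then obtain u v where uv: "smooth u" "smooth v" "w = (\<lambda>x. a * u x + b * v x)" by blast
  have "((\<lambda>x. a * u x + b * v x) has_derivative (\<lambda>h. a * (grad u x \<bullet> h) + b * (grad v x \<bullet> h))) (at x)"
    by (intro derivative_intros differentiable_has_grad smooth_differentiable uv)
  then show "w differentiable (at x)" unfolding uv(3) by (rule differentiableI)
next
  fix w :: "'a \<Rightarrow> real" and i :: 'a
  assume "\<exists>u v. smooth u \<and> smooth v \<and> w = (\<lambda>x. a * u x + b * v x)" and i: "i \<in> Basis"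
  then obtain u v where uv: "smooth u" "smooth v" "w = (\<lambda>x. a * u x + b * v x)" by blast
  have "partial_deriv i w = (\<lambda>x. a * partial_deriv i u x + b * partial_deriv i v x)"
  proof
    fix x
    have "(w has_derivative (\<lambda>h. a * (grad u x \<bullet> h) + b * (grad v x \<bullet> h))) (at x)"
      unfolding uv(3)
      by (intro derivative_intros differentiable_has_grad smooth_differentiable uv)
    then show "partial_deriv i w x = a * partial_deriv i u x + b * partial_deriv i v x"
      using i by (simp add: partial_deriv_eq grad_inner_Basis)
  qed
  then show "\<exists>u v. smooth u \<and> smooth v \<and> partial_deriv i w = (\<lambda>x. a * u x + b * v x)"
    using uv i smooth_partial_deriv by blast
qed

section \<open>A smooth bump function\<close>

text \<open>
  The factor \<open>t\<^sup>-\<^sup>n\<close> makes the span of these functions closed under differentiation; the case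
  \<open>n = 0\<close> is the classical flat function \<open>exp (- 1 / t)\<close>.
\<close>

definition flat_exp :: "nat \<Rightarrow> real \<Rightarrow> real" where
  "flat_exp n t = (if t \<le> 0 then 0 else exp (- (1 / t)) / t ^ n)"

lemma flat_exp_tendsto_0: "(flat_exp n \<longlongrightarrow> 0) (at_right 0)"
proof -
  have "((\<lambda>t::real. inverse t ^ n / exp (inverse t)) \<longlongrightarrow> 0) (at_right 0)"
    by (rule filterlim_compose[OF tendsto_power_div_exp_0 filterlim_inverse_at_top_right])
  moreover have "\<forall>\<^sub>F t in at_right (0::real). inverse t ^ n / exp (inverse t) = flat_exp n t"
    by (rule eventually_at_right_less[THEN eventually_mono])
      (auto simp: flat_exp_def exp_minus field_simps power_inverse)
  ultimately show ?thesis by (rule Lim_transform_eventually)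
qed

text \<open>
  At \<open>0\<close> the difference quotient of the function with index \<open>n\<close> is, for positive arguments, the function with
  index \<open>n + 1\<close>, which tends to \<open>0\<close> because the exponential beats every power.
\<close>

lemma flat_exp_deriv:
  "(flat_exp n has_real_derivative flat_exp (n + 2) t - n * flat_exp (n + 1) t) (at t)"
proof -
  consider "t < 0" | "t = 0" | "t > 0" by linarith
  then show ?thesis
  proof cases
    case 1
    have "((\<lambda>_. 0) has_real_derivative 0) (at t)" by simp
    then have "(flat_exp n has_real_derivative 0) (at t)"
      by (rule has_field_derivative_transform_within_open[where S="{..<0}"])
        (use 1 in \<open>auto simp: flat_exp_def\<close>)
    then show ?thesis using 1 by (simp add: flat_exp_def)
  next
    case 2
    have "((\<lambda>h. (flat_exp n h - flat_exp n 0) / (h - 0)) \<longlongrightarrow> 0) (at 0)"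
    proof (rule filterlim_split_at)
      show "((\<lambda>h. (flat_exp n h - flat_exp n 0) / (h - 0)) \<longlongrightarrow> 0) (at_left 0)"
        by (rule Lim_transform_eventually[OF tendsto_const])
          (auto simp: flat_exp_def eventually_at_left_field intro!: exI[of _ "-1"])
      show "((\<lambda>h. (flat_exp n h - flat_exp n 0) / (h - 0)) \<longlongrightarrow> 0) (at_right 0)"
        by (rule Lim_transform_eventually[OF flat_exp_tendsto_0[of "Suc n"]])
          (auto simp: flat_exp_def eventually_at_right_field intro!: exI[of _ 1])
    qed
    then show ?thesis using 2
      by (simp add: has_field_derivative_iff flat_exp_def)
  next
    case 3
    have "((\<lambda>t. exp (- (1 / t)) / t ^ n) has_real_derivative
        flat_exp (n + 2) t - n * flat_exp (n + 1) t) (at t)"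
    proof (cases n)
      case 0
      then show ?thesis using 3
        by (auto intro!: derivative_eq_intros simp: flat_exp_def field_simps power2_eq_square)
    next
      case (Suc m)
      then show ?thesis using 3
        by (auto intro!: derivative_eq_intros simp: flat_exp_def field_simps power2_eq_square)
          (cases m; simp)
    qed
    then show ?thesis
      by (rule has_field_derivative_transform_within_open[where S="{0<..}"])
        (use 3 in \<open>auto simp: flat_exp_def\<close>)
  qed
qed

text \<open>
  A partial derivative of \<open>k(\<delta>\<^sup>2 - x \<bullet> x)\<close> has a coordinate of \<open>x\<close> as a factor. So closing the
  bumps under multiplication by coordinates and linear combinations gives a family that is closed under partial
  derivatives.
\<close>

inductive bump_family :: "real \<Rightarrow> ('a::euclidean_space \<Rightarrow> real) \<Rightarrow> bool" for \<delta> where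
  base: "bump_family \<delta> (\<lambda>x. flat_exp n (\<delta>\<^sup>2 - x \<bullet> x))"
| coord: "bump_family \<delta> u \<Longrightarrow> bump_family \<delta> (\<lambda>x. (x \<bullet> j) * u x)"
| lincomb: "bump_family \<delta> u \<Longrightarrow> bump_family \<delta> v \<Longrightarrow> bump_family \<delta> (\<lambda>x. a * u x + b * v x)"

lemma bump_family_deriv:
  assumes "bump_family \<delta> u"
  shows "(\<forall>x. u differentiable (at x)) \<and> (\<forall>i. bump_family \<delta> (\<lambda>x. grad u x \<bullet> i))"
  using assms
proof induction
  case (base n)
  let ?d = "\<lambda>x::'a. flat_exp (n + 2) (\<delta>\<^sup>2 - x \<bullet> x) - n * flat_exp (n + 1) (\<delta>\<^sup>2 - x \<bullet> x)"
  have D: "((\<lambda>x. flat_exp n (\<delta>\<^sup>2 - x \<bullet> x)) has_derivative (\<lambda>h. ((- 2 * ?d x) *\<^sub>R x) \<bullet> h)) (at x)" for x :: 'a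
    by (rule has_derivative_eq_rhs[OF has_derivative_compose[where g = "flat_exp n"
          and f = "\<lambda>x. \<delta>\<^sup>2 - x \<bullet> x", OF _ flat_exp_deriv[unfolded has_field_derivative_def]]])
      (auto intro!: derivative_eq_intros simp: inner_commute algebra_simps)
  have "bump_family \<delta> (\<lambda>x. (x \<bullet> i) * (- 2 * flat_exp (n + 2) (\<delta>\<^sup>2 - x \<bullet> x) +
           (2 * n) * flat_exp (n + 1) (\<delta>\<^sup>2 - x \<bullet> x)))" for i :: 'a
    by (intro bump_family.intros)
  moreover have "grad (\<lambda>x. flat_exp n (\<delta>\<^sup>2 - x \<bullet> x)) x \<bullet> i =
     (x \<bullet> i) * (- 2 * flat_exp (n + 2) (\<delta>\<^sup>2 - x \<bullet> x) + (2 * n) * flat_exp (n + 1) (\<delta>\<^sup>2 - x \<bullet> x))"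
    for x i :: 'a
    unfolding grad_eqI[OF D] by (simp add: algebra_simps)
  ultimately show ?case using D[THEN differentiableI] by auto
next
  case (coord u j)
  have D: "((\<lambda>x. (x \<bullet> j) * u x) has_derivative (\<lambda>h. (u x *\<^sub>R j + (x \<bullet> j) *\<^sub>R grad u x) \<bullet> h)) (at x)" for x
    using coord.IH by (auto intro!: derivative_eq_intros differentiable_has_grad simp: algebra_simps inner_commute)
  have "bump_family \<delta> (\<lambda>x. (j \<bullet> i) * u x + 1 * ((x \<bullet> j) * (grad u x \<bullet> i)))" for i
    by (rule bump_family.lincomb[OF coord.hyps bump_family.coord]) (use coord in auto)
  then show ?case using D[THEN differentiableI]
    unfolding grad_eqI[OF D] by (simp add: inner_add_left mult.commute[of "u x" for x])
next
  case (lincomb u v a b)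
  have D: "((\<lambda>x. a * u x + b * v x) has_derivative (\<lambda>h. (a *\<^sub>R grad u x + b *\<^sub>R grad v x) \<bullet> h)) (at x)" for x
    using lincomb.IH by (auto intro!: derivative_eq_intros differentiable_has_grad simp: algebra_simps inner_commute)
  show ?case using D lincomb.IH
    by (auto simp: differentiable_def grad_eqI[OF D] inner_add_left intro!: bump_family.lincomb)
qed

lemma smooth_bump_family: "bump_family \<delta> u \<Longrightarrow> smooth u"
proof (rule smooth_coinduct[where Q="bump_family \<delta>"])
  fix w :: "'a \<Rightarrow> real" and i :: 'a
  assume "bump_family \<delta> w" "i \<in> Basis"
  moreover from this have "partial_deriv i w = (\<lambda>x. grad w x \<bullet> i)"
    by (simp add: grad_inner_Basis)
  ultimately show "bump_family \<delta> (partial_deriv i w)"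
    using bump_family_deriv[of \<delta> w] by simp
qed (use bump_family_deriv in auto)

lemma smooth_bump: "smooth (\<lambda>x::'a::euclidean_space. flat_exp 0 (\<delta>\<^sup>2 - x \<bullet> x))"
  by (rule smooth_bump_family) (rule bump_family.base)


section \<open>Integration by parts for compactly supported functions\<close>

text \<open>
  The space \<open>C\<^sup>1\<^sub>c\<close>. The gradient is a parameter, so that it can be given by a formula, and so is
  the compact set \<open>K\<close> outside of which the function vanishes; \<open>K\<close> may be larger than the support.
\<close>

definition C1c :: "'a::euclidean_space set \<Rightarrow> ('a \<Rightarrow> real) \<Rightarrow> ('a \<Rightarrow> 'a) \<Rightarrow> bool" where
  "C1c K \<phi> \<gamma> \<longleftrightarrow> compact K \<and> (\<forall>x. (\<phi> has_derivative (\<lambda>h. \<gamma> x \<bullet> h)) (at x)) \<and>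
     continuous_on UNIV \<gamma> \<and> (\<forall>x. x \<notin> K \<longrightarrow> \<phi> x = 0)"

lemma C1cD:
  assumes "C1c K \<phi> \<gamma>"
  shows "compact K" "\<And>x. (\<phi> has_derivative (\<lambda>h. \<gamma> x \<bullet> h)) (at x)" "continuous_on UNIV \<gamma>"
    "\<And>x. x \<notin> K \<Longrightarrow> \<phi> x = 0"
  using assms by (auto simp: C1c_def)

lemma C1c_continuous: "C1c K \<phi> \<gamma> \<Longrightarrow> continuous_on UNIV \<phi>"
  by (metis C1cD(2) has_derivative_continuous continuous_at_imp_continuous_on)

lemma C1c_grad_zero:
  assumes "C1c K \<phi> \<gamma>" "x \<notin> K"
  shows "\<gamma> x = 0"
proof -
  have "(\<phi> has_derivative (\<lambda>h. 0 \<bullet> h)) (at x)"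
  proof (rule has_derivative_transform_within_open[where s = "- K" and f = "\<lambda>_. 0"])
    show "((\<lambda>_. 0) has_derivative (\<lambda>h. 0 \<bullet> h)) (at x)" by simp
  qed (use assms in \<open>auto simp: C1c_def compact_imp_closed\<close>)
  with C1cD(2)[OF assms(1), of x] show ?thesis using grad_eqI by metis
qed

lemma compact_support_integrable:
  fixes F :: "'a::euclidean_space \<Rightarrow> 'b::{banach,second_countable_topology}"
  assumes "continuous_on UNIV F" "compact K" "\<And>x. x \<notin> K \<Longrightarrow> F x = 0"
  shows "integrable lborel F"
proof -
  have "integrable lborel (\<lambda>x. indicator K x *\<^sub>R F x)"
    by (rule borel_integrable_compact) (use assms(2) continuous_on_subset[OF assms(1)] in auto)
  moreover have "(\<lambda>x. indicator K x *\<^sub>R F x) = F"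
    using assms(3) by (auto simp: indicator_def)
  ultimately show ?thesis by simp
qed

lemma compact_support_bounded:
  fixes F :: "'a::euclidean_space \<Rightarrow> 'b::real_normed_vector"
  assumes "continuous_on UNIV F" "compact K" "\<And>x. x \<notin> K \<Longrightarrow> F x = 0"
  obtains B where "B > 0" "\<And>x. norm (F x) \<le> B"
proof -
  have "bounded (F ` K)"
    using assms by (intro compact_imp_bounded compact_continuous_image) (auto intro: continuous_on_subset)
  then obtain B where B: "B > 0" "\<And>x. x \<in> K \<Longrightarrow> norm (F x) \<le> B"
    by (auto simp: bounded_pos)
  have "norm (F x) \<le> B" for x
    using B assms(3)[of x] by (cases "x \<in> K") auto
  with B(1) that show ?thesis by blast
qed

lemma lborel_integral_translate:
  fixes F :: "'a::euclidean_space \<Rightarrow> 'b::{banach,second_countable_topology}"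
  assumes "F \<in> borel_measurable borel"
  shows "(\<integral>x. F (c + x) \<partial>lborel) = (\<integral>x. F x \<partial>lborel)"
  using integral_distr[of "(+) c" lborel borel F] assms lborel_distr_plus[of c] by simp

lemma lborel_integral_reflect:
  fixes F :: "'a::euclidean_space \<Rightarrow> 'b::{banach,second_countable_topology}"
  assumes F: "F \<in> borel_measurable borel"
  shows "(\<integral>y. F (x - y) \<partial>lborel) = (\<integral>y. F y \<partial>lborel)"
proof -
  have "lborel = distr lborel borel (\<lambda>y::'a. x + (-1) *\<^sub>R y)"
    by (subst lborel_affine[of "-1" x]) (auto simp: density_1)
  then have "(\<integral>y. F y \<partial>lborel) = (\<integral>y. F y \<partial>(distr lborel borel (\<lambda>y::'a. x + (-1) *\<^sub>R y)))"
    by simp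
  also have "\<dots> = (\<integral>y. F (x + (-1) *\<^sub>R y) \<partial>lborel)"
    using F by (intro integral_distr) auto
  finally show ?thesis by simp
qed

text \<open>
  By translation invariance the difference quotients in direction \<open>i\<close> have integral zero. They converge
  to the directional derivative and are dominated, since the function is Lipschitz with compact support.
\<close>

lemma C1c_integral_zero:
  fixes \<phi> :: "'a::euclidean_space \<Rightarrow> real"
  assumes C: "C1c K \<phi> \<gamma>"
  shows "(\<integral>x. \<gamma> x \<bullet> i \<partial>lborel) = 0"
proof -
  note D = C1cD[OF C]
  have cont: "continuous_on UNIV \<phi>" by (rule C1c_continuous[OF C])
  then have meas[measurable]: "\<phi> \<in> borel_measurable borel" by (rule borel_measurable_continuous_onI)
  have int: "integrable lborel \<phi>" using compact_support_integrable[OF cont D(1,4)] .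
  obtain L where L: "L > 0" "\<And>x. norm (\<gamma> x) \<le> L"
    using compact_support_bounded[OF D(3,1) C1c_grad_zero[OF C]] by blast
  have lip: "\<bar>\<phi> y - \<phi> x\<bar> \<le> L * norm (y - x)" for x y
  proof -
    have "norm (\<phi> y - \<phi> x) \<le> L * norm (y - x)"
    proof (rule differentiable_bound[of UNIV \<phi> "\<lambda>x h. \<gamma> x \<bullet> h"])
      show "onorm (\<lambda>h. \<gamma> z \<bullet> h) \<le> L" for z
      proof (rule onorm_le)
        fix h
        have "\<bar>\<gamma> z \<bullet> h\<bar> \<le> norm (\<gamma> z) * norm h" by (rule Cauchy_Schwarz_ineq2)
        also have "\<dots> \<le> L * norm h" using L(2) by (intro mult_right_mono) auto
        finally show "norm (\<gamma> z \<bullet> h) \<le> L * norm h" by simp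
      qed
    qed (use D(2) in auto)
    then show ?thesis by simp
  qed
  obtain R where R: "R > 0" "K \<subseteq> cball 0 R"
    using compact_imp_bounded[OF D(1)] by (auto simp: bounded_pos subset_eq)
  define s where "s n x = (\<phi> (inverse (real (Suc n)) *\<^sub>R i + x) - \<phi> x) * real (Suc n)" for n x
  have int_s: "(\<integral>x. s n x \<partial>lborel) = 0" for n
  proof -
    have "integrable lborel (\<lambda>x. \<phi> (inverse (real (Suc n)) *\<^sub>R i + x))"
    proof (rule compact_support_integrable)
      show "continuous_on UNIV (\<lambda>x. \<phi> (inverse (real (Suc n)) *\<^sub>R i + x))"
        by (intro continuous_on_compose2[OF cont]) (auto intro!: continuous_intros)
      show "compact ((+) (- (inverse (real (Suc n)) *\<^sub>R i)) ` K)"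
        using D(1) by (rule compact_translation)
      fix x assume x: "x \<notin> (+) (- (inverse (real (Suc n)) *\<^sub>R i)) ` K"
      show "\<phi> (inverse (real (Suc n)) *\<^sub>R i + x) = 0"
      proof (rule D(4), rule notI)
        assume "inverse (real (Suc n)) *\<^sub>R i + x \<in> K"
        then have "- (inverse (real (Suc n)) *\<^sub>R i) + (inverse (real (Suc n)) *\<^sub>R i + x)
            \<in> (+) (- (inverse (real (Suc n)) *\<^sub>R i)) ` K" by blast
        with x show False by simp
      qed
    qed
    then show ?thesis
      using int lborel_integral_translate[OF meas] by (simp add: s_def)
  qed
  have "(\<lambda>n. \<integral>x. s n x \<partial>lborel) \<longlonglongrightarrow> (\<integral>x. \<gamma> x \<bullet> i \<partial>lborel)"
  proof (rule integral_dominated_convergence[where w = "\<lambda>x. indicator (cball 0 (R + norm i)) x * (L * norm i)"])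
    show "(\<lambda>x. \<gamma> x \<bullet> i) \<in> borel_measurable lborel"
      using D(3) by (auto intro!: borel_measurable_continuous_onI continuous_intros)
    show "s n \<in> borel_measurable lborel" for n
      unfolding s_def by measurable
    show "integrable lborel (\<lambda>x. indicator (cball 0 (R + norm i)) x * (L * norm i))"
      by (intro integrable_mult_left integrable_real_indicator emeasure_bounded_finite) auto
    show "AE x in lborel. (\<lambda>n. s n x) \<longlonglongrightarrow> \<gamma> x \<bullet> i"
    proof (rule AE_I2)
      fix x
      have "((\<lambda>t. \<phi> (t *\<^sub>R i + x)) has_derivative (\<lambda>t. \<gamma> (0 *\<^sub>R i + x) \<bullet> (t *\<^sub>R i + 0))) (at 0)"
        by (rule has_derivative_compose[where g = \<phi>, OF _ D(2)]) (auto intro!: derivative_eq_intros)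
      then have "((\<lambda>t. \<phi> (t *\<^sub>R i + x)) has_real_derivative (\<gamma> x \<bullet> i)) (at 0)"
        unfolding has_field_derivative_def by (rule has_derivative_eq_rhs) (auto simp: mult.commute)
      then have *: "((\<lambda>t. (\<phi> (t *\<^sub>R i + x) - \<phi> x) / t) \<longlongrightarrow> \<gamma> x \<bullet> i) (at 0)"
        by (simp add: has_field_derivative_iff)
      have "filterlim (\<lambda>n. inverse (real (Suc n))) (at 0) sequentially"
        using LIMSEQ_inverse_real_of_nat by (simp add: filterlim_at)
      from filterlim_compose[OF * this]
      show "(\<lambda>n. s n x) \<longlonglongrightarrow> \<gamma> x \<bullet> i"
        by (simp add: s_def divide_inverse)
    qed
    fix n
    show "AE x in lborel. norm (s n x) \<le> indicator (cball 0 (R + norm i)) x * (L * norm i)"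
    proof (rule AE_I2)
      fix x
      have "\<bar>s n x\<bar> \<le> L * norm (inverse (real (Suc n)) *\<^sub>R i) * real (Suc n)"
        unfolding s_def abs_mult using lip[of "inverse (real (Suc n)) *\<^sub>R i + x" x]
        by (simp add: mult_right_mono)
      also have "\<dots> = L * norm i" by simp
      finally have 1: "\<bar>s n x\<bar> \<le> L * norm i" .
      have 2: "s n x = 0" if x: "x \<notin> cball 0 (R + norm i)"
      proof -
        have "norm i * 1 \<ge> norm i * inverse (real (Suc n))"
          by (intro mult_left_mono) (auto simp: field_simps)
        then have "norm (inverse (real (Suc n)) *\<^sub>R i) \<le> norm i" by (simp add: mult.commute)
        moreover have "norm x \<le> norm (inverse (real (Suc n)) *\<^sub>R i + x) + norm (inverse (real (Suc n)) *\<^sub>R i)"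
          using norm_triangle_ineq4[of "inverse (real (Suc n)) *\<^sub>R i + x" "inverse (real (Suc n)) *\<^sub>R i"]
          by (simp del: of_nat_Suc)
        moreover have "norm x > R + norm i" using x by auto
        ultimately have "norm (inverse (real (Suc n)) *\<^sub>R i + x) > R" "norm x > R"
          using norm_ge_zero[of i] by linarith+
        then have "x \<notin> K" "inverse (real (Suc n)) *\<^sub>R i + x \<notin> K" using R(2) by auto
        then show ?thesis using D(4) by (simp add: s_def)
      qed
      show "norm (s n x) \<le> indicator (cball 0 (R + norm i)) x * (L * norm i)"
        using 1 2 by (cases "x \<in> cball 0 (R + norm i)") auto
    qed
  qed
  then show ?thesis by (simp add: int_s LIMSEQ_const_iff)
qed

text \<open>
  The factor \<open>\<psi>\<close> need only be differentiable on a neighbourhood of \<open>K\<close>, because the product is zero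
  elsewhere whatever the values of \<open>\<psi>\<close> are.
\<close>

lemma C1c_mult:
  assumes C: "C1c K \<phi> \<gamma>" and D: "open D" "K \<subseteq> D"
    and \<psi>: "\<And>x. x \<in> D \<Longrightarrow> (\<psi> has_derivative (\<lambda>h. \<Psi> x \<bullet> h)) (at x)" "continuous_on D \<Psi>"
  shows "C1c K (\<lambda>x. \<phi> x * \<psi> x) (\<lambda>x. \<psi> x *\<^sub>R \<gamma> x + \<phi> x *\<^sub>R \<Psi> x)"
proof -
  note CD = C1cD[OF C]
  have K: "open (- K)" using CD(1) by (simp add: compact_imp_closed open_Compl)
  have cov: "D \<union> - K = UNIV" using D(2) by auto
  have z: "\<psi> x *\<^sub>R \<gamma> x + \<phi> x *\<^sub>R \<Psi> x = 0" if "x \<notin> K" for x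
    using C1c_grad_zero[OF C that] CD(4)[OF that] by simp
  have "((\<lambda>x. \<phi> x * \<psi> x) has_derivative (\<lambda>h. (\<psi> x *\<^sub>R \<gamma> x + \<phi> x *\<^sub>R \<Psi> x) \<bullet> h)) (at x)" for x
  proof (cases "x \<in> K")
    case True
    then have "x \<in> D" using D by auto
    show ?thesis
      by (rule has_derivative_eq_rhs[OF has_derivative_mult[OF CD(2) \<psi>(1)[OF \<open>x \<in> D\<close>]]])
        (auto simp: algebra_simps)
  next
    case False
    show ?thesis unfolding z[OF False]
    proof (rule has_derivative_transform_within_open[where s = "- K" and f = "\<lambda>_. 0"])
      show "((\<lambda>_. 0) has_derivative (\<lambda>h. 0 \<bullet> h)) (at x)" by simp
    qed (use False CD(4) K in auto)
  qed
  moreover have "continuous_on UNIV (\<lambda>x. \<psi> x *\<^sub>R \<gamma> x + \<phi> x *\<^sub>R \<Psi> x)"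
    unfolding cov[symmetric]
  proof (rule continuous_on_open_Un[OF D(1) K])
    have "continuous_on D \<psi>"
      using \<psi>(1) by (meson continuous_at_imp_continuous_on has_derivative_continuous)
    then show "continuous_on D (\<lambda>x. \<psi> x *\<^sub>R \<gamma> x + \<phi> x *\<^sub>R \<Psi> x)"
      using CD(3) C1c_continuous[OF C] \<psi>(2)
      by (intro continuous_intros) (auto intro: continuous_on_subset)
    have "continuous_on (- K) (\<lambda>x. 0 :: 'a)" by simp
    then show "continuous_on (- K) (\<lambda>x. \<psi> x *\<^sub>R \<gamma> x + \<phi> x *\<^sub>R \<Psi> x)"
      by (rule continuous_on_eq) (use z in auto)
  qed
  ultimately show ?thesis using CD(1,4) by (auto simp: C1c_def)
qed

section \<open>Mollification\<close>

definition convolve :: "('a::euclidean_space \<Rightarrow> real) \<Rightarrow> ('a \<Rightarrow> real) \<Rightarrow> 'a \<Rightarrow> real" where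
  "convolve \<phi> \<eta> x = (\<integral>y. \<phi> y * \<eta> (x - y) \<partial>lborel)"

lemma continuous_grad_smooth: "smooth \<eta> \<Longrightarrow> continuous_on UNIV (grad \<eta>)"
  unfolding grad_def by (intro continuous_intros smooth_continuous smooth_partial_deriv)

lemma smooth_has_grad: "smooth \<eta> \<Longrightarrow> (\<eta> has_derivative (\<lambda>h. grad \<eta> x \<bullet> h)) (at x)"
  by (intro differentiable_has_grad smooth_differentiable)

lemma convolve_eq_integral_cbox:
  fixes \<phi> :: "'a::euclidean_space \<Rightarrow> real"
  assumes \<phi>: "continuous_on UNIV \<phi>" "\<And>x. x \<notin> cbox a b \<Longrightarrow> \<phi> x = 0" and \<eta>: "continuous_on UNIV \<eta>"
  shows "convolve \<phi> \<eta> x = integral (cbox a b) (\<lambda>y. \<phi> y * \<eta> (x - y))"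
    "(\<lambda>y. \<phi> y * \<eta> (x - y)) integrable_on cbox a b"
proof -
  have c: "continuous_on UNIV (\<lambda>y. \<phi> y * \<eta> (x - y))"
    by (intro continuous_intros \<phi> continuous_on_compose2[OF \<eta>]) auto
  have s: "set_integrable lborel (cbox a b) (\<lambda>y. \<phi> y * \<eta> (x - y))"
    unfolding set_integrable_def
    by (rule borel_integrable_compact) (use c continuous_on_subset in auto)
  have "convolve \<phi> \<eta> x = (LINT y:cbox a b|lborel. \<phi> y * \<eta> (x - y))"
    unfolding convolve_def set_lebesgue_integral_def
    by (rule Bochner_Integration.integral_cong) (use \<phi>(2) in \<open>auto simp: indicator_def\<close>)
  then show "convolve \<phi> \<eta> x = integral (cbox a b) (\<lambda>y. \<phi> y * \<eta> (x - y))"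
    using set_borel_integral_eq_integral(2)[OF s] by simp
  show "(\<lambda>y. \<phi> y * \<eta> (x - y)) integrable_on cbox a b"
    using set_borel_integral_eq_integral(1)[OF s] .
qed

lemma convolve_has_derivative:
  fixes \<phi> :: "'a::euclidean_space \<Rightarrow> real"
  assumes \<phi>: "continuous_on UNIV \<phi>" "compact K" "\<And>x. x \<notin> K \<Longrightarrow> \<phi> x = 0" and \<eta>: "smooth \<eta>"
  shows "\<exists>D. (convolve \<phi> \<eta> has_derivative D) (at x) \<and> (\<forall>i\<in>Basis. D i = convolve \<phi> (partial_deriv i \<eta>) x)"
proof -
  obtain a b where ab: "K \<subseteq> cbox a b"
    using bounded_subset_cbox_symmetric[OF compact_imp_bounded[OF \<phi>(2)]] by blast
  then have \<phi>0: "\<And>x. x \<notin> cbox a b \<Longrightarrow> \<phi> x = 0" using \<phi>(3) by auto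
  define fx where "fx x t = \<phi> t *\<^sub>R blinfun_inner_right (grad \<eta> (x - t))" for x t
  have app: "blinfun_apply (fx x t) h = \<phi> t * (grad \<eta> (x - t) \<bullet> h)" for x t h
    by (simp add: fx_def scaleR_blinfun.rep_eq)
  have cfx: "continuous_on (UNIV \<times> cbox a b) (\<lambda>(x, t). fx x t)"
    unfolding fx_def case_prod_beta
    by (intro continuous_intros continuous_on_compose2[OF \<phi>(1)]
        bounded_linear.continuous_on[OF bounded_linear_blinfun_inner_right]
        continuous_on_compose2[OF continuous_grad_smooth[OF \<eta>]]) auto
  have "((\<lambda>x. integral (cbox a b) (\<lambda>t. \<phi> t * \<eta> (x - t))) has_derivative
      blinfun_apply (integral (cbox a b) (fx x))) (at x within UNIV)"
  proof (rule leibniz_rule[OF _ _ cfx])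
    fix x t
    show "((\<lambda>x. \<phi> t * \<eta> (x - t)) has_derivative blinfun_apply (fx x t)) (at x within UNIV)"
      unfolding app
      by (rule has_derivative_eq_rhs[OF has_derivative_mult_right[OF has_derivative_compose[where g = \<eta>,
          OF _ smooth_has_grad[OF \<eta>]]]]) (auto intro!: derivative_eq_intros simp: app)
  next
    fix x show "(\<lambda>t. \<phi> t * \<eta> (x - t)) integrable_on cbox a b"
      by (rule convolve_eq_integral_cbox(2)[OF \<phi>(1) \<phi>0 smooth_continuous[OF \<eta>]])
  qed auto
  moreover have "(\<lambda>x. integral (cbox a b) (\<lambda>t. \<phi> t * \<eta> (x - t))) = convolve \<phi> \<eta>"
    using convolve_eq_integral_cbox(1)[OF \<phi>(1) \<phi>0 smooth_continuous[OF \<eta>]] by auto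
  moreover have "blinfun_apply (integral (cbox a b) (fx x)) i = convolve \<phi> (partial_deriv i \<eta>) x"
    if i: "i \<in> Basis" for i
  proof -
    have "continuous_on (cbox a b) (\<lambda>t. case (x, t) of (x, t) \<Rightarrow> fx x t)"
      by (rule continuous_on_compose2[OF cfx]) (auto intro!: continuous_intros)
    then have "continuous_on (cbox a b) (fx x)" by simp
    then have "fx x integrable_on cbox a b" by (rule integrable_continuous)
    then have "blinfun_apply (integral (cbox a b) (fx x)) i
        = integral (cbox a b) (\<lambda>t. \<phi> t * partial_deriv i \<eta> (x - t))"
      using i by (simp add: blinfun_apply_integral app grad_inner_Basis)
    then show ?thesis
      using convolve_eq_integral_cbox(1)[OF \<phi>(1) \<phi>0 smooth_continuous[OF smooth_partial_deriv[OF \<eta> i]]]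
      by simp
  qed
  ultimately show ?thesis by auto
qed

lemma partial_deriv_convolve:
  fixes \<phi> :: "'a::euclidean_space \<Rightarrow> real"
  assumes \<phi>: "continuous_on UNIV \<phi>" "compact K" "\<And>x. x \<notin> K \<Longrightarrow> \<phi> x = 0" and \<eta>: "smooth \<eta>" "i \<in> Basis"
  shows "partial_deriv i (convolve \<phi> \<eta>) = convolve \<phi> (partial_deriv i \<eta>)"
proof
  fix x
  obtain D where D: "(convolve \<phi> \<eta> has_derivative D) (at x)" "\<forall>i\<in>Basis. D i = convolve \<phi> (partial_deriv i \<eta>) x"
    using convolve_has_derivative[OF assms(1-4), of x] by blast
  show "partial_deriv i (convolve \<phi> \<eta>) x = convolve \<phi> (partial_deriv i \<eta>) x"
    using partial_deriv_eq[OF D(1), of i] D(2) \<eta>(2) by simp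
qed

lemma smooth_convolve:
  fixes \<phi> :: "'a::euclidean_space \<Rightarrow> real"
  assumes \<phi>: "continuous_on UNIV \<phi>" "compact K" "\<And>x. x \<notin> K \<Longrightarrow> \<phi> x = 0" and \<eta>: "smooth \<eta>"
  shows "smooth (convolve \<phi> \<eta>)"
proof (rule smooth_coinduct[where Q = "\<lambda>w. \<exists>\<eta>. smooth \<eta> \<and> w = convolve \<phi> \<eta>"])
  show "\<exists>\<eta>'. smooth \<eta>' \<and> convolve \<phi> \<eta> = convolve \<phi> \<eta>'" using \<eta> by blast
  show "w differentiable (at x)" if w: "\<exists>\<eta>. smooth \<eta> \<and> w = convolve \<phi> \<eta>" for w and x :: 'a
    using w convolve_has_derivative[OF \<phi>, where x = x] by (auto simp: differentiable_def)
  show "\<exists>\<eta>. smooth \<eta> \<and> partial_deriv i w = convolve \<phi> \<eta>"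
    if w: "\<exists>\<eta>. smooth \<eta> \<and> w = convolve \<phi> \<eta>" and "i \<in> Basis" for w and i :: 'a
    using w partial_deriv_convolve[OF \<phi> _ \<open>i \<in> Basis\<close>] smooth_partial_deriv[OF _ \<open>i \<in> Basis\<close>] by metis
qed

text \<open>
  The derivative is moved from the kernel to the function by integrating by parts in \<open>y\<close>. Hence the gradient of
  a mollified function is the mollified gradient, and one closeness estimate covers both.
\<close>

lemma convolve_partial_deriv_commute:
  fixes \<phi> :: "'a::euclidean_space \<Rightarrow> real"
  assumes C: "C1c K \<phi> \<gamma>" and \<eta>: "smooth \<eta>" and i: "i \<in> Basis"
  shows "convolve \<phi> (partial_deriv i \<eta>) x = convolve (\<lambda>y. \<gamma> y \<bullet> i) \<eta> x"
proof -
  note D = C1cD[OF C]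
  have "((\<lambda>y. \<eta> (x - y)) has_derivative (\<lambda>h. (- grad \<eta> (x - y)) \<bullet> h)) (at y)" for y
    by (rule has_derivative_eq_rhs[OF has_derivative_compose[where g = \<eta>, OF _ smooth_has_grad[OF \<eta>]]])
      (auto intro!: derivative_eq_intros)
  moreover have "continuous_on UNIV (\<lambda>y. - grad \<eta> (x - y))"
    by (intro continuous_intros continuous_on_compose2[OF continuous_grad_smooth[OF \<eta>]]) auto
  ultimately have "C1c K (\<lambda>y. \<phi> y * \<eta> (x - y)) (\<lambda>y. \<eta> (x - y) *\<^sub>R \<gamma> y + \<phi> y *\<^sub>R (- grad \<eta> (x - y)))"
    using C1c_mult[OF C, of UNIV "\<lambda>y. \<eta> (x - y)" "\<lambda>y. - grad \<eta> (x - y)"] by auto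
  from C1c_integral_zero[OF this, of i]
  have *: "(\<integral>y. (\<gamma> y \<bullet> i) * \<eta> (x - y) - \<phi> y * partial_deriv i \<eta> (x - y) \<partial>lborel) = 0"
    using i by (simp add: inner_add_left inner_diff_left grad_inner_Basis mult.commute)
  have "integrable lborel (\<lambda>y. (\<gamma> y \<bullet> i) * \<eta> (x - y))"
    by (rule compact_support_integrable[OF _ D(1)])
      (auto intro!: continuous_intros D(3) continuous_on_compose2[OF smooth_continuous[OF \<eta>]] simp: C1c_grad_zero[OF C])
  moreover have "integrable lborel (\<lambda>y. \<phi> y * partial_deriv i \<eta> (x - y))"
    by (rule compact_support_integrable[OF _ D(1)])
      (auto intro!: continuous_intros C1c_continuous[OF C]
         continuous_on_compose2[OF smooth_continuous[OF smooth_partial_deriv[OF \<eta> i]]] simp: D(4))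
  ultimately show ?thesis using * by (simp add: convolve_def)
qed

definition mollifier :: "real \<Rightarrow> ('a::euclidean_space \<Rightarrow> real) \<Rightarrow> bool" where
  "mollifier \<delta> \<eta> \<longleftrightarrow> smooth \<eta> \<and> (\<forall>x. 0 \<le> \<eta> x) \<and> (\<forall>x. \<delta> \<le> norm x \<longrightarrow> \<eta> x = 0) \<and> (\<integral>x. \<eta> x \<partial>lborel) = 1"

lemma mollifier_exists:
  assumes "\<delta> > 0"
  shows "\<exists>\<eta>::'a::euclidean_space \<Rightarrow> real. mollifier \<delta> \<eta>"
proof -
  define k where "k = (\<lambda>x::'a. flat_exp 0 (\<delta>\<^sup>2 - x \<bullet> x))"
  have sm: "smooth k" unfolding k_def by (rule smooth_bump)
  have nn: "k x \<ge> 0" for x by (simp add: k_def flat_exp_def)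
  have z: "k x = 0" if "\<delta> \<le> norm x" for x
  proof -
    have "\<delta>\<^sup>2 \<le> (norm x)\<^sup>2" using that assms by (intro power_mono) auto
    then show ?thesis by (simp add: k_def flat_exp_def power2_norm_eq_inner)
  qed
  have int: "integrable lborel k"
    by (rule compact_support_integrable[OF smooth_continuous[OF sm] compact_cball[of 0 \<delta>]]) (auto intro: z)
  have "(\<integral>x. k x \<partial>lborel) \<noteq> 0"
  proof
    assume "(\<integral>x. k x \<partial>lborel) = 0"
    then have ae: "AE x in lborel. k x = 0"
      using integral_nonneg_eq_0_iff_AE[OF int] nn by auto
    have pos: "k x \<noteq> 0" if "x \<in> ball 0 \<delta>" for x
    proof -
      have "(norm x)\<^sup>2 < \<delta>\<^sup>2" using that by (intro power_strict_mono) auto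
      then show ?thesis by (simp add: k_def flat_exp_def power2_norm_eq_inner)
    qed
    have "AE x in lborel. x \<notin> ball (0::'a) \<delta>"
      using ae by eventually_elim (use pos in auto)
    then have "ball (0::'a) \<delta> \<in> null_sets lborel"
      by (simp add: AE_iff_null_sets)
    then have "negligible (ball (0::'a) \<delta>)"
      by (simp add: negligible_iff_null_sets null_sets_completionI)
    then show False using open_not_negligible[of "ball (0::'a) \<delta>"] assms by auto
  qed
  then have c: "(\<integral>x. k x \<partial>lborel) > 0"
    using nn by (simp add: less_le integral_nonneg_AE)
  have "smooth (\<lambda>x. inverse (\<integral>x. k x \<partial>lborel) * k x + 0 * k x)"
    by (rule smooth_lincomb[OF sm sm])
  then have "mollifier \<delta> (\<lambda>x. inverse (\<integral>x. k x \<partial>lborel) * k x)"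
    using c nn z by (auto simp: mollifier_def)
  then show ?thesis by blast
qed

text \<open>
  The kernel is a probability density in the ball of radius \<open>\<delta>\<close>, so the convolution at \<open>x\<close> is
  an average of values that differ from \<open>\<psi> x\<close> by at most \<open>e\<close>.
\<close>

lemma convolve_close:
  fixes \<psi> :: "'a::euclidean_space \<Rightarrow> real"
  assumes \<psi>: "continuous_on UNIV \<psi>" "compact K" "\<And>x. x \<notin> K \<Longrightarrow> \<psi> x = 0"
    and \<eta>: "mollifier \<delta> \<eta>"
    and close: "\<And>x y. dist x y < \<delta> \<Longrightarrow> \<bar>\<psi> y - \<psi> x\<bar> \<le> e"
  shows "\<bar>convolve \<psi> \<eta> x - \<psi> x\<bar> \<le> e"
proof -
  have sm: "smooth \<eta>" and nn: "\<And>x. 0 \<le> \<eta> x" and z: "\<And>x. \<delta> \<le> norm x \<Longrightarrow> \<eta> x = 0"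
    and one: "(\<integral>x. \<eta> x \<partial>lborel) = 1" using \<eta> by (auto simp: mollifier_def)
  note cont = smooth_continuous[OF sm]
  have cx: "continuous_on UNIV (\<lambda>y. \<eta> (x - y))"
    by (intro continuous_on_compose2[OF cont]) (auto intro!: continuous_intros)
  have i1: "integrable lborel (\<lambda>y. \<eta> (x - y))"
    by (rule compact_support_integrable[OF cx compact_cball[of x \<delta>]]) (auto intro: z simp: dist_norm)
  have o1: "(\<integral>y. \<eta> (x - y) \<partial>lborel) = 1"
    using lborel_integral_reflect[of \<eta> x] one cont by (simp add: borel_measurable_continuous_onI)
  have i2: "integrable lborel (\<lambda>y. \<psi> y * \<eta> (x - y))"
    by (rule compact_support_integrable[OF _ \<psi>(2)]) (use \<psi> cx in \<open>auto intro!: continuous_intros\<close>)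
  have "convolve \<psi> \<eta> x - \<psi> x = (\<integral>y. \<psi> y * \<eta> (x - y) - \<psi> x * \<eta> (x - y) \<partial>lborel)"
    using i1 i2 o1 by (simp add: convolve_def)
  also have "\<bar>\<dots>\<bar> \<le> (\<integral>y. e * \<eta> (x - y) \<partial>lborel)"
  proof (rule integral_abs_bound[THEN order_trans], rule integral_mono)
    show "\<bar>\<psi> y * \<eta> (x - y) - \<psi> x * \<eta> (x - y)\<bar> \<le> e * \<eta> (x - y)" for y
    proof (cases "dist x y < \<delta>")
      case True
      have "\<bar>\<psi> y * \<eta> (x - y) - \<psi> x * \<eta> (x - y)\<bar> = \<bar>\<psi> y - \<psi> x\<bar> * \<eta> (x - y)"
        using nn[of "x - y"] by (simp add: abs_mult flip: left_diff_distrib)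
      then show ?thesis using close[OF True] nn by (simp add: mult_right_mono)
    next
      case False
      then show ?thesis using z[of "x - y"] by (simp add: dist_norm)
    qed
  qed (use i1 i2 in auto)
  also have "\<dots> = e" using o1 by simp
  finally show ?thesis .
qed

lemma compact_support_uniformly_continuous:
  fixes F :: "'a::euclidean_space \<Rightarrow> 'b::real_normed_vector"
  assumes F: "continuous_on UNIV F" "compact K" "\<And>x. x \<notin> K \<Longrightarrow> F x = 0" and e: "e > 0"
  obtains d where "d > 0" "\<And>x y. dist x y < d \<Longrightarrow> norm (F y - F x) \<le> e"
proof -
  obtain R where R: "K \<subseteq> cball 0 R"
    using compact_imp_bounded[OF F(2)] by (auto simp: bounded_pos subset_eq)
  have "uniformly_continuous_on (cball 0 (R + 1)) F"
    by (rule compact_uniformly_continuous) (use F(1) continuous_on_subset in auto)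
  then obtain d where d: "d > 0" "\<And>x y. x \<in> cball 0 (R + 1) \<Longrightarrow> y \<in> cball 0 (R + 1) \<Longrightarrow> dist y x < d \<Longrightarrow> dist (F y) (F x) < e"
    unfolding uniformly_continuous_on_def using e by metis
  show ?thesis
  proof (rule that[of "min d 1"])
    fix x y :: 'a assume xy: "dist x y < min d 1"
    show "norm (F y - F x) \<le> e"
    proof (cases "x \<in> K \<or> y \<in> K")
      case True
      then have "norm x \<le> R \<or> norm y \<le> R" using R by auto
      moreover have "\<bar>norm x - norm y\<bar> \<le> 1"
        using xy norm_triangle_ineq3[of x y] by (simp add: dist_norm)
      ultimately have "x \<in> cball 0 (R + 1)" "y \<in> cball 0 (R + 1)" by auto
      then show ?thesis using d(2)[of x y] xy by (simp add: dist_norm norm_minus_commute less_imp_le)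
    next
      case False
      then show ?thesis using F(3) e by auto
    qed
  qed (use d in auto)
qed

lemma compact_thicken:
  fixes K :: "'a::euclidean_space set"
  assumes K: "compact K" "K \<subseteq> \<Omega>" "open \<Omega>"
  obtains e K' where "e > 0" "compact K'" "(\<Union>x\<in>K. ball x e) \<subseteq> K'" "K' \<subseteq> \<Omega>"
proof -
  obtain \<epsilon> where \<epsilon>: "\<epsilon> > 0" "(\<Union>x\<in>K. ball x \<epsilon>) \<subseteq> \<Omega>"
    using compact_subset_open_imp_ball_epsilon_subset[OF K(1,3,2)] by blast
  define K' where "K' = (\<Union>x\<in>K. \<Union>y\<in>cball 0 (\<epsilon>/2). {x + y})"
  have "compact K'" unfolding K'_def by (intro compact_sums' K compact_cball)
  moreover have "K' \<subseteq> \<Omega>"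
  proof
    fix z assume "z \<in> K'"
    then obtain x y where "x \<in> K" "norm y \<le> \<epsilon> / 2" "z = x + y" by (auto simp: K'_def)
    then have "z \<in> ball x \<epsilon>" using \<epsilon>(1) by (auto simp: dist_norm)
    then show "z \<in> \<Omega>" using \<epsilon>(2) \<open>x \<in> K\<close> by blast
  qed
  moreover have "(\<Union>x\<in>K. ball x (\<epsilon>/2)) \<subseteq> K'"
  proof
    fix z assume "z \<in> (\<Union>x\<in>K. ball x (\<epsilon>/2))"
    then obtain x where x: "x \<in> K" "dist x z < \<epsilon>/2" by auto
    then have "z - x \<in> cball 0 (\<epsilon>/2)" by (simp add: dist_norm norm_minus_commute)
    then have "x + (z - x) \<in> K'" unfolding K'_def using x by (intro UN_I) auto
    then show "z \<in> K'" by simp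
  qed
  ultimately show ?thesis using that[of "\<epsilon>/2" K'] \<epsilon> by auto
qed

lemma test_function_convolve:
  fixes K :: "'a::euclidean_space set"
  assumes K: "compact K" "K \<subseteq> \<Omega>" "open \<Omega>"
  obtains d where "d > 0" "\<And>\<phi> \<eta> \<delta>. \<lbrakk>continuous_on UNIV \<phi>; \<And>x. x \<notin> K \<Longrightarrow> \<phi> x = 0; mollifier \<delta> \<eta>; \<delta> \<le> d\<rbrakk>
     \<Longrightarrow> convolve \<phi> \<eta> \<in> test_functions \<Omega>"
proof -
  obtain d K' where K': "d > 0" "compact K'" "(\<Union>x\<in>K. ball x d) \<subseteq> K'" "K' \<subseteq> \<Omega>"
    using compact_thicken[OF K] .
  show ?thesis
  proof (rule that[OF K'(1)])
    fix \<phi> \<eta> :: "'a \<Rightarrow> real" and \<delta>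
    assume \<phi>: "continuous_on UNIV \<phi>" "\<And>x. x \<notin> K \<Longrightarrow> \<phi> x = 0" and m: "mollifier \<delta> \<eta>" "\<delta> \<le> d"
    have zero: "convolve \<phi> \<eta> x = 0" if x: "x \<notin> K'" for x
    proof -
      have "\<phi> y * \<eta> (x - y) = 0" for y
      proof (cases "y \<in> K")
        case True
        then have "x \<notin> ball y d" using K'(3) x by blast
        then have "\<delta> \<le> norm (x - y)" using m(2) by (simp add: dist_norm norm_minus_commute)
        then show ?thesis using m(1) by (simp add: mollifier_def)
      qed (use \<phi>(2) in auto)
      then have eq: "(\<lambda>y. \<phi> y * \<eta> (x - y)) = (\<lambda>y. 0)" by (intro ext)
      show ?thesis unfolding convolve_def eq by simp
    qed
    have "closure {x. convolve \<phi> \<eta> x \<noteq> 0} \<subseteq> K'"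
      using zero K'(2) by (intro closure_minimal) (auto simp: compact_imp_closed)
    moreover from this have "compact (closure {x. convolve \<phi> \<eta> x \<noteq> 0})"
      using K'(2) by (metis closed_Int_compact closed_closure inf.absorb_iff1)
    moreover have "smooth (convolve \<phi> \<eta>)"
      by (rule smooth_convolve[OF \<phi>(1) K(1) \<phi>(2)]) (use m in \<open>auto simp: mollifier_def\<close>)
    ultimately show "convolve \<phi> \<eta> \<in> test_functions \<Omega>"
      using K'(4) by (auto simp: test_functions_def smooth_def)
  qed
qed

lemma continuous_test_function_approx:
  fixes \<phi> :: "'a::euclidean_space \<Rightarrow> real"
  assumes \<phi>: "continuous_on UNIV \<phi>" "\<And>x. x \<notin> K \<Longrightarrow> \<phi> x = 0" and K: "compact K" "K \<subseteq> \<Omega>" "open \<Omega>" and e: "e > 0"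
  shows "\<exists>\<psi>\<in>test_functions \<Omega>. \<forall>x. \<bar>\<psi> x - \<phi> x\<bar> \<le> e"
proof -
  obtain d where d: "d > 0" "\<And>\<phi> \<eta> \<delta>. \<lbrakk>continuous_on UNIV \<phi>; \<And>x. x \<notin> K \<Longrightarrow> \<phi> x = 0; mollifier \<delta> \<eta>; \<delta> \<le> d\<rbrakk>
     \<Longrightarrow> convolve \<phi> \<eta> \<in> test_functions \<Omega>"
    using test_function_convolve[OF K] by blast
  obtain d' where d': "d' > 0" "\<And>x y. dist x y < d' \<Longrightarrow> norm (\<phi> y - \<phi> x) \<le> e"
    using compact_support_uniformly_continuous[OF \<phi>(1) K(1) \<phi>(2) e] by blast
  obtain \<eta> :: "'a \<Rightarrow> real" where \<eta>: "mollifier (min d d') \<eta>"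
    using mollifier_exists[of "min d d'"] d d' by auto
  have "convolve \<phi> \<eta> \<in> test_functions \<Omega>" using d(2)[OF \<phi> \<eta>] by auto
  moreover have "\<bar>convolve \<phi> \<eta> x - \<phi> x\<bar> \<le> e" for x
    by (rule convolve_close[OF \<phi>(1) K(1) \<phi>(2) \<eta>]) (use d' in auto)
  ultimately show ?thesis by blast
qed

lemma C1c_test_function_approx:
  fixes \<phi> :: "'a::euclidean_space \<Rightarrow> real"
  assumes C: "C1c K \<phi> \<gamma>" and K: "K \<subseteq> \<Omega>" "open \<Omega>" and e: "e > 0"
  shows "\<exists>\<psi>\<in>test_functions \<Omega>. \<forall>x. \<bar>\<psi> x - \<phi> x\<bar> \<le> e \<and> norm (grad \<psi> x - \<gamma> x) \<le> e"
proof -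
  note D = C1cD[OF C]
  have cont: "continuous_on UNIV \<phi>" by (rule C1c_continuous[OF C])
  \<comment> \<open>The norm of a gradient is bounded by the sum of its \<open>DIM('a)\<close> components.\<close>
  define e' where "e' = e / DIM('a)"
  have e': "e' > 0" using e by (simp add: e'_def)
  obtain d where d: "d > 0" "\<And>\<phi> \<eta> \<delta>. \<lbrakk>continuous_on UNIV \<phi>; \<And>x. x \<notin> K \<Longrightarrow> \<phi> x = 0; mollifier \<delta> \<eta>; \<delta> \<le> d\<rbrakk>
     \<Longrightarrow> convolve \<phi> \<eta> \<in> test_functions \<Omega>"
    using test_function_convolve[OF D(1) K] by blast
  obtain d1 where d1: "d1 > 0" "\<And>x y. dist x y < d1 \<Longrightarrow> norm (\<phi> y - \<phi> x) \<le> e"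
    using compact_support_uniformly_continuous[OF cont D(1,4) e] by blast
  obtain d2 where d2: "d2 > 0" "\<And>x y. dist x y < d2 \<Longrightarrow> norm (\<gamma> y - \<gamma> x) \<le> e'"
    using compact_support_uniformly_continuous[OF D(3,1) C1c_grad_zero[OF C] e'] by blast
  obtain \<eta> :: "'a \<Rightarrow> real" where \<eta>: "mollifier (min d (min d1 d2)) \<eta>"
    using mollifier_exists[of "min d (min d1 d2)"] d d1 d2 by auto
  then have sm: "smooth \<eta>" by (simp add: mollifier_def)
  have test: "convolve \<phi> \<eta> \<in> test_functions \<Omega>" using d(2)[OF cont D(4) \<eta>] by auto
  have 1: "\<bar>convolve \<phi> \<eta> x - \<phi> x\<bar> \<le> e" for x
    by (rule convolve_close[OF cont D(1,4) \<eta>]) (use d1 in auto)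
  have 2: "norm (grad (convolve \<phi> \<eta>) x - \<gamma> x) \<le> e" for x
  proof -
    have "\<bar>(grad (convolve \<phi> \<eta>) x - \<gamma> x) \<bullet> i\<bar> \<le> e'" if i: "i \<in> Basis" for i
    proof -
      have "grad (convolve \<phi> \<eta>) x \<bullet> i = convolve (\<lambda>y. \<gamma> y \<bullet> i) \<eta> x"
        using i convolve_partial_deriv_commute[OF C sm i] partial_deriv_convolve[OF cont D(1,4) sm i]
        by (simp add: grad_inner_Basis)
      moreover have "\<bar>convolve (\<lambda>y. \<gamma> y \<bullet> i) \<eta> x - \<gamma> x \<bullet> i\<bar> \<le> e'"
      proof (rule convolve_close[OF _ D(1) _ \<eta>])
        show "continuous_on UNIV (\<lambda>y. \<gamma> y \<bullet> i)" by (intro continuous_intros D)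
        show "\<gamma> x \<bullet> i = 0" if "x \<notin> K" for x using C1c_grad_zero[OF C that] by simp
        fix x y :: 'a assume "dist x y < min d (min d1 d2)"
        then have "norm (\<gamma> y - \<gamma> x) \<le> e'" by (intro d2) auto
        moreover have "\<bar>(\<gamma> y - \<gamma> x) \<bullet> i\<bar> \<le> norm (\<gamma> y - \<gamma> x)" using i by (rule Basis_le_norm)
        ultimately show "\<bar>\<gamma> y \<bullet> i - \<gamma> x \<bullet> i\<bar> \<le> e'" by (simp add: inner_diff_left)
      qed
      ultimately show ?thesis by (simp add: inner_diff_left)
    qed
    then have "(\<Sum>i\<in>Basis. \<bar>(grad (convolve \<phi> \<eta>) x - \<gamma> x) \<bullet> i\<bar>) \<le> (\<Sum>i\<in>(Basis::'a set). e')"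
      by (intro sum_mono)
    also have "\<dots> = e" by (simp add: e'_def)
    finally show ?thesis by (rule order_trans[OF norm_le_l1])
  qed
  from test 1 2 show ?thesis by blast
qed

lemma test_function_C1c:
  assumes "\<phi> \<in> test_functions \<Omega>"
  obtains K where "C1c K \<phi> (grad \<phi>)" "K \<subseteq> \<Omega>"
proof -
  have sm: "smooth \<phi>" using assms by (auto simp: test_functions_def smooth_def)
  have "C1c (closure {x. \<phi> x \<noteq> 0}) \<phi> (grad \<phi>)"
    unfolding C1c_def using assms smooth_has_grad[OF sm] continuous_grad_smooth[OF sm] closure_subset[of "{x. \<phi> x \<noteq> 0}"]
    by (auto simp: test_functions_def)
  with assms that show ?thesis by (auto simp: test_functions_def)
qed


section \<open>The fundamental lemma of the calculus of variations\<close>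

text \<open>
  Up to a null set \<open>S\<close> is a countable union of compact sets, and on each of them the positive function
  \<open>h\<close> has integral zero.
\<close>

lemma null_set_if_compact_integrals_zero:
  fixes h :: "'a::euclidean_space \<Rightarrow> real"
  assumes S: "S \<in> sets lebesgue" and pos: "\<And>x. x \<in> S \<Longrightarrow> h x > 0"
    and int: "\<And>K. compact K \<Longrightarrow> K \<subseteq> S \<Longrightarrow> integrable lebesgue (\<lambda>x. indicator K x * h x)"
    and zero: "\<And>K. compact K \<Longrightarrow> K \<subseteq> S \<Longrightarrow> (\<integral>x. indicator K x * h x \<partial>lebesgue) = 0"
  shows "S \<in> null_sets lebesgue"
proof -
  obtain C T where CT: "fsigma C" "T \<in> null_sets lebesgue" "C \<union> T = S" "disjnt C T"
    using lebesgue_set_almost_fsigma[OF S] .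
  then obtain F where F: "range F \<subseteq> Collect compact" "C = \<Union>(range (F::nat \<Rightarrow> _))"
    using fsigma_Union_compact by metis
  have "F n \<in> null_sets lebesgue" for n
  proof -
    have n: "compact (F n)" "F n \<subseteq> S" using F CT by auto
    have "AE x in lebesgue. indicator (F n) x * h x = 0"
      using integral_nonneg_eq_0_iff_AE[OF int[OF n]] zero[OF n] pos n(2)
      by (force simp: indicator_def)
    then have "AE x in lebesgue. x \<notin> F n"
      by eventually_elim (use n(2) pos in \<open>force simp: indicator_def split: if_splits\<close>)
    then show ?thesis
      using n(1) by (simp add: AE_iff_null_sets compact_imp_closed borel_closed)
  qed
  then have "C \<in> null_sets lebesgue" unfolding F(2) by (intro null_sets_UN)
  then show ?thesis using CT by (metis null_sets.Un)
qed

locale bounded_domain =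
  fixes \<Omega> :: "'a::euclidean_space set"
  assumes open_domain: "open \<Omega>" and bounded_domain: "bounded \<Omega>"
begin

abbreviation M :: "'a measure" where "M \<equiv> lebesgue_on \<Omega>"

lemma sets_domain [measurable, simp]: "\<Omega> \<in> sets lebesgue"
  using open_domain by (simp add: borel_open)

lemma finite_measure_M: "finite_measure M"
proof (rule finite_measureI)
  have "emeasure lborel \<Omega> < \<infinity>"
    by (rule emeasure_bounded_finite[OF bounded_domain])
  then show "emeasure M (space M) \<noteq> \<infinity>"
    using open_domain by (simp add: emeasure_restrict_space borel_open)
qed

lemma integrable_const_M [simp]: "integrable M (\<lambda>x. c :: real)"
  by (simp add: finite_measure.integrable_const finite_measure_M)

lemma AE_M_I: "(\<And>x. x \<in> \<Omega> \<Longrightarrow> P x) \<Longrightarrow> AE x in M. P x"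
  by (rule AE_I2) simp

lemma continuous_measurable_M:
  assumes "continuous_on \<Omega> (F :: 'a \<Rightarrow> 'b::euclidean_space)"
  shows "F \<in> borel_measurable M"
  by (rule continuous_imp_measurable_on_sets_lebesgue[OF assms sets_domain])

lemma continuous_UNIV_measurable_M:
  assumes "continuous_on UNIV (F :: 'a \<Rightarrow> 'b::euclidean_space)"
  shows "F \<in> borel_measurable M"
  using assms continuous_measurable_M continuous_on_subset by blast

lemma measurable_cong_AE_M:
  fixes F :: "'a \<Rightarrow> 'b::euclidean_space"
  assumes F: "F \<in> borel_measurable M" and ae: "AE x in M. F x = G x"
  shows "G \<in> borel_measurable M"
proof -
  have "(\<lambda>x. indicator \<Omega> x *\<^sub>R F x) \<in> borel_measurable lebesgue"
    using F by (simp add: borel_measurable_restrict_space_iff)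
  moreover have "AE x in lebesgue. indicator \<Omega> x *\<^sub>R F x = indicator \<Omega> x *\<^sub>R G x"
    using ae by (simp add: AE_restrict_space_iff) (auto simp: indicator_def elim: eventually_mono)
  ultimately have "(\<lambda>x. indicator \<Omega> x *\<^sub>R G x) \<in> borel_measurable lebesgue"
    by (rule borel_measurable_AE)
  then show ?thesis by (simp add: borel_measurable_restrict_space_iff)
qed

lemma
  fixes F :: "'a \<Rightarrow> real"
  assumes F: "F \<in> borel_measurable borel" "\<And>x. x \<notin> \<Omega> \<Longrightarrow> F x = 0"
  shows integral_M_eq_lborel: "(\<integral>x. F x \<partial>M) = (\<integral>x. F x \<partial>lborel)"
    and integrable_M_iff_lborel: "integrable M F \<longleftrightarrow> integrable lborel F"
proof -
  have eq: "(\<lambda>x. indicator \<Omega> x *\<^sub>R F x) = F"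
    by (rule ext) (use F(2) in \<open>auto split: split_indicator\<close>)
  have F': "F \<in> borel_measurable lborel" using F(1) by simp
  show "(\<integral>x. F x \<partial>M) = (\<integral>x. F x \<partial>lborel)"
    using integral_completion[OF F']
    by (simp only: integral_restrict_space[OF sets.Int[OF sets_domain sets.top]] eq)
  show "integrable M F \<longleftrightarrow> integrable lborel F"
    using integrable_completion[OF F']
    by (simp only: integrable_restrict_space[OF sets.Int[OF sets_domain sets.top]] eq)
qed

text \<open>
  The set where the inequality fails is open. This upgrades the almost everywhere hypotheses on the
  nonlinearity to pointwise bounds for Laplacians.
\<close>

lemma continuous_AE_le_imp_le:
  fixes F :: "'a \<Rightarrow> real"
  assumes "continuous_on \<Omega> F" "AE x in M. F x \<le> 0" "x \<in> \<Omega>"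
  shows "F x \<le> 0"
proof (rule ccontr)
  let ?U = "\<Omega> \<inter> F -` {0<..}"
  assume "\<not> F x \<le> 0"
  then have "x \<in> ?U" using assms by auto
  moreover have op: "open ?U"
    by (rule continuous_open_preimage[OF assms(1) open_domain]) auto
  moreover have "?U \<in> null_sets lebesgue"
  proof -
    have "AE x in lebesgue. x \<notin> ?U"
      using assms(2) by (simp add: AE_restrict_space_iff) (auto elim: eventually_mono)
    then show ?thesis using op by (simp add: AE_iff_null_sets borel_open)
  qed
  ultimately show False
    using open_not_negligible[OF op] by (auto simp: negligible_iff_null_sets)
qed

lemma integrable_compact_times_bounded:
  fixes h \<phi> :: "'a \<Rightarrow> real"
  assumes "integrable M (\<lambda>x. indicator K x * h x)" "h \<in> borel_measurable M" "\<phi> \<in> borel_measurable M"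
    and "\<And>x. x \<notin> K \<Longrightarrow> \<phi> x = 0" "\<And>x. \<bar>\<phi> x\<bar> \<le> B"
  shows "integrable M (\<lambda>x. h x * \<phi> x)"
proof (rule Bochner_Integration.integrable_bound)
  show "integrable M (\<lambda>x. B * (indicator K x * h x))" using assms(1) by simp
  show "(\<lambda>x. h x * \<phi> x) \<in> borel_measurable M" using assms(2,3) by measurable
  show "AE x in M. norm (h x * \<phi> x) \<le> norm (B * (indicator K x * h x))"
  proof (rule AE_I2)
    fix x
    have "0 \<le> B" using assms(5)[of x] by linarith
    then show "norm (h x * \<phi> x) \<le> norm (B * (indicator K x * h x))"
      using assms(4,5)[of x] by (cases "x \<in> K") (auto simp: abs_mult mult.commute mult_left_mono mult_right_mono)
  qed
qed

text \<open>
  The indicator function of \<open>K\<close> is the pointwise limit of uniformly bounded test functions with supports in one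
  compact subset of the domain, so that local integrability of \<open>h\<close> suffices for dominated
  convergence.
\<close>

lemma integral_compact_zero:
  fixes h :: "'a \<Rightarrow> real"
  assumes h: "h \<in> borel_measurable M"
    and int: "\<And>K. compact K \<Longrightarrow> K \<subseteq> \<Omega> \<Longrightarrow> integrable M (\<lambda>x. indicator K x * h x)"
    and zero: "\<And>\<phi>. \<phi> \<in> test_functions \<Omega> \<Longrightarrow> (\<integral>x. h x * \<phi> x \<partial>M) = 0"
    and K: "compact K" "K \<subseteq> \<Omega>"
  shows "(\<integral>x. indicator K x * h x \<partial>M) = 0"
proof (cases "K = {}")
  case True
  then show ?thesis by simp
next
  case False
  obtain e L where L: "e > 0" "compact L" "(\<Union>x\<in>K. ball x e) \<subseteq> L" "L \<subseteq> \<Omega>"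
    using compact_thicken[OF K open_domain] .
  obtain e' L' where L': "e' > 0" "compact L'" "(\<Union>x\<in>L. ball x e') \<subseteq> L'" "L' \<subseteq> \<Omega>"
    using compact_thicken[OF L(2,4) open_domain] .
  let ?U = "\<Union>x\<in>L. ball x e'"
  have U: "open ?U" "L \<subseteq> ?U" using L'(1) by auto
  obtain N :: nat where N: "inverse (real (Suc N)) < e"
    using reals_Archimedean[OF L(1)] by blast
  \<comment> \<open>Continuous cutoffs that decrease to the indicator function of \<open>K\<close>; the shift by
    \<open>N\<close> keeps all of them zero outside \<open>L\<close>.\<close>
  define \<psi> where "\<psi> n x = max 0 (1 - real (Suc N + n) * infdist x K)" for n x
  have cont: "continuous_on UNIV (\<psi> n)" for n
    unfolding \<psi>_def by (intro continuous_intros)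
  have \<psi>0: "\<psi> n x = 0" if "x \<notin> L" for n x
  proof -
    have "infdist x K \<ge> e"
    proof (rule ccontr)
      assume "\<not> infdist x K \<ge> e"
      moreover obtain y where "y \<in> K" "infdist x K = dist x y"
        using infdist_attains_inf[OF compact_imp_closed[OF K(1)] False] by blast
      ultimately have "x \<in> ball y e" by (simp add: dist_commute)
      then show False using \<open>y \<in> K\<close> L(3) that by blast
    qed
    then have "infdist x K \<ge> inverse (real (Suc N))" using N by simp
    then have "real (Suc N) * infdist x K \<ge> 1" by (simp add: field_simps)
    moreover have "real (Suc N + n) * infdist x K \<ge> real (Suc N) * infdist x K"
      by (intro mult_right_mono) (auto simp: infdist_nonneg)
    ultimately show ?thesis by (simp add: \<psi>_def del: of_nat_Suc of_nat_add)
  qed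
  have \<psi>1: "\<bar>\<psi> n x\<bar> \<le> 1" for n x
    by (auto simp: \<psi>_def infdist_nonneg simp del: of_nat_Suc of_nat_add)
  have \<psi>_lim: "(\<lambda>n. \<psi> n x) \<longlonglongrightarrow> indicator K x" for x
  proof (cases "x \<in> K")
    case True
    then show ?thesis by (simp add: \<psi>_def)
  next
    case False
    then have d: "infdist x K > 0"
      using infdist_pos_not_in_closed[OF compact_imp_closed[OF K(1)] \<open>K \<noteq> {}\<close>] by blast
    obtain m :: nat where m: "1 / infdist x K < real m" using reals_Archimedean2 by blast
    have "\<psi> n x = 0" if "n \<ge> m" for n
    proof -
      have "1 \<le> real m * infdist x K" using m d by (simp add: field_simps)
      also have "\<dots> \<le> real (Suc N + n) * infdist x K"
        using d that by (intro mult_right_mono) auto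
      finally show ?thesis by (simp add: \<psi>_def del: of_nat_Suc of_nat_add)
    qed
    then have "\<forall>\<^sub>F n in sequentially. 0 = \<psi> n x"
      by (auto simp: eventually_sequentially)
    then have "(\<lambda>n. \<psi> n x) \<longlonglongrightarrow> 0" by (rule Lim_transform_eventually[OF tendsto_const])
    then show ?thesis using False by simp
  qed
  have "\<exists>\<phi>\<in>test_functions ?U. \<forall>x. \<bar>\<phi> x - \<psi> n x\<bar> \<le> inverse (real (Suc n))" for n
    by (rule continuous_test_function_approx[OF cont \<psi>0 L(2) U(2,1)]) auto
  then obtain \<phi> where \<phi>: "\<And>n. \<phi> n \<in> test_functions ?U" "\<And>n x. \<bar>\<phi> n x - \<psi> n x\<bar> \<le> inverse (real (Suc n))"
    by metis
  have sub: "?U \<subseteq> \<Omega>" using L'(3,4) by (rule order_trans)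
  have test: "\<phi> n \<in> test_functions \<Omega>" for n
    using \<phi>(1)[of n] sub unfolding test_functions_def by (blast intro: order_trans)
  have \<phi>0: "\<phi> n x = 0" if "x \<notin> L'" for n x
  proof -
    obtain S where "C1c S (\<phi> n) (grad (\<phi> n))" "S \<subseteq> ?U" using test_function_C1c[OF \<phi>(1)] .
    then show ?thesis using C1cD(4) L'(3) that by blast
  qed
  have \<phi>2: "\<bar>\<phi> n x\<bar> \<le> 2" for n x
  proof -
    have "inverse (real (Suc n)) \<le> 1" by (simp add: inverse_le_1_iff)
    then show ?thesis using \<phi>(2)[of n x] \<psi>1[of n x] by linarith
  qed
  have \<phi>_lim: "(\<lambda>n. \<phi> n x) \<longlonglongrightarrow> indicator K x" for x
  proof -
    have "(\<lambda>n. \<phi> n x - \<psi> n x) \<longlonglongrightarrow> 0"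
      by (rule Lim_null_comparison[OF always_eventually LIMSEQ_inverse_real_of_nat])
        (use \<phi>(2) in \<open>simp del: of_nat_Suc\<close>)
    from tendsto_add[OF this \<psi>_lim[of x]] show ?thesis by simp
  qed
  have "(\<lambda>n. \<integral>x. h x * \<phi> n x \<partial>M) \<longlonglongrightarrow> (\<integral>x. indicator K x * h x \<partial>M)"
  proof (rule integral_dominated_convergence[where w = "\<lambda>x. 2 * \<bar>indicator L' x * h x\<bar>"])
    show "(\<lambda>x. indicator K x * h x) \<in> borel_measurable M"
      using int[OF K] by (rule borel_measurable_integrable)
    show "(\<lambda>x. h x * \<phi> n x) \<in> borel_measurable M" for n
    proof -
      obtain S where "C1c S (\<phi> n) (grad (\<phi> n))" using test_function_C1c[OF test] by blast
      then show ?thesis using h continuous_UNIV_measurable_M[OF C1c_continuous] by measurable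
    qed
    show "integrable M (\<lambda>x. 2 * \<bar>indicator L' x * h x\<bar>)" using int[OF L'(2,4)] by simp
    show "AE x in M. norm (h x * \<phi> n x) \<le> 2 * \<bar>indicator L' x * h x\<bar>" for n
    proof (rule AE_I2)
      fix x show "norm (h x * \<phi> n x) \<le> 2 * \<bar>indicator L' x * h x\<bar>"
        using \<phi>0[of x n] \<phi>2[of n x]
        by (cases "x \<in> L'") (auto simp: abs_mult mult.commute intro: mult_left_mono)
    qed
    show "AE x in M. (\<lambda>n. h x * \<phi> n x) \<longlonglongrightarrow> indicator K x * h x"
      using tendsto_mult[OF tendsto_const \<phi>_lim] by (simp add: mult.commute)
  qed
  then show ?thesis by (simp add: zero[OF test] LIMSEQ_const_iff)
qed

lemma AE_le_0_of_weak_zero: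
  fixes h :: "'a \<Rightarrow> real"
  assumes h: "h \<in> borel_measurable M"
    and int: "\<And>K. compact K \<Longrightarrow> K \<subseteq> \<Omega> \<Longrightarrow> integrable M (\<lambda>x. indicator K x * h x)"
    and zero: "\<And>\<phi>. \<phi> \<in> test_functions \<Omega> \<Longrightarrow> (\<integral>x. h x * \<phi> x \<partial>M) = 0"
  shows "AE x in M. h x \<le> 0"
proof -
  let ?S = "{x\<in>\<Omega>. h x > 0}"
  have "?S \<in> sets M" using h by measurable (simp add: pred_def)
  then have S: "?S \<in> sets lebesgue" by (simp add: sets_restrict_space_iff)
  have eq: "indicator \<Omega> x *\<^sub>R (indicator K x * h x) = indicator K x * h x" if "K \<subseteq> \<Omega>" for K x
    using that by (auto simp: indicator_def)
  have "?S \<in> null_sets lebesgue"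
  proof (rule null_set_if_compact_integrals_zero[OF S])
    fix K assume K: "compact K" "K \<subseteq> ?S"
    then have "K \<subseteq> \<Omega>" by auto
    note * = int[OF K(1) this] integral_compact_zero[OF h int zero K(1) this] eq[OF this]
    show "integrable lebesgue (\<lambda>x. indicator K x * h x)" "(\<integral>x. indicator K x * h x \<partial>lebesgue) = 0"
      using *(1,2) by (simp_all add: integrable_restrict_space integral_restrict_space *(3) del: scaleR_conv_of_real real_scaleR_def)
  qed auto
  then have "AE x in lebesgue. x \<notin> ?S" by (rule AE_not_in)
  then show ?thesis by (simp add: AE_restrict_space_iff) (auto elim: eventually_mono)
qed

lemma fundamental_lemma:
  fixes h :: "'a \<Rightarrow> real"
  assumes h: "h \<in> borel_measurable M"
    and int: "\<And>K. compact K \<Longrightarrow> K \<subseteq> \<Omega> \<Longrightarrow> integrable M (\<lambda>x. indicator K x * h x)"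
    and zero: "\<And>\<phi>. \<phi> \<in> test_functions \<Omega> \<Longrightarrow> (\<integral>x. h x * \<phi> x \<partial>M) = 0"
  shows "AE x in M. h x = 0"
proof -
  have "AE x in M. h x \<le> 0" by (rule AE_le_0_of_weak_zero[OF assms])
  moreover have "AE x in M. - h x \<le> 0"
    by (rule AE_le_0_of_weak_zero) (use assms in auto)
  ultimately show ?thesis by eventually_elim auto
qed

end


section \<open>Weak gradients and the Sobolev space\<close>

lemma integral_lincomb:
  fixes P Q :: "'a \<Rightarrow> real"
  assumes "integrable N P" "integrable N Q"
  shows "(\<integral>x. a * P x + b * Q x \<partial>N) = a * (\<integral>x. P x \<partial>N) + b * (\<integral>x. Q x \<partial>N)"
  using assms by simp

lemma L2D:
  assumes "u \<in> L2 \<Omega>"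
  shows "u \<in> borel_measurable (lebesgue_on \<Omega>)" "integrable (lebesgue_on \<Omega>) (\<lambda>x. (norm (u x))\<^sup>2)"
  using assms by (auto simp: L2_def)

lemma mult_le_sum_squares: "a * b \<le> a\<^sup>2 + b\<^sup>2" for a b :: real
  using zero_le_power2[of "a - b"] zero_le_power2[of a] zero_le_power2[of b]
  unfolding power2_diff by linarith

lemma norm_lincomb_square_le:
  fixes x y :: "'a::real_normed_vector"
  shows "(norm (a *\<^sub>R x + b *\<^sub>R y))\<^sup>2 \<le> 2 * a\<^sup>2 * (norm x)\<^sup>2 + 2 * b\<^sup>2 * (norm y)\<^sup>2"
proof -
  have "norm (a *\<^sub>R x + b *\<^sub>R y) \<le> \<bar>a\<bar> * norm x + \<bar>b\<bar> * norm y"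
    using norm_triangle_ineq[of "a *\<^sub>R x" "b *\<^sub>R y"] by simp
  then have "(norm (a *\<^sub>R x + b *\<^sub>R y))\<^sup>2 \<le> (\<bar>a\<bar> * norm x + \<bar>b\<bar> * norm y)\<^sup>2"
    by (intro power_mono) auto
  also have "\<dots> \<le> 2 * (\<bar>a\<bar> * norm x)\<^sup>2 + 2 * (\<bar>b\<bar> * norm y)\<^sup>2"
    using zero_le_power2[of "\<bar>a\<bar> * norm x - \<bar>b\<bar> * norm y"]
    by (simp add: power2_sum power2_diff)
  finally show ?thesis by (simp add: power_mult_distrib)
qed

lemma L2_lincomb:
  fixes u v :: "'a::euclidean_space \<Rightarrow> 'b::euclidean_space"
  assumes "u \<in> L2 \<Omega>" "v \<in> L2 \<Omega>"
  shows "(\<lambda>x. a *\<^sub>R u x + b *\<^sub>R v x) \<in> L2 \<Omega>"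
proof -
  note [measurable] = L2D(1)[OF assms(1)] L2D(1)[OF assms(2)]
  have "integrable (lebesgue_on \<Omega>) (\<lambda>x. (norm (a *\<^sub>R u x + b *\<^sub>R v x))\<^sup>2)"
  proof (rule Bochner_Integration.integrable_bound)
    show "integrable (lebesgue_on \<Omega>) (\<lambda>x. 2 * a\<^sup>2 * (norm (u x))\<^sup>2 + 2 * b\<^sup>2 * (norm (v x))\<^sup>2)"
      using L2D(2)[OF assms(1)] L2D(2)[OF assms(2)] by simp
    show "AE x in lebesgue_on \<Omega>. norm ((norm (a *\<^sub>R u x + b *\<^sub>R v x))\<^sup>2) \<le>
        norm (2 * a\<^sup>2 * (norm (u x))\<^sup>2 + 2 * b\<^sup>2 * (norm (v x))\<^sup>2)"
      using norm_lincomb_square_le by (intro AE_I2) (auto simp: abs_of_nonneg)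
  qed measurable
  then show ?thesis by (simp add: L2_def)
qed

lemma L2_inner_integrable:
  fixes u v :: "'a::euclidean_space \<Rightarrow> 'b::euclidean_space"
  assumes "u \<in> L2 \<Omega>" "v \<in> L2 \<Omega>"
  shows "integrable (lebesgue_on \<Omega>) (\<lambda>x. u x \<bullet> v x)"
proof (rule Bochner_Integration.integrable_bound)
  note [measurable] = L2D(1)[OF assms(1)] L2D(1)[OF assms(2)]
  show "integrable (lebesgue_on \<Omega>) (\<lambda>x. (norm (u x))\<^sup>2 + (norm (v x))\<^sup>2)"
    using L2D(2)[OF assms(1)] L2D(2)[OF assms(2)] by simp
  show "(\<lambda>x. u x \<bullet> v x) \<in> borel_measurable (lebesgue_on \<Omega>)" by measurable
  show "AE x in lebesgue_on \<Omega>. norm (u x \<bullet> v x) \<le> norm ((norm (u x))\<^sup>2 + (norm (v x))\<^sup>2)"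
  proof (rule AE_I2)
    fix x
    have "\<bar>u x \<bullet> v x\<bar> \<le> norm (u x) * norm (v x)" by (rule Cauchy_Schwarz_ineq2)
    also have "\<dots> \<le> (norm (u x))\<^sup>2 + (norm (v x))\<^sup>2"
      by (rule mult_le_sum_squares)
    finally show "norm (u x \<bullet> v x) \<le> norm ((norm (u x))\<^sup>2 + (norm (v x))\<^sup>2)" by simp
  qed
qed

lemma L2_mult_integrable:
  fixes u v :: "'a::euclidean_space \<Rightarrow> real"
  assumes "u \<in> L2 \<Omega>" "v \<in> L2 \<Omega>"
  shows "integrable (lebesgue_on \<Omega>) (\<lambda>x. u x * v x)"
  using L2_inner_integrable[OF assms] by simp

lemma L2_component:
  fixes g :: "'a::euclidean_space \<Rightarrow> 'b::euclidean_space"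
  assumes "g \<in> L2 \<Omega>" "i \<in> Basis"
  shows "(\<lambda>x. g x \<bullet> i) \<in> L2 \<Omega>"
proof -
  note [measurable] = L2D(1)[OF assms(1)]
  have "integrable (lebesgue_on \<Omega>) (\<lambda>x. (norm (g x \<bullet> i))\<^sup>2)"
  proof (rule Bochner_Integration.integrable_bound[OF L2D(2)[OF assms(1)]])
    show "AE x in lebesgue_on \<Omega>. norm ((norm (g x \<bullet> i))\<^sup>2) \<le> norm ((norm (g x))\<^sup>2)"
      using Basis_le_norm[OF assms(2)] by (intro AE_I2) (simp add: abs_le_square_iff[symmetric])
  qed measurable
  then show ?thesis by (simp add: L2_def)
qed

lemma continuous_on_compact_integrable:
  fixes F :: "'a::euclidean_space \<Rightarrow> real"
  assumes "continuous_on K F" "compact K" "\<And>x. x \<notin> K \<Longrightarrow> F x = 0"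
  shows "integrable lborel F" "F \<in> borel_measurable borel"
proof -
  have eq: "(\<lambda>x. indicator K x *\<^sub>R F x) = F" using assms(3) by (auto split: split_indicator)
  show "integrable lborel F" using borel_integrable_compact[OF assms(2,1)] by (simp only: eq)
  then show "F \<in> borel_measurable borel" using borel_measurable_integrable by fastforce
qed

context bounded_domain begin

lemma integral_affine:
  fixes P :: "'a \<Rightarrow> real"
  assumes "integrable M P"
  shows "(\<integral>x. a * P x + c \<partial>M) = a * (\<integral>x. P x \<partial>M) + c * measure M \<Omega>"
  using assms by simp

lemma bounded_L2:
  fixes F :: "'a \<Rightarrow> 'b::euclidean_space"
  assumes [measurable]: "F \<in> borel_measurable M" and B: "\<And>x. x \<in> \<Omega> \<Longrightarrow> norm (F x) \<le> B"
  shows "F \<in> L2 \<Omega>"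
proof -
  have "integrable M (\<lambda>x. (norm (F x))\<^sup>2)"
  proof (rule Bochner_Integration.integrable_bound[of M "\<lambda>_. B\<^sup>2"])
    show "AE x in M. norm ((norm (F x))\<^sup>2) \<le> norm (B\<^sup>2)"
      using B by (intro AE_M_I) (auto intro!: power_mono)
  qed auto
  then show ?thesis by (simp add: L2_def)
qed

lemma L2_indicator_integrable:
  fixes g :: "'a \<Rightarrow> 'b::euclidean_space"
  assumes g: "g \<in> L2 \<Omega>" and "compact K"
  shows "integrable M (\<lambda>x. indicator K x *\<^sub>R g x)"
proof (rule Bochner_Integration.integrable_bound)
  show "integrable M (\<lambda>x. 1 + (norm (g x))\<^sup>2)" using L2D(2)[OF g] by simp
  have "K \<in> sets lebesgue" using assms(2) by (simp add: borel_closed compact_imp_closed)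
  then have "(\<lambda>x. indicator K x :: real) \<in> borel_measurable M"
    by (intro borel_measurable_indicator' measurable_restrict_space1) auto
  then show "(\<lambda>x. indicator K x *\<^sub>R g x) \<in> borel_measurable M" using L2D(1)[OF g] by measurable
  show "AE x in M. norm (indicator K x *\<^sub>R g x) \<le> norm (1 + (norm (g x))\<^sup>2)"
  proof (rule AE_I2)
    fix x
    have "norm (g x) \<le> 1 + (norm (g x))\<^sup>2"
    proof -
      have "0 \<le> (norm (g x))\<^sup>2 + 1 - 2 * norm (g x)"
        using zero_le_power2[of "norm (g x) - 1"] by (simp add: power2_diff)
      then show ?thesis using norm_ge_zero[of "g x"] by linarith
    qed
    then show "norm (indicator K x *\<^sub>R g x) \<le> norm (1 + (norm (g x))\<^sup>2)"
      by (auto simp: indicator_def)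
  qed
qed

lemma C1c_L2:
  assumes C: "C1c K \<phi> \<gamma>"
  shows "\<phi> \<in> L2 \<Omega>" "\<gamma> \<in> L2 \<Omega>"
proof -
  obtain B where "\<And>x. norm (\<phi> x) \<le> B"
    using compact_support_bounded[OF C1c_continuous[OF C] C1cD(1,4)[OF C]] by blast
  then show "\<phi> \<in> L2 \<Omega>"
    by (intro bounded_L2[where B = B] continuous_UNIV_measurable_M C1c_continuous[OF C])
  obtain B where "\<And>x. norm (\<gamma> x) \<le> B"
    using compact_support_bounded[OF C1cD(3,1)[OF C] C1c_grad_zero[OF C]] by blast
  then show "\<gamma> \<in> L2 \<Omega>"
    by (intro bounded_L2[where B = B] continuous_UNIV_measurable_M C1cD(3)[OF C])
qed

lemma test_function_L2:
  assumes "\<phi> \<in> test_functions \<Omega>"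
  shows "\<phi> \<in> L2 \<Omega>" "grad \<phi> \<in> L2 \<Omega>" "i \<in> Basis \<Longrightarrow> partial_deriv i \<phi> \<in> L2 \<Omega>"
proof -
  obtain K where K: "C1c K \<phi> (grad \<phi>)" using test_function_C1c[OF assms] by blast
  show "\<phi> \<in> L2 \<Omega>" "grad \<phi> \<in> L2 \<Omega>" using C1c_L2[OF K] by auto
  then show "i \<in> Basis \<Longrightarrow> partial_deriv i \<phi> \<in> L2 \<Omega>"
    using L2_component[of "grad \<phi>" \<Omega> i] by (simp add: grad_inner_Basis)
qed

text \<open>
  Here \<open>D\<close> may be smaller than the domain over which one integrates: later \<open>\<psi>\<close> is differentiable only
  where some continuous function does not vanish.
\<close>

lemma C1c_integration_by_parts:
  assumes C: "C1c K \<phi> \<gamma>" "K \<subseteq> D"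
    and \<psi>: "\<And>x. x \<in> D \<Longrightarrow> (\<psi> has_derivative (\<lambda>h. \<Psi> x \<bullet> h)) (at x)" "continuous_on D \<Psi>"
    and D: "open D" "D \<subseteq> \<Omega>"
  shows "(\<integral>x. \<psi> x * (\<gamma> x \<bullet> i) \<partial>M) = - (\<integral>x. (\<Psi> x \<bullet> i) * \<phi> x \<partial>M)"
    "integrable M (\<lambda>x. \<psi> x * (\<gamma> x \<bullet> i))" "integrable M (\<lambda>x. (\<Psi> x \<bullet> i) * \<phi> x)"
proof -
  have P: "C1c K (\<lambda>x. \<phi> x * \<psi> x) (\<lambda>x. \<psi> x *\<^sub>R \<gamma> x + \<phi> x *\<^sub>R \<Psi> x)"
    by (rule C1c_mult[OF C(1) D(1) C(2) \<psi>])
  have "continuous_on D \<psi>"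
    using \<psi>(1) by (meson continuous_at_imp_continuous_on has_derivative_continuous)
  then have c: "continuous_on K \<psi>" "continuous_on K \<Psi>" using C(2) \<psi>(2) continuous_on_subset by blast+
  have out: "\<phi> x = 0" "\<gamma> x = 0" if "x \<notin> K" for x
    using that C1cD(4)[OF C(1)] C1c_grad_zero[OF C(1)] by auto
  have ck: "continuous_on K \<phi>" "continuous_on K \<gamma>"
    using C1c_continuous[OF C(1)] C1cD(3)[OF C(1)] continuous_on_subset by blast+
  note gen = continuous_on_compact_integrable[OF _ C1cD(1)[OF C(1)]]
  have 1: "integrable lborel (\<lambda>x. \<psi> x * (\<gamma> x \<bullet> i))" "(\<lambda>x. \<psi> x * (\<gamma> x \<bullet> i)) \<in> borel_measurable borel"
    by (rule gen; use c ck out in \<open>auto intro!: continuous_intros\<close>)+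
  have 2: "integrable lborel (\<lambda>x. (\<Psi> x \<bullet> i) * \<phi> x)" "(\<lambda>x. (\<Psi> x \<bullet> i) * \<phi> x) \<in> borel_measurable borel"
    by (rule gen; use c ck out in \<open>auto intro!: continuous_intros\<close>)+
  have o: "\<And>x. x \<notin> \<Omega> \<Longrightarrow> \<psi> x * (\<gamma> x \<bullet> i) = 0" "\<And>x. x \<notin> \<Omega> \<Longrightarrow> (\<Psi> x \<bullet> i) * \<phi> x = 0"
    using out C(2) D(2) by (metis mult_zero_left mult_zero_right inner_zero_left subsetD)+
  show "integrable M (\<lambda>x. \<psi> x * (\<gamma> x \<bullet> i))" "integrable M (\<lambda>x. (\<Psi> x \<bullet> i) * \<phi> x)"
    using 1 2 integrable_M_iff_lborel[OF 1(2) o(1)] integrable_M_iff_lborel[OF 2(2) o(2)] by auto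
  have "0 = (\<integral>x. \<psi> x * (\<gamma> x \<bullet> i) + (\<Psi> x \<bullet> i) * \<phi> x \<partial>lborel)"
    using C1c_integral_zero[OF P, of i] by (simp add: inner_add_left mult.commute)
  also have "\<dots> = (\<integral>x. \<psi> x * (\<gamma> x \<bullet> i) \<partial>lborel) + (\<integral>x. (\<Psi> x \<bullet> i) * \<phi> x \<partial>lborel)"
    using 1 2 by simp
  finally show "(\<integral>x. \<psi> x * (\<gamma> x \<bullet> i) \<partial>M) = - (\<integral>x. (\<Psi> x \<bullet> i) * \<phi> x \<partial>M)"
    using integral_M_eq_lborel[OF 1(2) o(1)] integral_M_eq_lborel[OF 2(2) o(2)] by simp
qed

text \<open>
  The comparison function \<open>G\<close> is only locally integrable, so that it may be a classical gradient whose square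
  integrability is not yet known.
\<close>

lemma weak_gradient_AE_eq:
  assumes wg: "has_weak_gradient \<Omega> u g" and G: "G \<in> borel_measurable M"
    and int: "\<And>K. compact K \<Longrightarrow> K \<subseteq> \<Omega> \<Longrightarrow> integrable M (\<lambda>x. indicator K x *\<^sub>R G x)"
    and parts: "\<And>\<phi> i. \<phi> \<in> test_functions \<Omega> \<Longrightarrow> i \<in> Basis \<Longrightarrow>
       (\<integral>x. u x * partial_deriv i \<phi> x \<partial>M) = - (\<integral>x. (G x \<bullet> i) * \<phi> x \<partial>M)"
  shows "AE x in M. g x = G x"
proof -
  have g: "g \<in> L2 \<Omega>" "g \<in> borel_measurable M" using wg by (auto simp: has_weak_gradient_def L2_def)
  have "AE x in M. (g x - G x) \<bullet> i = 0" if i: "i \<in> Basis" for i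
  proof (rule fundamental_lemma)
    show "(\<lambda>x. (g x - G x) \<bullet> i) \<in> borel_measurable M" using g(2) G by measurable
    have iG: "integrable M (\<lambda>x. indicator K x * (G x \<bullet> i))" if "compact K" "K \<subseteq> \<Omega>" for K
      using integrable_inner_left[OF int[OF that], of i] by simp
    have ig: "integrable M (\<lambda>x. indicator K x * (g x \<bullet> i))" if "compact K" for K
      using integrable_inner_left[OF L2_indicator_integrable[OF g(1) that], of i] by simp
    show "integrable M (\<lambda>x. indicator K x * ((g x - G x) \<bullet> i))" if "compact K" "K \<subseteq> \<Omega>" for K
      using Bochner_Integration.integrable_diff[OF ig[OF that(1)] iG[OF that]]
      by (simp add: inner_diff_left right_diff_distrib)
    fix \<phi> assume \<phi>: "\<phi> \<in> test_functions \<Omega>"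
    obtain K where K: "C1c K \<phi> (grad \<phi>)" "K \<subseteq> \<Omega>" using test_function_C1c[OF \<phi>] .
    obtain B where B: "\<And>x. norm (\<phi> x) \<le> B"
      using compact_support_bounded[OF C1c_continuous[OF K(1)] C1cD(1,4)[OF K(1)]] by blast
    have "integrable M (\<lambda>x. (G x \<bullet> i) * \<phi> x)"
      using B K G
      by (intro integrable_compact_times_bounded[OF iG[OF C1cD(1)[OF K(1)] K(2)] _ continuous_UNIV_measurable_M[OF C1c_continuous[OF K(1)]] C1cD(4)[OF K(1)]])
        auto
    moreover have "integrable M (\<lambda>x. (g x \<bullet> i) * \<phi> x)"
      by (rule L2_mult_integrable[OF L2_component[OF g(1) i] test_function_L2(1)[OF \<phi>]])
    ultimately have "(\<integral>x. ((g x - G x) \<bullet> i) * \<phi> x \<partial>M) = (\<integral>x. (g x \<bullet> i) * \<phi> x \<partial>M) - (\<integral>x. (G x \<bullet> i) * \<phi> x \<partial>M)"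
      by (simp add: inner_diff_left left_diff_distrib)
    also have "\<dots> = 0" using wg parts[OF \<phi> i] \<phi> i by (simp add: has_weak_gradient_def)
    finally show "(\<integral>x. ((g x - G x) \<bullet> i) * \<phi> x \<partial>M) = 0" .
  qed
  then have "AE x in M. \<forall>i\<in>Basis. (g x - G x) \<bullet> i = 0"
    by (subst AE_ball_countable) (auto simp: countable_finite)
  then show ?thesis
    by eventually_elim (metis euclidean_eq_iff inner_zero_left right_minus_eq)
qed

lemma has_weak_gradient_unique:
  assumes "has_weak_gradient \<Omega> u g" "has_weak_gradient \<Omega> u g'"
  shows "AE x in M. g x = g' x"
proof (rule weak_gradient_AE_eq[OF assms(1)])
  have g': "g' \<in> L2 \<Omega>" using assms(2) by (simp add: has_weak_gradient_def)
  then show "g' \<in> borel_measurable M" by (rule L2D)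
  show "integrable M (\<lambda>x. indicator K x *\<^sub>R g' x)" if "compact K" for K
    by (rule L2_indicator_integrable[OF g' that])
  show "(\<integral>x. u x * partial_deriv i \<phi> x \<partial>M) = - (\<integral>x. (g' x \<bullet> i) * \<phi> x \<partial>M)"
    if "\<phi> \<in> test_functions \<Omega>" "i \<in> Basis" for \<phi> i
    using assms(2) that by (simp add: has_weak_gradient_def)
qed

lemma has_weak_gradient_classical:
  assumes "has_weak_gradient \<Omega> u g"
    and D: "\<And>x. x \<in> \<Omega> \<Longrightarrow> (u has_derivative (\<lambda>h. G x \<bullet> h)) (at x)" "continuous_on \<Omega> G"
  shows "AE x in M. g x = G x"
proof (rule weak_gradient_AE_eq[OF assms(1)])
  show "G \<in> borel_measurable M" by (rule continuous_measurable_M[OF D(2)])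
  show "integrable M (\<lambda>x. indicator K x *\<^sub>R G x)" if "compact K" "K \<subseteq> \<Omega>" for K
  proof -
    have i: "integrable lborel (\<lambda>x. indicator K x *\<^sub>R G x)"
      by (rule borel_integrable_compact) (use that D continuous_on_subset in auto)
    have "(\<lambda>x. indicator \<Omega> x *\<^sub>R (indicator K x *\<^sub>R G x)) = (\<lambda>x. indicator K x *\<^sub>R G x)"
      by (rule ext) (use that in \<open>auto simp: indicator_def\<close>)
    then show ?thesis
      using i borel_measurable_integrable[OF i]
      by (simp only: integrable_restrict_space[OF sets.Int[OF sets_domain sets.top]] integrable_completion)
  qed
  show "(\<integral>x. u x * partial_deriv i \<phi> x \<partial>M) = - (\<integral>x. (G x \<bullet> i) * \<phi> x \<partial>M)"
    if \<phi>: "\<phi> \<in> test_functions \<Omega>" and i: "i \<in> Basis" for \<phi> i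
  proof -
    obtain K where K: "C1c K \<phi> (grad \<phi>)" "K \<subseteq> \<Omega>" using test_function_C1c[OF \<phi>] .
    show ?thesis using C1c_integration_by_parts(1)[OF K D open_domain subset_refl, of i] i by (simp add: grad_inner_Basis)
  qed
qed

lemma has_weak_gradient_cong_AE:
  assumes wg: "has_weak_gradient \<Omega> u g" and ae: "AE x in M. u x = v x"
  shows "has_weak_gradient \<Omega> v g"
proof -
  have u: "u \<in> L2 \<Omega>" using wg by (simp add: has_weak_gradient_def)
  have v: "v \<in> borel_measurable M" by (rule measurable_cong_AE_M[OF L2D(1)[OF u] ae])
  have "integrable M (\<lambda>x. (norm (v x))\<^sup>2)"
    by (rule integrable_cong_AE_imp[OF L2D(2)[OF u]]) (use v ae in \<open>auto elim: eventually_mono\<close>)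
  then have vL: "v \<in> L2 \<Omega>" using v by (simp add: L2_def)
  have "(\<integral>x. v x * partial_deriv i \<phi> x \<partial>M) = (\<integral>x. u x * partial_deriv i \<phi> x \<partial>M)"
    if "\<phi> \<in> test_functions \<Omega>" "i \<in> Basis" for \<phi> i
    using L2D(1)[OF test_function_L2(3)[OF that]] v L2D(1)[OF u] ae
    by (intro integral_cong_AE) (auto elim: eventually_mono)
  with wg vL show ?thesis by (simp add: has_weak_gradient_def)
qed

lemma has_weak_gradient_lincomb:
  assumes u: "has_weak_gradient \<Omega> u g" and v: "has_weak_gradient \<Omega> v h"
  shows "has_weak_gradient \<Omega> (\<lambda>x. a * u x + b * v x) (\<lambda>x. a *\<^sub>R g x + b *\<^sub>R h x)"
proof -
  have L: "u \<in> L2 \<Omega>" "g \<in> L2 \<Omega>" "v \<in> L2 \<Omega>" "h \<in> L2 \<Omega>"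
    using u v by (auto simp: has_weak_gradient_def)
  have "(\<integral>x. (a * u x + b * v x) * partial_deriv i \<phi> x \<partial>M) =
      - (\<integral>x. ((a *\<^sub>R g x + b *\<^sub>R h x) \<bullet> i) * \<phi> x \<partial>M)"
    if \<phi>: "\<phi> \<in> test_functions \<Omega>" and i: "i \<in> Basis" for \<phi> i
  proof -
    note t = test_function_L2[OF \<phi>]
    have "(\<integral>x. (a * u x + b * v x) * partial_deriv i \<phi> x \<partial>M) =
        a * (\<integral>x. u x * partial_deriv i \<phi> x \<partial>M) + b * (\<integral>x. v x * partial_deriv i \<phi> x \<partial>M)"
      using L2_mult_integrable[OF L(1) t(3)[OF i]] L2_mult_integrable[OF L(3) t(3)[OF i]]
      by (simp add: distrib_right mult.assoc)
    also have "\<dots> = - (a * (\<integral>x. (g x \<bullet> i) * \<phi> x \<partial>M) + b * (\<integral>x. (h x \<bullet> i) * \<phi> x \<partial>M))"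
      using u v \<phi> i by (simp add: has_weak_gradient_def)
    also have "\<dots> = - (\<integral>x. ((a *\<^sub>R g x + b *\<^sub>R h x) \<bullet> i) * \<phi> x \<partial>M)"
      using L2_mult_integrable[OF L2_component[OF L(2) i] t(1)] L2_mult_integrable[OF L2_component[OF L(4) i] t(1)]
      by (simp add: inner_add_left distrib_right mult.assoc)
    finally show ?thesis .
  qed
  then show ?thesis
    using L2_lincomb[OF L(1,3), of a b] L2_lincomb[OF L(2,4), of a b] by (simp add: has_weak_gradient_def)
qed

lemma has_weak_gradient_test_function:
  assumes "\<phi> \<in> test_functions \<Omega>"
  shows "has_weak_gradient \<Omega> \<phi> (grad \<phi>)"
proof -
  obtain K where K: "C1c K \<phi> (grad \<phi>)" "K \<subseteq> \<Omega>" using test_function_C1c[OF assms] .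
  have "(\<integral>x. \<phi> x * partial_deriv i \<psi> x \<partial>M) = - (\<integral>x. (grad \<phi> x \<bullet> i) * \<psi> x \<partial>M)"
    if \<psi>: "\<psi> \<in> test_functions \<Omega>" and i: "i \<in> Basis" for \<psi> i
  proof -
    obtain L where L: "C1c L \<psi> (grad \<psi>)" "L \<subseteq> \<Omega>" using test_function_C1c[OF \<psi>] .
    have "continuous_on \<Omega> (grad \<phi>)" using C1cD(3)[OF K(1)] continuous_on_subset by blast
    from C1c_integration_by_parts(1)[OF L C1cD(2)[OF K(1)] this open_domain subset_refl, of i] i
    show ?thesis by (simp add: grad_inner_Basis)
  qed
  then show ?thesis using test_function_L2[OF assms] by (simp add: has_weak_gradient_def)
qed

lemma has_weak_gradient_energy_integrable:
  assumes "has_weak_gradient \<Omega> u g"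
  shows "integrable M (\<lambda>x. (u x)\<^sup>2 + (norm (g x))\<^sup>2)"
  using assms L2D(2)[of u \<Omega>] L2D(2)[of g \<Omega>] by (simp add: has_weak_gradient_def)

lemma has_weak_gradient_diff_test_function:
  assumes "has_weak_gradient \<Omega> u g" "\<phi> \<in> test_functions \<Omega>"
  shows "has_weak_gradient \<Omega> (\<lambda>x. u x - \<phi> x) (\<lambda>x. g x - grad \<phi> x)"
  using has_weak_gradient_lincomb[OF assms(1) has_weak_gradient_test_function[OF assms(2)], of 1 "-1"] by simp

lemma H1_distance_integrable:
  assumes "has_weak_gradient \<Omega> u g" "\<phi> \<in> test_functions \<Omega>"
  shows "integrable M (\<lambda>x. (u x - \<phi> x)\<^sup>2 + (norm (g x - grad \<phi> x))\<^sup>2)"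
  by (rule has_weak_gradient_energy_integrable[OF has_weak_gradient_diff_test_function[OF assms]])

lemma weak_gradient_AE:
  assumes "has_weak_gradient \<Omega> u g"
  shows "has_weak_gradient \<Omega> u (weak_gradient \<Omega> u)" "AE x in M. weak_gradient \<Omega> u x = g x"
proof -
  show *: "has_weak_gradient \<Omega> u (weak_gradient \<Omega> u)"
    unfolding weak_gradient_def by (rule someI[of "has_weak_gradient \<Omega> u", OF assms])
  show "AE x in M. weak_gradient \<Omega> u x = g x" by (rule has_weak_gradient_unique[OF * assms])
qed

lemma H1_norm_eq:
  assumes "has_weak_gradient \<Omega> u g"
  shows "H1_norm \<Omega> u = sqrt (\<integral>x. (u x)\<^sup>2 + (norm (g x))\<^sup>2 \<partial>M)"
proof -
  note w = weak_gradient_AE[OF assms]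
  have [measurable]: "u \<in> borel_measurable M" "g \<in> borel_measurable M" "weak_gradient \<Omega> u \<in> borel_measurable M"
    using assms w(1) by (auto simp: has_weak_gradient_def L2_def)
  have "(\<integral>x. (u x)\<^sup>2 + (norm (weak_gradient \<Omega> u x))\<^sup>2 \<partial>M) = (\<integral>x. (u x)\<^sup>2 + (norm (g x))\<^sup>2 \<partial>M)"
    by (rule integral_cong_AE) (use w(2) in \<open>auto elim: eventually_mono\<close>)
  then show ?thesis by (simp add: H1_norm_def)
qed

text \<open>
  The norm in the definition of the Sobolev space involves a weak gradient chosen by Hilbert's
  \<open>\<epsilon>\<close>; uniqueness allows it to be replaced by any given one.
\<close>

lemma H10_iff:
  assumes "has_weak_gradient \<Omega> u g"
  shows "u \<in> H10 \<Omega> \<longleftrightarrow> (\<forall>e>0. \<exists>\<phi>\<in>test_functions \<Omega>. (\<integral>x. (u x - \<phi> x)\<^sup>2 + (norm (g x - grad \<phi> x))\<^sup>2 \<partial>M) < e)"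
proof -
  have eq: "H1_norm \<Omega> (\<lambda>x. u x - \<phi> x) = sqrt (\<integral>x. (u x - \<phi> x)\<^sup>2 + (norm (g x - grad \<phi> x))\<^sup>2 \<partial>M)"
    if "\<phi> \<in> test_functions \<Omega>" for \<phi>
    by (rule H1_norm_eq[OF has_weak_gradient_diff_test_function[OF assms that]])
  have "u \<in> H1 \<Omega>" using assms by (auto simp: H1_def)
  then have "u \<in> H10 \<Omega> \<longleftrightarrow> (\<forall>e>0. \<exists>\<phi>\<in>test_functions \<Omega>. sqrt (\<integral>x. (u x - \<phi> x)\<^sup>2 + (norm (g x - grad \<phi> x))\<^sup>2 \<partial>M) < e)"
    using eq by (auto simp: H10_def)
  also have "\<dots> \<longleftrightarrow> (\<forall>e>0. \<exists>\<phi>\<in>test_functions \<Omega>. (\<integral>x. (u x - \<phi> x)\<^sup>2 + (norm (g x - grad \<phi> x))\<^sup>2 \<partial>M) < e)"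
  proof (intro iffI allI impI)
    fix e :: real
    assume *: "\<forall>e>0. \<exists>\<phi>\<in>test_functions \<Omega>. sqrt (\<integral>x. (u x - \<phi> x)\<^sup>2 + (norm (g x - grad \<phi> x))\<^sup>2 \<partial>M) < e" and e: "e > 0"
    from *[rule_format, of "sqrt e"] e
    show "\<exists>\<phi>\<in>test_functions \<Omega>. (\<integral>x. (u x - \<phi> x)\<^sup>2 + (norm (g x - grad \<phi> x))\<^sup>2 \<partial>M) < e" by auto
  next
    fix e :: real
    assume *: "\<forall>e>0. \<exists>\<phi>\<in>test_functions \<Omega>. (\<integral>x. (u x - \<phi> x)\<^sup>2 + (norm (g x - grad \<phi> x))\<^sup>2 \<partial>M) < e" and e: "e > 0"
    from *[rule_format, of "e\<^sup>2"] e obtain \<phi> where \<phi>: "\<phi> \<in> test_functions \<Omega>"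
      "(\<integral>x. (u x - \<phi> x)\<^sup>2 + (norm (g x - grad \<phi> x))\<^sup>2 \<partial>M) < e\<^sup>2" by auto
    then have "sqrt (\<integral>x. (u x - \<phi> x)\<^sup>2 + (norm (g x - grad \<phi> x))\<^sup>2 \<partial>M) < e"
      using e real_less_lsqrt by (simp add: real_less_lsqrt)
    with \<phi> show "\<exists>\<phi>\<in>test_functions \<Omega>. sqrt (\<integral>x. (u x - \<phi> x)\<^sup>2 + (norm (g x - grad \<phi> x))\<^sup>2 \<partial>M) < e" by blast
  qed
  finally show ?thesis .
qed

lemma H10_D:
  assumes "u \<in> H10 \<Omega>"
  obtains g where "has_weak_gradient \<Omega> u g"
  using assms by (auto simp: H10_def H1_def)

lemma H10_lincomb:
  assumes u: "u \<in> H10 \<Omega>" and v: "v \<in> H10 \<Omega>"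
  shows "(\<lambda>x. a * u x + b * v x) \<in> H10 \<Omega>"
proof -
  obtain g h where g: "has_weak_gradient \<Omega> u g" and h: "has_weak_gradient \<Omega> v h"
    using u v by (metis H10_D)
  note gh = has_weak_gradient_lincomb[OF g h, of a b]
  show ?thesis unfolding H10_iff[OF gh]
  proof (intro allI impI)
    fix e :: real assume e: "e > 0"
    \<comment> \<open>The squares of the two errors enter with the factors \<open>2 a\<^sup>2\<close> and \<open>2
      b\<^sup>2\<close>.\<close>
    define e1 where "e1 = e / (4 * (a\<^sup>2 + b\<^sup>2 + 1))"
    have pos: "a\<^sup>2 + b\<^sup>2 + 1 > 0" by (simp add: add_nonneg_pos)
    have e1: "e1 > 0" using e pos by (simp add: e1_def)
    obtain \<phi> where \<phi>: "\<phi> \<in> test_functions \<Omega>" "(\<integral>x. (u x - \<phi> x)\<^sup>2 + (norm (g x - grad \<phi> x))\<^sup>2 \<partial>M) < e1"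
      using u e1 unfolding H10_iff[OF g] by blast
    obtain \<psi> where \<psi>: "\<psi> \<in> test_functions \<Omega>" "(\<integral>x. (v x - \<psi> x)\<^sup>2 + (norm (h x - grad \<psi> x))\<^sup>2 \<partial>M) < e1"
      using v e1 unfolding H10_iff[OF h] by blast
    define \<kappa> where "\<kappa> = (\<lambda>x. a * \<phi> x + b * \<psi> x)"
    obtain K where K: "C1c K \<phi> (grad \<phi>)" "K \<subseteq> \<Omega>" using test_function_C1c[OF \<phi>(1)] .
    obtain L where L: "C1c L \<psi> (grad \<psi>)" "L \<subseteq> \<Omega>" using test_function_C1c[OF \<psi>(1)] .
    have sm: "smooth \<phi>" "smooth \<psi>" using \<phi>(1) \<psi>(1) by (auto simp: test_functions_def smooth_def)
    have gr: "grad \<kappa> x = a *\<^sub>R grad \<phi> x + b *\<^sub>R grad \<psi> x" for x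
      unfolding \<kappa>_def
      by (rule grad_eqI) (auto intro!: derivative_eq_intros smooth_has_grad sm simp: inner_add_left)
    have cl: "closure {x. \<kappa> x \<noteq> 0} \<subseteq> K \<union> L"
    proof (rule closure_minimal)
      show "closed (K \<union> L)"
        using C1cD(1)[OF K(1)] C1cD(1)[OF L(1)] by (simp add: compact_imp_closed closed_Un)
      show "{x. \<kappa> x \<noteq> 0} \<subseteq> K \<union> L"
      proof
        fix x assume "x \<in> {x. \<kappa> x \<noteq> 0}"
        then have "\<phi> x \<noteq> 0 \<or> \<psi> x \<noteq> 0" by (auto simp: \<kappa>_def)
        then show "x \<in> K \<union> L" using C1cD(4)[OF K(1)] C1cD(4)[OF L(1)] by blast
      qed
    qed
    have test: "\<kappa> \<in> test_functions \<Omega>"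
      unfolding test_functions_def mem_Collect_eq
    proof (intro conjI)
      show "\<forall>k. Ck_on k UNIV \<kappa>" using smooth_lincomb[OF sm, of a b] by (simp add: \<kappa>_def smooth_def)
      show "closure {x. \<kappa> x \<noteq> 0} \<subseteq> \<Omega>" using cl K L by blast
      show "compact (closure {x. \<kappa> x \<noteq> 0})"
        using cl C1cD(1)[OF K(1)] C1cD(1)[OF L(1)]
        by (metis closed_Int_compact closed_closure compact_Un inf.absorb_iff1)
    qed
    let ?P = "\<lambda>x. (u x - \<phi> x)\<^sup>2 + (norm (g x - grad \<phi> x))\<^sup>2"
    let ?Q = "\<lambda>x. (v x - \<psi> x)\<^sup>2 + (norm (h x - grad \<psi> x))\<^sup>2"
    have iP: "integrable M ?P"
      by (rule H1_distance_integrable[OF g \<phi>(1)])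
    have iQ: "integrable M ?Q"
      using H1_distance_integrable[OF h \<psi>(1)] by simp
    have iR: "integrable M (\<lambda>x. (a * u x + b * v x - \<kappa> x)\<^sup>2 + (norm (a *\<^sub>R g x + b *\<^sub>R h x - grad \<kappa> x))\<^sup>2)"
      using H1_distance_integrable[OF gh test] by simp
    have "(\<integral>x. (a * u x + b * v x - \<kappa> x)\<^sup>2 + (norm (a *\<^sub>R g x + b *\<^sub>R h x - grad \<kappa> x))\<^sup>2 \<partial>M)
        \<le> (\<integral>x. 2 * a\<^sup>2 * ?P x + 2 * b\<^sup>2 * ?Q x \<partial>M)"
    proof (rule integral_mono[OF iR])
      show "integrable M (\<lambda>x. 2 * a\<^sup>2 * ?P x + 2 * b\<^sup>2 * ?Q x)"
        by (intro Bochner_Integration.integrable_add integrable_mult_right iP iQ)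
      fix x
      have 1: "a * u x + b * v x - \<kappa> x = a * (u x - \<phi> x) + b * (v x - \<psi> x)"
        "a *\<^sub>R g x + b *\<^sub>R h x - grad \<kappa> x = a *\<^sub>R (g x - grad \<phi> x) + b *\<^sub>R (h x - grad \<psi> x)"
        by (simp_all add: \<kappa>_def gr[unfolded \<kappa>_def] algebra_simps)
      show "(a * u x + b * v x - \<kappa> x)\<^sup>2 + (norm (a *\<^sub>R g x + b *\<^sub>R h x - grad \<kappa> x))\<^sup>2 \<le> 2 * a\<^sup>2 * ?P x + 2 * b\<^sup>2 * ?Q x"
        unfolding 1
        using norm_lincomb_square_le[of a "u x - \<phi> x" b "v x - \<psi> x"]
          norm_lincomb_square_le[of a "g x - grad \<phi> x" b "h x - grad \<psi> x"]
        by (simp add: algebra_simps)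
    qed
    also have "\<dots> = 2 * a\<^sup>2 * (\<integral>x. ?P x \<partial>M) + 2 * b\<^sup>2 * (\<integral>x. ?Q x \<partial>M)"
      by (rule integral_lincomb[OF iP iQ])
    also have "\<dots> \<le> 2 * a\<^sup>2 * e1 + 2 * b\<^sup>2 * e1"
      using \<phi>(2) \<psi>(2) by (intro add_mono mult_left_mono) auto
    also have "\<dots> < 4 * (a\<^sup>2 + b\<^sup>2 + 1) * e1"
      using e1 by (simp add: algebra_simps) (smt (verit) mult_nonneg_nonneg zero_le_power2)
    also have "\<dots> = e" using pos by (simp add: e1_def)
    finally show "\<exists>\<kappa>\<in>test_functions \<Omega>. (\<integral>x. (a * u x + b * v x - \<kappa> x)\<^sup>2 + (norm (a *\<^sub>R g x + b *\<^sub>R h x - grad \<kappa> x))\<^sup>2 \<partial>M) < e"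
      using test by blast
  qed
qed

lemma H10_cong_AE:
  assumes "u \<in> H10 \<Omega>" "AE x in M. u x = v x"
  shows "v \<in> H10 \<Omega>"
proof -
  obtain g where g: "has_weak_gradient \<Omega> u g" using assms(1) by (rule H10_D)
  note g' = has_weak_gradient_cong_AE[OF g assms(2)]
  have "(\<integral>x. (v x - \<phi> x)\<^sup>2 + (norm (g x - grad \<phi> x))\<^sup>2 \<partial>M) = (\<integral>x. (u x - \<phi> x)\<^sup>2 + (norm (g x - grad \<phi> x))\<^sup>2 \<partial>M)"
    if "\<phi> \<in> test_functions \<Omega>" for \<phi>
  proof (rule integral_cong_AE)
    show "(\<lambda>x. (u x - \<phi> x)\<^sup>2 + (norm (g x - grad \<phi> x))\<^sup>2) \<in> borel_measurable M"
      "(\<lambda>x. (v x - \<phi> x)\<^sup>2 + (norm (g x - grad \<phi> x))\<^sup>2) \<in> borel_measurable M"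
      using H1_distance_integrable[OF g that]
        H1_distance_integrable[OF g' that]
      by (auto dest!: borel_measurable_integrable)
    show "AE x in M. (v x - \<phi> x)\<^sup>2 + (norm (g x - grad \<phi> x))\<^sup>2 = (u x - \<phi> x)\<^sup>2 + (norm (g x - grad \<phi> x))\<^sup>2"
      using assms(2) by eventually_elim simp
  qed
  then show ?thesis using assms(1) unfolding H10_iff[OF g] H10_iff[OF g'] by simp
qed

text \<open>
  Both the integral identity of weak gradients and the \<open>H\<^sup>1\<close> distance pass to the limit by dominated convergence; a
  last mollification turns the approximating \<open>C\<^sup>1\<^sub>c\<close> functions into test functions.
\<close>

lemma H10_limit:
  assumes C: "\<And>n::nat. C1c (K n) (\<phi> n) (\<gamma> n)" "\<And>n. K n \<subseteq> \<Omega>"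
    and z: "z \<in> L2 \<Omega>" "g \<in> L2 \<Omega>"
    and lim: "\<And>x. x \<in> \<Omega> \<Longrightarrow> (\<lambda>n. \<phi> n x) \<longlonglongrightarrow> z x" "\<And>x. x \<in> \<Omega> \<Longrightarrow> (\<lambda>n. \<gamma> n x) \<longlonglongrightarrow> g x"
    and bound: "\<And>n x. x \<in> \<Omega> \<Longrightarrow> \<bar>\<phi> n x\<bar> \<le> \<bar>z x\<bar>" "\<And>n x. x \<in> \<Omega> \<Longrightarrow> norm (\<gamma> n x) \<le> norm (g x)"
  shows "has_weak_gradient \<Omega> z g" "z \<in> H10 \<Omega>"
proof -
  note [measurable] = L2D(1)[OF z(1)] L2D(1)[OF z(2)]
  have m[measurable]: "\<phi> n \<in> borel_measurable M" "\<gamma> n \<in> borel_measurable M" for n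
    using C1c_L2[OF C(1)] L2D(1) by blast+
  have parts: "(\<integral>x. z x * partial_deriv i \<psi> x \<partial>M) = - (\<integral>x. (g x \<bullet> i) * \<psi> x \<partial>M)"
    if \<psi>: "\<psi> \<in> test_functions \<Omega>" and i: "i \<in> Basis" for \<psi> i
  proof -
    note [measurable] = L2D(1)[OF test_function_L2(1)[OF \<psi>]] L2D(1)[OF test_function_L2(3)[OF \<psi> i]]
    have 1: "(\<lambda>n. \<integral>x. \<phi> n x * partial_deriv i \<psi> x \<partial>M) \<longlonglongrightarrow> (\<integral>x. z x * partial_deriv i \<psi> x \<partial>M)"
    proof (rule integral_dominated_convergence[where w = "\<lambda>x. \<bar>z x * partial_deriv i \<psi> x\<bar>"])
      show "integrable M (\<lambda>x. \<bar>z x * partial_deriv i \<psi> x\<bar>)"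
        using L2_mult_integrable[OF z(1) test_function_L2(3)[OF \<psi> i]] by simp
      show "AE x in M. norm (\<phi> n x * partial_deriv i \<psi> x) \<le> \<bar>z x * partial_deriv i \<psi> x\<bar>" for n
        using bound(1) by (intro AE_M_I) (auto simp: abs_mult intro!: mult_right_mono)
      show "AE x in M. (\<lambda>n. \<phi> n x * partial_deriv i \<psi> x) \<longlonglongrightarrow> z x * partial_deriv i \<psi> x"
        by (intro AE_M_I tendsto_intros lim)
    qed measurable
    have 2: "(\<lambda>n. \<integral>x. (\<gamma> n x \<bullet> i) * \<psi> x \<partial>M) \<longlonglongrightarrow> (\<integral>x. (g x \<bullet> i) * \<psi> x \<partial>M)"
    proof (rule integral_dominated_convergence[where w = "\<lambda>x. (norm (g x))\<^sup>2 + (norm (\<psi> x))\<^sup>2"])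
      show "integrable M (\<lambda>x. (norm (g x))\<^sup>2 + (norm (\<psi> x))\<^sup>2)"
        using L2D(2)[OF z(2)] L2D(2)[OF test_function_L2(1)[OF \<psi>]] by simp
      show "AE x in M. norm ((\<gamma> n x \<bullet> i) * \<psi> x) \<le> (norm (g x))\<^sup>2 + (norm (\<psi> x))\<^sup>2" for n
      proof (rule AE_M_I)
        fix x assume x: "x \<in> \<Omega>"
        have "norm ((\<gamma> n x \<bullet> i) * \<psi> x) \<le> norm (g x) * norm (\<psi> x)"
          using Basis_le_norm[OF i, of "\<gamma> n x"] bound(2)[OF x, of n]
          by (auto simp: abs_mult intro!: mult_right_mono)
        also have "\<dots> \<le> (norm (g x))\<^sup>2 + (norm (\<psi> x))\<^sup>2"
      by (rule mult_le_sum_squares)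
        finally show "norm ((\<gamma> n x \<bullet> i) * \<psi> x) \<le> (norm (g x))\<^sup>2 + (norm (\<psi> x))\<^sup>2" .
      qed
      show "AE x in M. (\<lambda>n. (\<gamma> n x \<bullet> i) * \<psi> x) \<longlonglongrightarrow> (g x \<bullet> i) * \<psi> x"
        by (intro AE_M_I tendsto_intros lim)
    qed measurable
    have "(\<integral>x. \<phi> n x * partial_deriv i \<psi> x \<partial>M) = - (\<integral>x. (\<gamma> n x \<bullet> i) * \<psi> x \<partial>M)" for n
    proof -
      obtain L where L: "C1c L \<psi> (grad \<psi>)" "L \<subseteq> \<Omega>" using test_function_C1c[OF \<psi>] .
      have "continuous_on \<Omega> (\<gamma> n)" using C1cD(3)[OF C(1)] continuous_on_subset by blast
      from C1c_integration_by_parts(1)[OF L C1cD(2)[OF C(1)] this open_domain subset_refl, of i] i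
      show ?thesis by (simp add: grad_inner_Basis)
    qed
    then show ?thesis using LIMSEQ_unique[OF 1] tendsto_minus[OF 2] by simp
  qed
  show wg: "has_weak_gradient \<Omega> z g" using z parts by (simp add: has_weak_gradient_def)
  show "z \<in> H10 \<Omega>" unfolding H10_iff[OF wg]
  proof (intro allI impI)
    fix e :: real assume e: "e > 0"
    let ?d = "\<lambda>n x. (z x - \<phi> n x)\<^sup>2 + (norm (g x - \<gamma> n x))\<^sup>2"
    have iz: "integrable M (\<lambda>x. 4 * ((norm (z x))\<^sup>2 + (norm (g x))\<^sup>2))"
      using L2D(2)[OF z(1)] L2D(2)[OF z(2)] by simp
    have dle: "?d n x \<le> 4 * ((norm (z x))\<^sup>2 + (norm (g x))\<^sup>2)" if x: "x \<in> \<Omega>" for n x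
    proof -
      have "norm (z x - \<phi> n x) \<le> 2 * norm (z x)" "norm (g x - \<gamma> n x) \<le> 2 * norm (g x)"
        using bound(1)[OF x, of n] bound(2)[OF x, of n] norm_triangle_ineq4[of "z x" "\<phi> n x"] norm_triangle_ineq4[of "g x" "\<gamma> n x"]
        by (auto simp del: norm_triangle_ineq4)
      then have "(norm (z x - \<phi> n x))\<^sup>2 \<le> (2 * norm (z x))\<^sup>2" "(norm (g x - \<gamma> n x))\<^sup>2 \<le> (2 * norm (g x))\<^sup>2"
        by (intro power_mono; simp)+
      then show ?thesis by (simp add: power_mult_distrib)
    qed
    have "(\<lambda>n. \<integral>x. ?d n x \<partial>M) \<longlonglongrightarrow> (\<integral>x. 0 \<partial>M)"
    proof (rule integral_dominated_convergence[OF _ _ iz])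
      show "AE x in M. (\<lambda>n. ?d n x) \<longlonglongrightarrow> 0"
      proof (rule AE_M_I)
        fix x assume x: "x \<in> \<Omega>"
        have "(\<lambda>n. ?d n x) \<longlonglongrightarrow> (z x - z x)\<^sup>2 + (norm (g x - g x))\<^sup>2"
          by (intro tendsto_intros lim x)
        then show "(\<lambda>n. ?d n x) \<longlonglongrightarrow> 0" by simp
      qed
      show "AE x in M. norm (?d n x) \<le> 4 * ((norm (z x))\<^sup>2 + (norm (g x))\<^sup>2)" for n
        using dle by (intro AE_M_I) simp
    qed measurable
    then have "\<forall>\<^sub>F n in sequentially. (\<integral>x. ?d n x \<partial>M) < e / 4"
      using e by (intro order_tendstoD) auto
    then obtain n where n: "(\<integral>x. ?d n x \<partial>M) < e / 4" by (auto dest: eventually_happens)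
    define m where "m = measure M \<Omega>"
    have m0: "m \<ge> 0" by (simp add: m_def)
    \<comment> \<open>The error \<open>\<delta>\<close> of the mollification contributes \<open>4 \<delta>\<^sup>2 m \<le>
      e / 2\<close>, where \<open>m\<close> is the volume of the domain.\<close>
    define \<delta> where "\<delta> = sqrt (e / (8 * (m + 1)))"
    have \<delta>: "\<delta> > 0" "\<delta>\<^sup>2 = e / (8 * (m + 1))" using e m0 by (auto simp: \<delta>_def)
    obtain \<psi> where \<psi>: "\<psi> \<in> test_functions \<Omega>" "\<And>x. \<bar>\<psi> x - \<phi> n x\<bar> \<le> \<delta>" "\<And>x. norm (grad \<psi> x - \<gamma> n x) \<le> \<delta>"
      using C1c_test_function_approx[OF C open_domain \<delta>(1)] by blast
    have i1: "integrable M (?d n)"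
      by (rule Bochner_Integration.integrable_bound[OF iz]) (use dle in \<open>auto intro!: AE_M_I\<close>)
    have i2: "integrable M (\<lambda>x. (z x - \<psi> x)\<^sup>2 + (norm (g x - grad \<psi> x))\<^sup>2)"
      using H1_distance_integrable[OF wg \<psi>(1)] by simp
    have "(\<integral>x. (z x - \<psi> x)\<^sup>2 + (norm (g x - grad \<psi> x))\<^sup>2 \<partial>M) \<le> (\<integral>x. 2 * ?d n x + 4 * \<delta>\<^sup>2 \<partial>M)"
    proof (rule integral_mono[OF i2])
      show "integrable M (\<lambda>x. 2 * ?d n x + 4 * \<delta>\<^sup>2)"
        by (intro Bochner_Integration.integrable_add integrable_mult_right i1 integrable_const_M)
      fix x
      have "(\<phi> n x - \<psi> x)\<^sup>2 \<le> \<delta>\<^sup>2" "(norm (\<gamma> n x - grad \<psi> x))\<^sup>2 \<le> \<delta>\<^sup>2"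
        using \<psi>(2)[of x] \<psi>(3)[of x] \<delta>(1) by (auto simp: abs_le_square_iff[symmetric] abs_minus_commute norm_minus_commute)
      then show "(z x - \<psi> x)\<^sup>2 + (norm (g x - grad \<psi> x))\<^sup>2 \<le> 2 * ?d n x + 4 * \<delta>\<^sup>2"
        using norm_lincomb_square_le[of 1 "z x - \<phi> n x" 1 "\<phi> n x - \<psi> x"]
          norm_lincomb_square_le[of 1 "g x - \<gamma> n x" 1 "\<gamma> n x - grad \<psi> x"]
        by (simp add: algebra_simps)
    qed
    also have "\<dots> = 2 * (\<integral>x. ?d n x \<partial>M) + 4 * \<delta>\<^sup>2 * m"
      unfolding m_def by (rule integral_affine[OF i1])
    also have "\<dots> < 2 * (e / 4) + e / 2"
    proof (intro add_less_le_mono)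
      have "4 * \<delta>\<^sup>2 * m = (e / 2) * (m / (m + 1))" using m0 by (simp add: \<delta>(2) field_simps)
      also have "\<dots> \<le> (e / 2) * 1" using e m0 by (intro mult_left_mono) (auto simp: field_simps)
      finally show "4 * \<delta>\<^sup>2 * m \<le> e / 2" by simp
    qed (use n in auto)
    finally show "\<exists>\<psi>\<in>test_functions \<Omega>. (\<integral>x. (z x - \<psi> x)\<^sup>2 + (norm (g x - grad \<psi> x))\<^sup>2 \<partial>M) < e"
      using \<psi>(1) by auto
  qed
qed

end


section \<open>Functions of class C2 and the Laplacian\<close>

text \<open>
  \<open>G\<close> is the gradient of \<open>u\<close> and \<open>H i\<close> the gradient of the \<open>i\<close>-th component of \<open>G\<close>, that is, a
  row of the Hessian. With the data as parameters, differences and reflections of \<open>u\<close> have explicit second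
  derivatives.
\<close>

definition C2_on :: "'a::euclidean_space set \<Rightarrow> ('a \<Rightarrow> real) \<Rightarrow> ('a \<Rightarrow> 'a) \<Rightarrow> ('a \<Rightarrow> 'a \<Rightarrow> 'a) \<Rightarrow> bool" where
  "C2_on D u G H \<longleftrightarrow> (\<forall>x\<in>D. (u has_derivative (\<lambda>h. G x \<bullet> h)) (at x)) \<and>
     (\<forall>i\<in>Basis. (\<forall>x\<in>D. ((\<lambda>y. G y \<bullet> i) has_derivative (\<lambda>h. H i x \<bullet> h)) (at x)) \<and> continuous_on D (H i))"

definition trace_of :: "('a::euclidean_space \<Rightarrow> 'a \<Rightarrow> 'a) \<Rightarrow> 'a \<Rightarrow> real" where
  "trace_of H x = (\<Sum>i\<in>Basis. H i x \<bullet> i)"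

lemma C2_onD:
  assumes "C2_on D u G H"
  shows "\<And>x. x \<in> D \<Longrightarrow> (u has_derivative (\<lambda>h. G x \<bullet> h)) (at x)"
    "\<And>i x. i \<in> Basis \<Longrightarrow> x \<in> D \<Longrightarrow> ((\<lambda>y. G y \<bullet> i) has_derivative (\<lambda>h. H i x \<bullet> h)) (at x)"
    "\<And>i. i \<in> Basis \<Longrightarrow> continuous_on D (H i)"
  using assms by (auto simp: C2_on_def)

lemma C2_on_subset: "C2_on D u G H \<Longrightarrow> D' \<subseteq> D \<Longrightarrow> C2_on D' u G H"
  unfolding C2_on_def by (meson continuous_on_subset subsetD)

lemma C2_on_continuous: "C2_on D u G H \<Longrightarrow> continuous_on D u"
  by (meson C2_onD(1) continuous_at_imp_continuous_on has_derivative_continuous)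

lemma C2_on_continuous_grad:
  assumes "C2_on D u G H"
  shows "continuous_on D G"
proof -
  have "continuous_on D (\<lambda>x. \<Sum>i\<in>Basis. (G x \<bullet> i) *\<^sub>R i)"
  proof (intro continuous_on_sum continuous_on_scaleR continuous_on_const)
    fix i :: 'a assume "i \<in> Basis"
    then show "continuous_on D (\<lambda>x. G x \<bullet> i)"
      using C2_onD(2)[OF assms] by (meson continuous_at_imp_continuous_on has_derivative_continuous)
  qed
  then show ?thesis by (simp add: euclidean_representation)
qed

lemma C2_on_continuous_trace: "C2_on D u G H \<Longrightarrow> continuous_on D (trace_of H)"
  unfolding trace_of_def by (intro continuous_intros C2_onD(3))

lemma Ck_on_2_C2_on:
  assumes "Ck_on 2 D u"
  shows "C2_on D u (grad u) (\<lambda>i. grad (partial_deriv i u))" "laplacian u = trace_of (\<lambda>i. grad (partial_deriv i u))"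
proof -
  have u: "\<And>x. x \<in> D \<Longrightarrow> u differentiable (at x)"
    "\<And>i x. i \<in> Basis \<Longrightarrow> x \<in> D \<Longrightarrow> partial_deriv i u differentiable (at x)"
    "\<And>i j. i \<in> Basis \<Longrightarrow> j \<in> Basis \<Longrightarrow> continuous_on D (partial_deriv j (partial_deriv i u))"
    using assms by (auto simp: numeral_2_eq_2)
  show "C2_on D u (grad u) (\<lambda>i. grad (partial_deriv i u))"
    unfolding C2_on_def
  proof (intro conjI ballI)
    fix i :: 'a assume i: "i \<in> Basis"
    have eq: "(\<lambda>y. grad u y \<bullet> i) = partial_deriv i u" using i by (simp add: grad_inner_Basis)
    show "((\<lambda>y. grad u y \<bullet> i) has_derivative (\<lambda>h. grad (partial_deriv i u) x \<bullet> h)) (at x)" if "x \<in> D" for x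
      unfolding eq by (intro differentiable_has_grad u i that)
    show "continuous_on D (grad (partial_deriv i u))"
      unfolding grad_def by (intro continuous_intros u i)
  qed (intro differentiable_has_grad u)
  show "laplacian u = trace_of (\<lambda>i. grad (partial_deriv i u))"
    by (rule ext) (simp add: laplacian_def trace_of_def grad_inner_Basis)
qed

lemma C2_on_diff:
  assumes "C2_on D u G H" "C2_on D v G' H'"
  shows "C2_on D (\<lambda>x. u x - v x) (\<lambda>x. G x - G' x) (\<lambda>i x. H i x - H' i x)"
    "trace_of (\<lambda>i x. H i x - H' i x) x = trace_of H x - trace_of H' x"
proof -
  show "C2_on D (\<lambda>x. u x - v x) (\<lambda>x. G x - G' x) (\<lambda>i x. H i x - H' i x)"
    unfolding C2_on_def inner_diff_left
    by (intro conjI ballI has_derivative_diff continuous_on_diff C2_onD(1)[OF assms(1)] C2_onD(1)[OF assms(2)]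
         C2_onD(2)[OF assms(1)] C2_onD(2)[OF assms(2)] C2_onD(3)[OF assms(1)] C2_onD(3)[OF assms(2)])
  show "trace_of (\<lambda>i x. H i x - H' i x) x = trace_of H x - trace_of H' x"
    by (simp add: trace_of_def inner_diff_left sum_subtractf)
qed

lemma C2_on_cong:
  assumes C: "C2_on D u G H" and D: "open D" and eq: "\<And>x. x \<in> D \<Longrightarrow> u x = v x"
  shows "C2_on D v G H"
  unfolding C2_on_def
proof (intro conjI ballI)
  fix x assume x: "x \<in> D"
  show "(v has_derivative (\<lambda>h. G x \<bullet> h)) (at x)"
    by (rule has_derivative_transform_within_open[OF C2_onD(1)[OF C x] D x]) (use eq in auto)
qed (use C2_onD(2,3)[OF C] in auto)

section \<open>Truncation near the zero set\<close>

text \<open>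
  A \<open>C\<^sup>1\<close> truncation: \<open>(\<bar>t\<bar> - e)\<^sup>2 / t\<close> for \<open>\<bar>t\<bar> > e\<close> and \<open>0\<close> otherwise. Its derivative
  \<open>1 - e\<^sup>2 / t\<^sup>2\<close>, respectively \<open>0\<close>, increases to \<open>1\<close> as \<open>e\<close> decreases to \<open>0\<close>, for \<open>t \<noteq> 0\<close>. The maximum
  in the denominator merges the cases.
\<close>

definition trunc :: "real \<Rightarrow> real \<Rightarrow> real" where
  "trunc e t = t * (1 - e / max \<bar>t\<bar> e)\<^sup>2"

definition trunc' :: "real \<Rightarrow> real \<Rightarrow> real" where
  "trunc' e t = 1 - (e / max \<bar>t\<bar> e)\<^sup>2"

lemma trunc_zero: "e > 0 \<Longrightarrow> \<bar>t\<bar> \<le> e \<Longrightarrow> trunc e t = 0" "e > 0 \<Longrightarrow> \<bar>t\<bar> \<le> e \<Longrightarrow> trunc' e t = 0"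
  by (auto simp: trunc_def trunc'_def max_def)

lemma ratio_bounds:
  fixes e t :: real
  shows "e > 0 \<Longrightarrow> 0 \<le> e / max \<bar>t\<bar> e" "e > 0 \<Longrightarrow> e / max \<bar>t\<bar> e \<le> 1"
  by (auto simp: max_def)

lemma trunc_bounds:
  assumes "e > 0"
  shows "\<bar>trunc e t\<bar> \<le> \<bar>t\<bar>" "0 \<le> trunc' e t" "trunc' e t \<le> 1"
  using ratio_bounds[OF assms, of t]
  by (auto simp: trunc_def trunc'_def abs_mult intro!: mult_left_le power_le_one)

lemma trunc'_mono:
  assumes "0 < e" "e \<le> d"
  shows "trunc' d t \<le> trunc' e t"
proof -
  have "e * max \<bar>t\<bar> d \<le> d * max \<bar>t\<bar> e"
    using assms by (auto simp: max_def mult_mono mult.commute intro: mult_right_mono)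
  then have "e / max \<bar>t\<bar> e \<le> d / max \<bar>t\<bar> d"
    using assms by (simp add: field_simps)
  then show ?thesis using ratio_bounds[of e t] assms by (simp add: trunc'_def power_mono)
qed

text \<open>
  At the gluing points \<open>\<bar>t\<bar> = e\<close> the truncation is quadratically small, so its derivative is zero there.
\<close>

lemma trunc_deriv:
  assumes e: "e > 0"
  shows "(trunc e has_real_derivative trunc' e t) (at t)"
proof -
  consider "\<bar>t\<bar> < e" | "t > e" | "t < - e" | "\<bar>t\<bar> = e" by linarith
  then show ?thesis
  proof cases
    case 1
    have "((\<lambda>_. 0) has_real_derivative 0) (at t)" by simp
    then have "(trunc e has_real_derivative 0) (at t)"
      by (rule has_field_derivative_transform_within_open[where S="{-e<..<e}"])
        (use 1 e in \<open>auto simp: trunc_zero\<close>)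
    then show ?thesis using 1 e by (simp add: trunc_zero)
  next
    case 2
    have "((\<lambda>t. t * (1 - e / t)\<^sup>2) has_real_derivative trunc' e t) (at t)"
      using 2 e by (auto intro!: derivative_eq_intros simp: trunc'_def) (simp add: field_simps power2_eq_square)
    then show ?thesis
      by (rule has_field_derivative_transform_within_open[where S="{e<..}"])
        (use 2 e in \<open>auto simp: trunc_def\<close>)
  next
    case 3
    have "((\<lambda>t. t * (1 + e / t)\<^sup>2) has_real_derivative trunc' e t) (at t)"
      using 3 e by (auto intro!: derivative_eq_intros simp: trunc'_def) (simp add: field_simps power2_eq_square)
    then show ?thesis
      by (rule has_field_derivative_transform_within_open[where S="{..<-e}"])
        (use 3 e in \<open>auto simp: trunc_def\<close>)
  next
    case 4
    have bound: "\<bar>trunc e s\<bar> \<le> \<bar>s - t\<bar>\<^sup>2 / e" for s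
    proof (cases "\<bar>s\<bar> \<le> e")
      case True
      then show ?thesis using e by (simp add: trunc_zero)
    next
      case False
      then have "\<bar>trunc e s\<bar> = (\<bar>s\<bar> - e)\<^sup>2 / \<bar>s\<bar>"
      proof -
        define a where "a = \<bar>s\<bar>"
        have a: "a > 0" "max a e = a" using False e by (auto simp: a_def)
        have "\<bar>trunc e s\<bar> = a * (1 - e / a)\<^sup>2"
          using a by (simp add: trunc_def abs_mult a_def)
        also have "\<dots> = (a - e)\<^sup>2 / a" using a(1) by (simp add: field_simps power2_eq_square)
        finally show ?thesis by (simp add: a_def)
      qed
      also have "\<dots> \<le> (\<bar>s\<bar> - e)\<^sup>2 / e" using False e by (intro divide_left_mono) auto
      also have "\<dots> \<le> \<bar>s - t\<bar>\<^sup>2 / e"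
        using 4 e False by (intro divide_right_mono power_mono) auto
      finally show ?thesis .
    qed
    have "((\<lambda>s. (trunc e s - trunc e t) / (s - t)) \<longlongrightarrow> 0) (at t)"
    proof (rule Lim_null_comparison)
      show "\<forall>\<^sub>F s in at t. norm ((trunc e s - trunc e t) / (s - t)) \<le> \<bar>s - t\<bar> / e"
      proof (rule eventually_at_filter[THEN iffD2], rule always_eventually, intro allI impI)
        fix s assume "s \<noteq> t"
        then show "norm ((trunc e s - trunc e t) / (s - t)) \<le> \<bar>s - t\<bar> / e"
          using bound[of s] 4 e by (simp add: trunc_zero field_simps power2_eq_square)
      qed
      have "((\<lambda>s. \<bar>s - t\<bar> / e) \<longlongrightarrow> \<bar>t - t\<bar> / e) (at t)"
        using e by (intro tendsto_intros) auto
      then show "((\<lambda>s. \<bar>s - t\<bar> / e) \<longlongrightarrow> 0) (at t)" by simp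
    qed
    then show ?thesis using 4 e by (simp add: has_field_derivative_iff trunc_zero)
  qed
qed

lemma trunc'_continuous: "e > 0 \<Longrightarrow> continuous_on UNIV (trunc' e)"
  unfolding trunc'_def by (intro continuous_intros) (auto simp: max_def)

lemma trunc_tendsto:
  assumes E: "E \<longlonglongrightarrow> 0" "\<And>n. E n > 0"
  shows "(\<lambda>n. trunc (E n) t) \<longlonglongrightarrow> t" "t \<noteq> 0 \<Longrightarrow> (\<lambda>n. trunc' (E n) t) \<longlonglongrightarrow> 1"
proof -
  have r: "(\<lambda>n. E n / max \<bar>t\<bar> (E n)) \<longlonglongrightarrow> 0" if "t \<noteq> 0"
  proof -
    have "(\<lambda>n. E n / max \<bar>t\<bar> (E n)) \<longlonglongrightarrow> 0 / max \<bar>t\<bar> 0"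
      using that by (intro tendsto_intros E) auto
    then show ?thesis by simp
  qed
  show "(\<lambda>n. trunc (E n) t) \<longlonglongrightarrow> t"
  proof (cases "t = 0")
    case True
    then show ?thesis by (simp add: trunc_def)
  next
    case False
    have "(\<lambda>n. trunc (E n) t) \<longlonglongrightarrow> t * (1 - 0)\<^sup>2"
      unfolding trunc_def by (intro tendsto_intros r False)
    then show ?thesis by simp
  qed
  show "(\<lambda>n. trunc' (E n) t) \<longlonglongrightarrow> 1" if "t \<noteq> 0"
  proof -
    have "(\<lambda>n. trunc' (E n) t) \<longlonglongrightarrow> 1 - 0\<^sup>2"
      unfolding trunc'_def by (intro tendsto_intros r that)
    then show ?thesis by simp
  qed
qed

context bounded_domain begin

text \<open>
  The products of \<open>\<phi>\<close> with the components of \<open>G\<close> are compactly supported \<open>C\<^sup>1\<close> functions; the identity is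
  the sum of their integrated partial derivatives.
\<close>

lemma green_identity:
  assumes C: "C1c K \<phi> \<gamma>" "K \<subseteq> D" and u: "C2_on D u G H" and D: "open D" "D \<subseteq> \<Omega>"
  shows "(\<integral>x. \<gamma> x \<bullet> G x \<partial>M) = - (\<integral>x. trace_of H x * \<phi> x \<partial>M)"
    "integrable M (\<lambda>x. \<gamma> x \<bullet> G x)" "integrable M (\<lambda>x. trace_of H x * \<phi> x)"
proof -
  note ibp = C1c_integration_by_parts[OF C C2_onD(2)[OF u] C2_onD(3)[OF u] D]
  have eq1: "(\<lambda>x. \<gamma> x \<bullet> G x) = (\<lambda>x. \<Sum>i\<in>Basis. (G x \<bullet> i) * (\<gamma> x \<bullet> i))"
    by (subst euclidean_inner) (simp add: mult.commute)
  have eq2: "(\<lambda>x. trace_of H x * \<phi> x) = (\<lambda>x. \<Sum>i\<in>Basis. (H i x \<bullet> i) * \<phi> x)"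
    by (simp add: trace_of_def sum_distrib_right)
  show "integrable M (\<lambda>x. \<gamma> x \<bullet> G x)" unfolding eq1
    by (intro Bochner_Integration.integrable_sum ibp(2))
  show "integrable M (\<lambda>x. trace_of H x * \<phi> x)" unfolding eq2
    by (intro Bochner_Integration.integrable_sum ibp(3))
  have "(\<integral>x. \<gamma> x \<bullet> G x \<partial>M) = (\<Sum>i\<in>Basis. \<integral>x. (G x \<bullet> i) * (\<gamma> x \<bullet> i) \<partial>M)"
    unfolding eq1 by (intro Bochner_Integration.integral_sum ibp(2))
  also have "\<dots> = (\<Sum>i\<in>Basis. - (\<integral>x. (H i x \<bullet> i) * \<phi> x \<partial>M))"
    by (intro sum.cong refl ibp(1))
  also have "\<dots> = - (\<Sum>i\<in>Basis. \<integral>x. (H i x \<bullet> i) * \<phi> x \<partial>M)" by (simp add: sum_negf)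
  also have "(\<Sum>i\<in>Basis. \<integral>x. (H i x \<bullet> i) * \<phi> x \<partial>M) = (\<integral>x. trace_of H x * \<phi> x \<partial>M)"
    unfolding eq2 by (intro Bochner_Integration.integral_sum[symmetric] ibp(3))
  finally show "(\<integral>x. \<gamma> x \<bullet> G x \<partial>M) = - (\<integral>x. trace_of H x * \<phi> x \<partial>M)" .
qed

end

text \<open>
  A continuous function that is \<open>C\<^sup>2\<close> with bounded Laplacian where it does not vanish. The boundary of that
  set is arbitrary, and nothing is known about the gradient \<open>G\<close> near it.
\<close>

locale truncation = bounded_domain \<Omega> for \<Omega> :: "'a::euclidean_space set" +
  fixes z :: "'a \<Rightarrow> real" and G :: "'a \<Rightarrow> 'a" and H :: "'a \<Rightarrow> 'a \<Rightarrow> 'a" and B :: real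
  assumes z_cont: "continuous_on UNIV z" and z_supp: "{x. z x \<noteq> 0} \<subseteq> \<Omega>"
    and z_C2: "C2_on {x. z x \<noteq> 0} z G H"
    and lap_bound: "\<And>x. z x \<noteq> 0 \<Longrightarrow> \<bar>trace_of H x\<bar> \<le> B"
begin

definition zgrad :: "'a \<Rightarrow> 'a" where "zgrad x = (if z x \<noteq> 0 then G x else 0)"

definition level :: "nat \<Rightarrow> real" where "level n = inverse (real (Suc n))"

definition cutoff :: "nat \<Rightarrow> 'a \<Rightarrow> real" where "cutoff n x = trunc (level n) (z x)"
definition cutoff_grad :: "nat \<Rightarrow> 'a \<Rightarrow> 'a" where "cutoff_grad n x = trunc' (level n) (z x) *\<^sub>R zgrad x"

lemma level_pos: "level n > 0" by (simp add: level_def)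
lemma level_lim: "level \<longlonglongrightarrow> 0" unfolding level_def by (rule LIMSEQ_inverse_real_of_nat)

lemma open_nonzero: "open {x. z x \<noteq> 0}"
  by (rule open_Collect_neq[OF z_cont]) simp

lemma z_out: "x \<notin> \<Omega> \<Longrightarrow> z x = 0" using z_supp by auto

lemma C1c_cutoff: "C1c {x. level n \<le> \<bar>z x\<bar>} (cutoff n) (cutoff_grad n)"
  unfolding C1c_def
proof (intro conjI allI impI)
  have sub: "{x. level n \<le> \<bar>z x\<bar>} \<subseteq> \<Omega>" using level_pos[of n] z_supp by auto
  have "closed {x. level n \<le> \<bar>z x\<bar>}" by (intro closed_Collect_le continuous_intros z_cont)
  then show "compact {x. level n \<le> \<bar>z x\<bar>}"
    using bounded_subset[OF bounded_domain sub] by (simp add: compact_eq_bounded_closed)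
  have op: "open {x. \<bar>z x\<bar> < level n}" by (intro open_Collect_less continuous_intros z_cont)
  fix x
  show "(cutoff n has_derivative (\<lambda>h. cutoff_grad n x \<bullet> h)) (at x)"
  proof (cases "z x = 0")
    case True
    have "((\<lambda>_. 0) has_derivative (\<lambda>h. cutoff_grad n x \<bullet> h)) (at x)"
      using True by (simp add: cutoff_grad_def zgrad_def)
    then show ?thesis
      by (rule has_derivative_transform_within_open[OF _ op])
        (use True level_pos in \<open>auto simp: cutoff_def trunc_zero\<close>)
  next
    case False
    have "((\<lambda>y. trunc (level n) (z y)) has_derivative (\<lambda>h. trunc' (level n) (z x) * (G x \<bullet> h))) (at x)"
      by (rule has_derivative_compose[OF C2_onD(1)[OF z_C2] trunc_deriv[OF level_pos, unfolded has_field_derivative_def]])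
        (use False in auto)
    then show ?thesis using False by (simp add: cutoff_def[abs_def] cutoff_grad_def zgrad_def)
  qed
  show "cutoff n x = 0" if "x \<notin> {x. level n \<le> \<bar>z x\<bar>}"
    using that level_pos by (simp add: cutoff_def trunc_zero)
next
  have op: "open {x. \<bar>z x\<bar> < level n}" by (intro open_Collect_less continuous_intros z_cont)
  have cov: "{x. z x \<noteq> 0} \<union> {x. \<bar>z x\<bar> < level n} = UNIV" using level_pos[of n] by auto
  show "continuous_on UNIV (cutoff_grad n)"
    unfolding cov[symmetric]
  proof (rule continuous_on_open_Un[OF open_nonzero op])
    have "continuous_on {x. z x \<noteq> 0} (\<lambda>x. trunc' (level n) (z x) *\<^sub>R G x)"
      by (intro continuous_intros C2_on_continuous_grad[OF z_C2] continuous_on_compose2[OF trunc'_continuous[OF level_pos]]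
          continuous_on_subset[OF z_cont]) auto
    then show "continuous_on {x. z x \<noteq> 0} (cutoff_grad n)"
      by (rule continuous_on_eq) (auto simp: cutoff_grad_def zgrad_def)
    have "continuous_on {x. \<bar>z x\<bar> < level n} (\<lambda>x. 0::'a)" by simp
    then show "continuous_on {x. \<bar>z x\<bar> < level n} (cutoff_grad n)"
      by (rule continuous_on_eq) (use level_pos in \<open>auto simp: cutoff_grad_def trunc_zero\<close>)
  qed
qed

lemma supp_nonzero: "{x. level n \<le> \<bar>z x\<bar>} \<subseteq> {x. z x \<noteq> 0}" using level_pos[of n] by auto

lemma supp_sub: "{x. level n \<le> \<bar>z x\<bar>} \<subseteq> \<Omega>" using supp_nonzero z_supp by blast

lemma cutoff_bound: "\<bar>cutoff n x\<bar> \<le> \<bar>z x\<bar>" by (simp add: cutoff_def trunc_bounds level_pos)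

lemma cutoff_grad_bound: "norm (cutoff_grad n x) \<le> norm (zgrad x)"
  using trunc_bounds[OF level_pos] by (simp add: cutoff_grad_def mult_left_le_one_le)

lemma cutoff_lim: "(\<lambda>n. cutoff n x) \<longlonglongrightarrow> z x"
  unfolding cutoff_def by (rule trunc_tendsto[OF level_lim level_pos])

lemma cutoff_grad_lim: "(\<lambda>n. cutoff_grad n x) \<longlonglongrightarrow> zgrad x"
proof (cases "z x = 0")
  case True
  then show ?thesis by (simp add: cutoff_grad_def zgrad_def)
next
  case False
  have "(\<lambda>n. trunc' (level n) (z x) *\<^sub>R zgrad x) \<longlonglongrightarrow> 1 *\<^sub>R zgrad x"
    by (intro tendsto_intros trunc_tendsto[OF level_lim level_pos] False)
  then show ?thesis by (simp add: cutoff_grad_def)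
qed

lemma z_bounded: "\<exists>A. \<forall>x. \<bar>z x\<bar> \<le> A"
proof -
  have "compact (closure \<Omega>)" using bounded_domain by (simp add: compact_closure)
  moreover have "z x = 0" if "x \<notin> closure \<Omega>" for x
    using that z_out closure_subset[of \<Omega>] by auto
  ultimately obtain A where "\<And>x. norm (z x) \<le> A" using compact_support_bounded[OF z_cont] by blast
  then show ?thesis by auto
qed

lemma z_measurable [measurable]: "z \<in> borel_measurable M"
  by (rule continuous_UNIV_measurable_M[OF z_cont])

lemma cutoff_grad_measurable [measurable]: "cutoff_grad n \<in> borel_measurable M"
  by (rule continuous_UNIV_measurable_M[OF C1cD(3)[OF C1c_cutoff]])

lemma zgrad_measurable [measurable]: "zgrad \<in> borel_measurable M"
  by (rule borel_measurable_LIMSEQ_metric[where f = cutoff_grad, OF cutoff_grad_measurable cutoff_grad_lim])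

lemma z_L2: "z \<in> L2 \<Omega>"
proof -
  obtain A where "\<And>x. \<bar>z x\<bar> \<le> A" using z_bounded by blast
  then show ?thesis by (intro bounded_L2[where B = A]) auto
qed

lemma lap_measurable: "(\<lambda>x. trace_of H x * z x) \<in> borel_measurable M"
proof (rule borel_measurable_LIMSEQ_metric)
  show "(\<lambda>x. trace_of H x * cutoff n x) \<in> borel_measurable M" for n
    using green_identity(3)[OF C1c_cutoff supp_nonzero z_C2 open_nonzero z_supp] by (rule borel_measurable_integrable)
  show "(\<lambda>n. trace_of H x * cutoff n x) \<longlonglongrightarrow> trace_of H x * z x" for x
    by (intro tendsto_intros cutoff_lim)
qed

lemma lap_integral_lim: "(\<lambda>n. \<integral>x. trace_of H x * cutoff n x \<partial>M) \<longlonglongrightarrow> (\<integral>x. trace_of H x * z x \<partial>M)"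
proof -
  obtain A where A: "\<And>x. \<bar>z x\<bar> \<le> A" using z_bounded by blast
  show ?thesis
  proof (rule integral_dominated_convergence[where w = "\<lambda>_. \<bar>B\<bar> * A"])
    show "(\<lambda>x. trace_of H x * cutoff n x) \<in> borel_measurable M" for n
      using green_identity(3)[OF C1c_cutoff supp_nonzero z_C2 open_nonzero z_supp] by (rule borel_measurable_integrable)
    show "AE x in M. (\<lambda>n. trace_of H x * cutoff n x) \<longlonglongrightarrow> trace_of H x * z x"
      by (intro AE_I2 tendsto_intros cutoff_lim)
    show "AE x in M. norm (trace_of H x * cutoff n x) \<le> \<bar>B\<bar> * A" for n
    proof (rule AE_I2)
      fix x
      show "norm (trace_of H x * cutoff n x) \<le> \<bar>B\<bar> * A"
      proof (cases "z x = 0")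
        case True
        then have "cutoff n x = 0" using cutoff_bound[of n x] by simp
        then show ?thesis using A[of x] by simp
      next
        case False
        have "\<bar>trace_of H x\<bar> \<le> \<bar>B\<bar>" using lap_bound[OF False] by linarith
        moreover have "\<bar>cutoff n x\<bar> \<le> A" using cutoff_bound[of n x] A[of x] by linarith
        ultimately show ?thesis by (simp add: abs_mult mult_mono)
      qed
    qed
  qed (simp_all add: lap_measurable)
qed

text \<open>
  Green's identity for \<open>z\<close> and its truncations bounds the integrals of \<open>T' \<bar>\<nabla>z\<bar>\<^sup>2\<close>, which increase
  to the integral of \<open>\<bar>\<nabla>z\<bar>\<^sup>2\<close>. So monotone convergence gives integrability and the value at once.
\<close>

lemma zgrad_energy:
  shows "integrable M (\<lambda>x. (norm (zgrad x))\<^sup>2)" "(\<integral>x. (norm (zgrad x))\<^sup>2 \<partial>M) = - (\<integral>x. trace_of H x * z x \<partial>M)"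
proof -
  have eq: "cutoff_grad n x \<bullet> G x = trunc' (level n) (z x) * (norm (zgrad x))\<^sup>2" for n x
    using level_pos[of n] by (auto simp: cutoff_grad_def zgrad_def power2_norm_eq_inner)
  have i: "integrable M (\<lambda>x. trunc' (level n) (z x) * (norm (zgrad x))\<^sup>2)" for n
    using green_identity(2)[OF C1c_cutoff supp_nonzero z_C2 open_nonzero z_supp, of n] by (simp only: eq)
  have m: "AE x in M. mono (\<lambda>n. trunc' (level n) (z x) * (norm (zgrad x))\<^sup>2)"
    by (intro AE_I2 monoI mult_right_mono trunc'_mono level_pos) (auto simp: level_def)
  have l: "AE x in M. (\<lambda>n. trunc' (level n) (z x) * (norm (zgrad x))\<^sup>2) \<longlonglongrightarrow> (norm (zgrad x))\<^sup>2"
  proof (rule AE_I2)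
    fix x
    show "(\<lambda>n. trunc' (level n) (z x) * (norm (zgrad x))\<^sup>2) \<longlonglongrightarrow> (norm (zgrad x))\<^sup>2"
    proof (cases "z x = 0")
      case True
      then show ?thesis by (simp add: zgrad_def)
    next
      case False
      have "(\<lambda>n. trunc' (level n) (z x) * (norm (zgrad x))\<^sup>2) \<longlonglongrightarrow> 1 * (norm (zgrad x))\<^sup>2"
        by (intro tendsto_intros trunc_tendsto[OF level_lim level_pos] False)
      then show ?thesis by simp
    qed
  qed
  have "(\<integral>x. trunc' (level n) (z x) * (norm (zgrad x))\<^sup>2 \<partial>M) = - (\<integral>x. trace_of H x * cutoff n x \<partial>M)" for n
    using green_identity(1)[OF C1c_cutoff supp_nonzero z_C2 open_nonzero z_supp, of n] by (simp only: eq)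
  then have il: "(\<lambda>n. \<integral>x. trunc' (level n) (z x) * (norm (zgrad x))\<^sup>2 \<partial>M) \<longlonglongrightarrow> - (\<integral>x. trace_of H x * z x \<partial>M)"
    using tendsto_minus[OF lap_integral_lim] by simp
  have meas: "(\<lambda>x. (norm (zgrad x))\<^sup>2) \<in> borel_measurable M" by measurable
  show "integrable M (\<lambda>x. (norm (zgrad x))\<^sup>2)" "(\<integral>x. (norm (zgrad x))\<^sup>2 \<partial>M) = - (\<integral>x. trace_of H x * z x \<partial>M)"
    using integrable_monotone_convergence[OF i m l il meas] integral_monotone_convergence[OF i m l il meas] .
qed

lemma zgrad_L2: "zgrad \<in> L2 \<Omega>" using zgrad_energy(1) by (simp add: L2_def)

lemma z_weak_gradient: "has_weak_gradient \<Omega> z zgrad" and z_H10: "z \<in> H10 \<Omega>"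
  using H10_limit[OF C1c_cutoff supp_sub z_L2 zgrad_L2 cutoff_lim cutoff_grad_lim cutoff_bound cutoff_grad_bound] .

lemma green_weak:
  assumes u: "C2_on \<Omega> u Gu Hu" "Gu \<in> L2 \<Omega>" and Bu: "\<And>x. x \<in> \<Omega> \<Longrightarrow> \<bar>trace_of Hu x\<bar> \<le> Bu"
  shows "(\<integral>x. zgrad x \<bullet> Gu x \<partial>M) = - (\<integral>x. trace_of Hu x * z x \<partial>M)"
proof -
  note [measurable] = L2D(1)[OF u(2)] continuous_measurable_M[OF C2_on_continuous_trace[OF u(1)]]
    continuous_UNIV_measurable_M[OF C1c_continuous[OF C1c_cutoff]]
  obtain A where A: "\<And>x. \<bar>z x\<bar> \<le> A" using z_bounded by blast
  have 1: "(\<lambda>n. \<integral>x. cutoff_grad n x \<bullet> Gu x \<partial>M) \<longlonglongrightarrow> (\<integral>x. zgrad x \<bullet> Gu x \<partial>M)"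
  proof (rule integral_dominated_convergence[where w = "\<lambda>x. (norm (zgrad x))\<^sup>2 + (norm (Gu x))\<^sup>2"])
    show "integrable M (\<lambda>x. (norm (zgrad x))\<^sup>2 + (norm (Gu x))\<^sup>2)"
      using zgrad_energy(1) L2D(2)[OF u(2)] by simp
    show "AE x in M. (\<lambda>n. cutoff_grad n x \<bullet> Gu x) \<longlonglongrightarrow> zgrad x \<bullet> Gu x"
      by (intro AE_I2 tendsto_intros cutoff_grad_lim)
    show "AE x in M. norm (cutoff_grad n x \<bullet> Gu x) \<le> (norm (zgrad x))\<^sup>2 + (norm (Gu x))\<^sup>2" for n
    proof (rule AE_I2)
      fix x
      have "norm (cutoff_grad n x \<bullet> Gu x) \<le> norm (cutoff_grad n x) * norm (Gu x)"
        using Cauchy_Schwarz_ineq2[of "cutoff_grad n x" "Gu x"] by simp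
      also have "\<dots> \<le> norm (zgrad x) * norm (Gu x)"
        by (intro mult_right_mono cutoff_grad_bound norm_ge_zero)
      also have "\<dots> \<le> (norm (zgrad x))\<^sup>2 + (norm (Gu x))\<^sup>2"
        by (rule mult_le_sum_squares)
      finally show "norm (cutoff_grad n x \<bullet> Gu x) \<le> (norm (zgrad x))\<^sup>2 + (norm (Gu x))\<^sup>2" .
    qed
  qed measurable
  have 2: "(\<lambda>n. \<integral>x. trace_of Hu x * cutoff n x \<partial>M) \<longlonglongrightarrow> (\<integral>x. trace_of Hu x * z x \<partial>M)"
  proof (rule integral_dominated_convergence[where w = "\<lambda>_. \<bar>Bu\<bar> * A"])
    show "AE x in M. (\<lambda>n. trace_of Hu x * cutoff n x) \<longlonglongrightarrow> trace_of Hu x * z x"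
      by (intro AE_I2 tendsto_intros cutoff_lim)
    show "AE x in M. norm (trace_of Hu x * cutoff n x) \<le> \<bar>Bu\<bar> * A" for n
    proof (rule AE_M_I)
      fix x assume "x \<in> \<Omega>"
      then have "\<bar>trace_of Hu x\<bar> \<le> \<bar>Bu\<bar>" using Bu[of x] by linarith
      moreover have "\<bar>cutoff n x\<bar> \<le> A" using cutoff_bound[of n x] A[of x] by linarith
      ultimately show "norm (trace_of Hu x * cutoff n x) \<le> \<bar>Bu\<bar> * A" by (simp add: abs_mult mult_mono)
    qed
    show "integrable M (\<lambda>_. \<bar>Bu\<bar> * A)" by (rule integrable_const_M)
  qed measurable
  have "(\<integral>x. cutoff_grad n x \<bullet> Gu x \<partial>M) = - (\<integral>x. trace_of Hu x * cutoff n x \<partial>M)" for n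
    by (rule green_identity(1)[OF C1c_cutoff supp_sub u(1) open_domain subset_refl])
  then show ?thesis using LIMSEQ_unique[OF 1] tendsto_minus[OF 2] by simp
qed

end


section \<open>Hopf's lemma and the strong maximum principle\<close>

lemma second_derivative_nonneg_at_min:
  fixes g :: "real \<Rightarrow> real"
  assumes d: "d > 0" and g: "\<And>t. \<bar>t\<bar> < d \<Longrightarrow> (g has_real_derivative g' t) (at t)"
    and g': "(g' has_real_derivative c) (at 0)" and min: "\<And>t. \<bar>t\<bar> < d \<Longrightarrow> g 0 \<le> g t"
  shows "c \<ge> 0"
proof (rule ccontr)
  assume "\<not> c \<ge> 0"
  have "g' 0 = 0" by (rule DERIV_local_min[OF g d]) (use d min in auto)
  moreover obtain \<delta> where \<delta>: "\<delta> > 0" "\<And>h. h > 0 \<Longrightarrow> h < \<delta> \<Longrightarrow> g' (0 + h) < g' 0"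
    using DERIV_neg_dec_right[OF g'] \<open>\<not> c \<ge> 0\<close> by auto
  ultimately have neg: "g' h < 0" if "0 < h" "h < \<delta>" for h using \<delta>(2)[of h] that by simp
  define t where "t = min d \<delta> / 2"
  have t: "t > 0" "t < d" "t < \<delta>" using d \<delta> by (auto simp: t_def)
  obtain s where s: "0 < s" "s < t" "g t - g 0 = (t - 0) * g' s"
    using MVT2[of 0 t g g'] t g by auto
  then have "g t - g 0 < 0" using neg[of s] t by (simp add: mult_pos_neg)
  then show False using min[of t] t by simp
qed

text \<open>
  In the shell between radii \<open>R / 2\<close> and \<open>R\<close>, the function \<open>v\<close> lies above a multiple of the barrier
  \<open>h x = exp (- \<alpha> \<bar>x - c\<bar>\<^sup>2) - exp (- \<alpha> R\<^sup>2)\<close>, for which \<open>\<Delta>h > L h\<close>. The barrier has a positive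
  inward derivative at \<open>y\<close>, whereas that of \<open>v\<close> is assumed to be zero.
\<close>

lemma hopf_boundary_point:
  fixes c y :: "'a::euclidean_space"
  assumes R: "R > 0" "dist c y = R"
    and v: "C2_on (ball c R) v G H" "continuous_on (cball c R) v"
    and pos: "\<And>x. x \<in> ball c R \<Longrightarrow> v x > 0" and y0: "v y = 0"
    and sup: "\<And>x. x \<in> ball c R \<Longrightarrow> trace_of H x \<le> L * v x" and L: "L \<ge> 0"
    and crit: "(v has_derivative (\<lambda>_. 0)) (at y)"
  shows False
proof -
  define N where "N = real DIM('a)"
  \<comment> \<open>Large enough for \<open>4 \<alpha>\<^sup>2 \<rho>\<^sup>2 - 2 \<alpha> N > L\<close> for every
    \<open>\<rho> \<ge> R / 2\<close>; the left-hand side is the factor of the exponential in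
    \<open>\<Delta>h\<close>.\<close>
  define \<alpha> where "\<alpha> = (2 * N + L + 1) / R\<^sup>2 + 1"
  have N: "N \<ge> 0" by (simp add: N_def)
  have \<alpha>1: "\<alpha> \<ge> 1" using R L N by (simp add: \<alpha>_def)
  have "\<alpha> * R\<^sup>2 = 2 * N + L + 1 + R\<^sup>2" using R by (simp add: \<alpha>_def field_simps)
  then have "\<alpha> * R\<^sup>2 - 2 * N \<ge> L + 1" by simp
  then have "\<alpha> * (\<alpha> * R\<^sup>2 - 2 * N) \<ge> 1 * (L + 1)" using \<alpha>1 L by (intro mult_mono) auto
  then have \<alpha>: "\<alpha>\<^sup>2 * R\<^sup>2 - 2 * \<alpha> * N > L" by (simp add: power2_eq_square algebra_simps)
  define E where "E s = exp (- (\<alpha> * s))" for s :: real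
  define h where "h x = E ((x - c) \<bullet> (x - c)) - E (R\<^sup>2)" for x
  have hcont: "continuous_on UNIV h" unfolding h_def E_def by (intro continuous_intros)
  have normeq: "(x - c) \<bullet> (x - c) = (dist c x)\<^sup>2" for x
    by (simp add: dist_norm norm_minus_commute[of c x] power2_norm_eq_inner)
  have vnn: "v x \<ge> 0" if "x \<in> cball c R" for x
  proof -
    have "closure (ball c R) = cball c R" using R by simp
    then show ?thesis
      using continuous_ge_on_closure[of "ball c R" v x 0] v(2) that pos less_imp_le by auto
  qed
  define A where "A = cball c R - ball c (R / 2)"
  have A: "compact A" unfolding A_def by (intro compact_diff compact_cball open_ball)
  have yA: "y \<in> A" using R by (simp add: A_def)
  obtain m where m: "m > 0" "\<And>x. dist c x = R / 2 \<Longrightarrow> m \<le> v x"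
  proof -
    have ne: "sphere c (R / 2) \<noteq> {}" using R by simp
    have "continuous_on (sphere c (R / 2)) v"
    proof (rule continuous_on_subset[OF v(2)])
      show "sphere c (R / 2) \<subseteq> cball c R"
      proof
        fix x assume "x \<in> sphere c (R / 2)"
        then have "dist c x = R / 2" by simp
        then show "x \<in> cball c R" using R(1) by simp
      qed
    qed
    from continuous_attains_inf[OF compact_sphere ne this]
    obtain x0 where x0: "x0 \<in> sphere c (R / 2)" "\<forall>x\<in>sphere c (R / 2). v x0 \<le> v x" by blast
    have "dist c x0 = R / 2" using x0(1) by simp
    then have "v x0 > 0" using R(1) by (intro pos) simp
    then show ?thesis using that[of "v x0"] x0(2) by simp
  qed
  have hle: "h x \<le> E ((x - c) \<bullet> (x - c))" "E ((x - c) \<bullet> (x - c)) \<le> 1" for x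
    using \<alpha>1 by (auto simp: h_def E_def)
  define w where "w x = v x - m * h x" for x
  have wcont: "continuous_on A w"
    unfolding w_def by (intro continuous_intros continuous_on_subset[OF v(2)] continuous_on_subset[OF hcont]) (auto simp: A_def)
  obtain p where p: "p \<in> A" "\<And>x. x \<in> A \<Longrightarrow> w p \<le> w x"
    using continuous_attains_inf[OF A _ wcont] yA by blast
  \<comment> \<open>A negative minimum of \<open>w = v - m h\<close> is interior, where its Laplacian would be
    nonnegative by the one-dimensional second derivative test along each axis.\<close>
  have wnn: "w p \<ge> 0"
  proof (rule ccontr)
    assume neg: "\<not> w p \<ge> 0"
    consider "dist c p = R" | "dist c p = R / 2" | "R / 2 < dist c p" "dist c p < R"
      using p(1) by (auto simp: A_def) linarith
    then show False
    proof cases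
      case 1
      then have "h p = 0" by (simp add: h_def normeq)
      then show False using vnn[of p] 1 neg by (simp add: w_def)
    next
      case 2
      have "m * h p \<le> m * 1" using hle[of p] m(1) by (intro mult_left_mono) auto
      then show False using m(2)[OF 2] neg by (simp add: w_def)
    next
      case 3
      define U where "U = ball c R - cball c (R / 2)"
      have U: "open U" "p \<in> U" "U \<subseteq> A" "U \<subseteq> ball c R" using 3 by (auto simp: U_def A_def open_Diff)
      obtain d where d: "d > 0" "ball p d \<subseteq> U" using U(1,2) open_contains_ball by blast
      have pb: "p \<in> ball c R" using U by auto
      define e where "e = E ((p - c) \<bullet> (p - c))"
      have e: "e > 0" by (simp add: e_def E_def)
      have key: "m * ((4 * \<alpha>\<^sup>2 * ((p - c) \<bullet> i)\<^sup>2 - 2 * \<alpha>) * e) \<le> H i p \<bullet> i" if i: "i \<in> Basis" for i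
      proof -
        let ?b = "(p - c) \<bullet> i"
        define Q where "Q t = (p - c) \<bullet> (p - c) + 2 * t * ?b + t\<^sup>2" for t
        have Qeq: "(p + t *\<^sub>R i - c) \<bullet> (p + t *\<^sub>R i - c) = Q t" for t
          using i by (simp add: Q_def inner_add_left inner_add_right inner_diff_left inner_diff_right
              inner_commute power2_eq_square algebra_simps)
        define g where "g t = v (p + t *\<^sub>R i) - m * (E (Q t) - E (R\<^sup>2))" for t
        define g' where "g' t = G (p + t *\<^sub>R i) \<bullet> i - m * (- (\<alpha> * (2 * ?b + 2 * t)) * E (Q t))" for t
        have geq: "g t = w (p + t *\<^sub>R i)" for t by (simp add: g_def w_def h_def Qeq)
        have inb: "p + t *\<^sub>R i \<in> U" if "\<bar>t\<bar> < d" for t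
          using d(2) that i by (auto simp: dist_norm intro!: subsetD[OF d(2)])
        have "m * ((4 * \<alpha>\<^sup>2 * ?b\<^sup>2 - 2 * \<alpha>) * e) \<le> H i p \<bullet> i \<longleftrightarrow> 0 \<le> H i p \<bullet> i - m * ((4 * \<alpha>\<^sup>2 * ?b\<^sup>2 - 2 * \<alpha>) * e)"
          by linarith
        also have "\<dots>"
        proof (rule second_derivative_nonneg_at_min[OF d(1), of g g'])
          fix t assume t: "\<bar>t\<bar> < d"
          have x: "p + t *\<^sub>R i \<in> ball c R" using inb[OF t] U by auto
          have "((\<lambda>t. v (p + t *\<^sub>R i)) has_derivative (\<lambda>s. G (p + t *\<^sub>R i) \<bullet> (s *\<^sub>R i))) (at t)"
            by (rule has_derivative_compose[where g = v and f = "\<lambda>t. p + t *\<^sub>R i", OF _ C2_onD(1)[OF v(1) x]]) (auto intro!: derivative_eq_intros)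
          then have 1: "((\<lambda>t. v (p + t *\<^sub>R i)) has_real_derivative G (p + t *\<^sub>R i) \<bullet> i) (at t)"
            unfolding has_field_derivative_def by (rule has_derivative_eq_rhs) (auto simp: mult.commute)
          have 2: "((\<lambda>t. E (Q t)) has_real_derivative - (\<alpha> * (2 * ?b + 2 * t)) * E (Q t)) (at t)"
            unfolding E_def Q_def by (auto intro!: derivative_eq_intros simp: algebra_simps)
          show "(g has_real_derivative g' t) (at t)"
            unfolding g_def g'_def
            using DERIV_diff[OF 1 DERIV_cmult[OF DERIV_diff[OF 2 DERIV_const[of "E (R\<^sup>2)"]], of m]]
            by (simp only: diff_0_right)
          show "g 0 \<le> g t" unfolding geq using p(2)[of "p + t *\<^sub>R i"] inb[OF t] U(3) by auto
        next
          have "((\<lambda>t. G (p + t *\<^sub>R i) \<bullet> i) has_derivative (\<lambda>s. H i p \<bullet> (s *\<^sub>R i))) (at 0)"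
            by (rule has_derivative_compose[where g = "\<lambda>x. G x \<bullet> i" and f = "\<lambda>t. p + t *\<^sub>R i" and x = 0 and s = UNIV, simplified])
              (use C2_onD(2)[OF v(1) i pb] in \<open>auto intro!: derivative_eq_intros\<close>)
          then have 1: "((\<lambda>t. G (p + t *\<^sub>R i) \<bullet> i) has_real_derivative H i p \<bullet> i) (at 0)"
            unfolding has_field_derivative_def by (rule has_derivative_eq_rhs) (auto simp: mult.commute)
          have Q0: "E (Q 0) = e" by (simp add: Q_def e_def)
          have 2: "((\<lambda>t. - (\<alpha> * (2 * ?b + 2 * t)) * E (Q t)) has_real_derivative (4 * \<alpha>\<^sup>2 * ?b\<^sup>2 - 2 * \<alpha>) * E (Q 0)) (at 0)"
            unfolding E_def Q_def by (auto intro!: derivative_eq_intros simp: algebra_simps power2_eq_square)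
          show "(g' has_real_derivative H i p \<bullet> i - m * ((4 * \<alpha>\<^sup>2 * ?b\<^sup>2 - 2 * \<alpha>) * e)) (at 0)"
            unfolding g'_def using DERIV_diff[OF 1 DERIV_cmult[OF 2, of m]] by (simp only: Q0)
        qed
        finally show ?thesis .
      qed
      have "(\<Sum>i\<in>Basis. m * ((4 * \<alpha>\<^sup>2 * ((p - c) \<bullet> i)\<^sup>2 - 2 * \<alpha>) * e)) \<le> trace_of H p"
        unfolding trace_of_def by (intro sum_mono key)
      also have "(\<Sum>i\<in>Basis. m * ((4 * \<alpha>\<^sup>2 * ((p - c) \<bullet> i)\<^sup>2 - 2 * \<alpha>) * e))
          = m * ((4 * \<alpha>\<^sup>2 * ((p - c) \<bullet> (p - c)) - 2 * \<alpha> * N) * e)"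
        by (subst euclidean_inner[of "p - c" "p - c"])
          (simp add: N_def sum_subtractf power2_eq_square flip: sum_distrib_left sum_distrib_right)
      finally have 4: "m * ((4 * \<alpha>\<^sup>2 * ((p - c) \<bullet> (p - c)) - 2 * \<alpha> * N) * e) \<le> trace_of H p" .
      have "(p - c) \<bullet> (p - c) \<ge> (R / 2)\<^sup>2" unfolding normeq using 3 R by (intro power_mono) auto
      then have "4 * \<alpha>\<^sup>2 * ((p - c) \<bullet> (p - c)) \<ge> 4 * \<alpha>\<^sup>2 * (R / 2)\<^sup>2" by (intro mult_left_mono) auto
      then have "4 * \<alpha>\<^sup>2 * ((p - c) \<bullet> (p - c)) - 2 * \<alpha> * N > L" using \<alpha> by (simp add: power_divide)
      then have "L * (m * e) < (4 * \<alpha>\<^sup>2 * ((p - c) \<bullet> (p - c)) - 2 * \<alpha> * N) * (m * e)"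
        using m(1) e by (intro mult_strict_right_mono) auto
      then have "L * (m * e) < trace_of H p" using 4 by (simp add: mult_ac)
      also have "\<dots> \<le> L * v p" by (rule sup[OF pb])
      also have "\<dots> \<le> L * (m * h p)" using neg L by (intro mult_left_mono) (auto simp: w_def)
      also have "\<dots> \<le> L * (m * e)" using hle(1)[of p] L m(1) by (intro mult_left_mono) (auto simp: e_def)
      finally show False by simp
    qed
  qed
  define k where "k t = m * (E ((1 - t)\<^sup>2 * R\<^sup>2) - E (R\<^sup>2))" for t
  define q where "q t = v (y + t *\<^sub>R (c - y)) - k t" for t
  have q_nonneg: "q t \<ge> 0" if t: "0 < t" "t < 1 / 2" for t
  proof -
    let ?x = "y + t *\<^sub>R (c - y)"
    have eq: "c - ?x = (1 - t) *\<^sub>R (c - y)" by (simp add: algebra_simps)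
    have dx: "dist c ?x = (1 - t) * R" unfolding dist_norm eq using t R by (simp add: dist_norm)
    have "(1 - t) * R \<le> 1 * R" "(1 / 2) * R \<le> (1 - t) * R" using t R by (intro mult_right_mono; simp)+
    then have "?x \<in> A" by (simp add: A_def dx)
    then have "w ?x \<ge> 0" using p(2) wnn order_trans by blast
    moreover have "h ?x = E ((1 - t)\<^sup>2 * R\<^sup>2) - E (R\<^sup>2)"
      by (simp add: h_def normeq dx power_mult_distrib)
    ultimately show ?thesis by (simp add: q_def w_def k_def)
  qed
  have "((\<lambda>t. v (y + t *\<^sub>R (c - y))) has_derivative (\<lambda>s. 0)) (at 0)"
    by (rule has_derivative_compose[where g = v and f = "\<lambda>t. y + t *\<^sub>R (c - y)" and x = 0 and s = UNIV and g' = "\<lambda>_. 0", simplified])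
      (use crit in \<open>auto intro!: derivative_eq_intros\<close>)
  then have 1: "((\<lambda>t. v (y + t *\<^sub>R (c - y))) has_real_derivative 0) (at 0)"
    unfolding has_field_derivative_def by (rule has_derivative_eq_rhs) auto
  have 2: "(k has_real_derivative m * (2 * \<alpha> * R\<^sup>2 * E (R\<^sup>2))) (at 0)"
    unfolding k_def E_def by (auto intro!: derivative_eq_intros simp: algebra_simps)
  have 3: "(q has_real_derivative 0 - m * (2 * \<alpha> * R\<^sup>2 * E (R\<^sup>2))) (at 0)"
    unfolding q_def by (rule DERIV_diff[OF 1 2])
  have "0 - m * (2 * \<alpha> * R\<^sup>2 * E (R\<^sup>2)) < 0" using m(1) \<alpha>1 R by (simp add: E_def)
  from DERIV_neg_dec_right[OF 3 this]
  obtain d where d: "d > 0" "\<And>t. 0 < t \<Longrightarrow> t < d \<Longrightarrow> q (0 + t) < q 0" by auto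
  have "q 0 = 0" by (simp add: q_def k_def y0)
  moreover have "q (min d (1/2) / 2) < q 0" using d(2)[of "min d (1/2) / 2"] d(1) by auto
  moreover have "q (min d (1/2) / 2) \<ge> 0" using d(1) by (intro q_nonneg) auto
  ultimately show False by simp
qed

text \<open>
  If \<open>v\<close> has a zero, connectedness yields a ball on which \<open>v\<close> is positive and whose boundary contains a
  zero in \<open>D\<close>. That zero is an interior minimum, so the gradient vanishes there, against Hopf's lemma.
\<close>

lemma strong_maximum_principle:
  fixes D :: "'a::euclidean_space set"
  assumes D: "open D" "connected D" and v: "C2_on D v G H"
    and nn: "\<And>x. x \<in> D \<Longrightarrow> v x \<ge> 0" and sup: "\<And>x. x \<in> D \<Longrightarrow> trace_of H x \<le> L * v x" and L: "L \<ge> 0"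
    and nz: "\<exists>x\<in>D. v x \<noteq> 0" and x: "x \<in> D"
  shows "v x > 0"
proof (rule ccontr)
  assume "\<not> v x > 0"
  then have x0: "v x = 0" using nn[OF x] by simp
  note cont = C2_on_continuous[OF v]
  define Z where "Z = {x \<in> D. v x = 0}"
  have opos: "open {x \<in> D. v x \<noteq> 0}"
  proof -
    have "{x \<in> D. v x \<noteq> 0} = D \<inter> v -` (- {0})" by auto
    then show ?thesis using continuous_open_preimage[OF cont D(1), of "- {0}"] by (simp add: open_Compl)
  qed
  have "\<not> open Z"
  proof
    assume "open Z"
    moreover have "Z \<inter> {x \<in> D. v x \<noteq> 0} \<inter> D = {}" "D \<subseteq> Z \<union> {x \<in> D. v x \<noteq> 0}" by (auto simp: Z_def)
    ultimately have "Z \<inter> D = {} \<or> {x \<in> D. v x \<noteq> 0} \<inter> D = {}" using connectedD[OF D(2) _ opos] by blast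
    then show False using nz x x0 by (auto simp: Z_def)
  qed
  then obtain z where z: "z \<in> Z" "\<And>e. e > 0 \<Longrightarrow> \<not> ball z e \<subseteq> Z" unfolding open_contains_ball by blast
  then have zD: "z \<in> D" "v z = 0" by (auto simp: Z_def)
  obtain \<rho> where \<rho>: "\<rho> > 0" "cball z \<rho> \<subseteq> D" using D(1) zD open_contains_cball by blast
  \<comment> \<open>The point \<open>p\<close> is closer to the zero \<open>z\<close> than to the boundary of
    \<open>D\<close>, so its nearest zero lies in \<open>D\<close>.\<close>
  obtain p where p: "p \<in> ball z (\<rho> / 2)" "p \<notin> Z"
  proof -
    have "\<not> ball z (\<rho> / 2) \<subseteq> Z" using z(2)[of "\<rho> / 2"] \<rho>(1) by simp
    then show ?thesis using that by blast
  qed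
  have pz: "dist z p < \<rho> / 2" using p by simp
  define S where "S = {x \<in> cball z \<rho>. v x = 0}"
  have "closed S" unfolding S_def
    by (rule continuous_closed_preimage_constant[OF continuous_on_subset[OF cont \<rho>(2)] closed_cball])
  moreover have zS: "z \<in> S" using \<rho> zD by (simp add: S_def)
  ultimately obtain y where y: "y \<in> S" "\<And>x. x \<in> S \<Longrightarrow> dist p y \<le> dist p x"
    using distance_attains_inf[of S p] by blast
  define R where "R = dist p y"
  have Rle: "R < \<rho> / 2" using y(2)[OF zS] pz by (simp add: R_def dist_commute)
  have cb: "cball p R \<subseteq> cball z \<rho>"
  proof
    fix x assume "x \<in> cball p R"
    then show "x \<in> cball z \<rho>" using dist_triangle[of z x p] Rle pz by simp
  qed
  have pD: "p \<in> D" using p(1) \<rho> by auto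
  have "v p \<noteq> 0" using p(2) pD by (simp add: Z_def)
  have Rpos: "R > 0"
  proof (rule ccontr)
    assume "\<not> R > 0"
    then have "p = y" by (simp add: R_def)
    then show False using y(1) \<open>v p \<noteq> 0\<close> by (simp add: S_def)
  qed
  have sub: "ball p R \<subseteq> D" "cball p R \<subseteq> D" using cb \<rho>(2) ball_subset_cball[of p R] by (meson order_trans)+
  have yD: "y \<in> D" "v y = 0" using y(1) \<rho>(2) by (auto simp: S_def)
  have "(\<lambda>h. G y \<bullet> h) = (\<lambda>h. 0)"
    by (rule differential_zero_maxmin[OF yD(1) D(1) C2_onD(1)[OF v yD(1)]]) (use nn yD in auto)
  then have crit: "(v has_derivative (\<lambda>_. 0)) (at y)" using C2_onD(1)[OF v yD(1)] by simp
  show False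
  proof (rule hopf_boundary_point[OF Rpos _ C2_on_subset[OF v sub(1)] continuous_on_subset[OF cont sub(2)] _ yD(2) _ L crit])
    show "dist p y = R" by (simp add: R_def)
    fix x assume xb: "x \<in> ball p R"
    then have xD: "x \<in> D" using sub by auto
    show "trace_of H x \<le> L * v x" by (rule sup[OF xD])
    have "v x \<noteq> 0"
    proof
      assume "v x = 0"
      moreover have "x \<in> cball z \<rho>" using xb by (intro subsetD[OF cb]) simp
      ultimately have "x \<in> S" by (simp add: S_def)
      then show False using y(2)[of x] xb by (simp add: R_def)
    qed
    then show "v x > 0" using nn[OF xD] by simp
  qed
qed

section \<open>Reflections and radial domains\<close>

definition reflect :: "'a::euclidean_space \<Rightarrow> 'a \<Rightarrow> 'a" where
  "reflect e x = x - (2 * (x \<bullet> e) / (e \<bullet> e)) *\<^sub>R e"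

lemma reflect_linear: "linear (reflect e)"
  by (rule linearI) (simp_all add: reflect_def inner_add_left algebra_simps add_divide_distrib)

lemma reflect_reflect: "reflect e (reflect e x) = x"
  by (cases "e = 0") (auto simp: reflect_def inner_diff_left scaleR_left_distrib[symmetric] algebra_simps)

lemma reflect_inner: "reflect e x \<bullet> y = x \<bullet> reflect e y"
  by (simp add: reflect_def inner_diff_left inner_diff_right inner_commute)

lemma reflect_norm: "norm (reflect e x) = norm x"
  by (simp add: norm_eq_sqrt_inner reflect_inner reflect_reflect)

lemma reflect_normal: "reflect e x \<bullet> e = - (x \<bullet> e)"
  by (cases "e = 0") (auto simp: reflect_def inner_diff_left)

lemma reflect_fixed: "x \<bullet> e = 0 \<Longrightarrow> reflect e x = x"
  by (simp add: reflect_def)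

lemma reflect_swap:
  assumes "norm x = norm y"
  shows "reflect (y - x) x = y"
proof (cases "x = y")
  case False
  have "x \<bullet> x = y \<bullet> y" using assms by (simp add: norm_eq)
  then have "(y - x) \<bullet> (y - x) = - (2 * (x \<bullet> (y - x)))"
    by (simp add: inner_diff_left inner_diff_right inner_commute)
  moreover have "(y - x) \<bullet> (y - x) \<noteq> 0" using False by simp
  ultimately have "2 * (x \<bullet> (y - x)) / ((y - x) \<bullet> (y - x)) = -1" by (simp add: field_simps)
  then show ?thesis by (simp add: reflect_def)
qed (simp add: reflect_def)

lemma reflect_has_derivative: "(reflect e has_derivative reflect e) (at x)"
  by (rule bounded_linear_imp_has_derivative) (simp add: linear_conv_bounded_linear[symmetric] reflect_linear)

lemma reflect_continuous: "continuous_on S (reflect e)"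
  unfolding reflect_def divide_inverse by (intro continuous_intros)

text \<open>
  The Laplacian commutes with the reflection because the trace of the Hessian does not depend on the
  orthonormal basis.
\<close>

lemma C2_on_reflect:
  assumes C: "C2_on D u G H"
  shows "C2_on (reflect e -` D) (\<lambda>x. u (reflect e x)) (\<lambda>x. reflect e (G (reflect e x)))
      (\<lambda>i x. \<Sum>j\<in>Basis. (reflect e i \<bullet> j) *\<^sub>R reflect e (H j (reflect e x)))"
    and "trace_of (\<lambda>i x. \<Sum>j\<in>Basis. (reflect e i \<bullet> j) *\<^sub>R reflect e (H j (reflect e x))) x = trace_of H (reflect e x)"
proof -
  let ?s = "reflect e"
  show "C2_on (?s -` D) (\<lambda>x. u (?s x)) (\<lambda>x. ?s (G (?s x))) (\<lambda>i x. \<Sum>j\<in>Basis. (?s i \<bullet> j) *\<^sub>R ?s (H j (?s x)))"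
    unfolding C2_on_def
  proof (intro conjI ballI)
    fix x assume x: "x \<in> ?s -` D"
    then have sx: "?s x \<in> D" by simp
    show "((\<lambda>x. u (?s x)) has_derivative (\<lambda>h. ?s (G (?s x)) \<bullet> h)) (at x)"
      using has_derivative_compose[OF reflect_has_derivative C2_onD(1)[OF C sx]]
      by (simp add: reflect_inner)
    fix i :: 'a assume i: "i \<in> Basis"
    have eq: "(\<lambda>y. ?s (G (?s y)) \<bullet> i) = (\<lambda>y. \<Sum>j\<in>Basis. (?s i \<bullet> j) * (G (?s y) \<bullet> j))"
      by (rule ext, subst reflect_inner, subst euclidean_inner) (simp add: mult.commute)
    show "((\<lambda>y. ?s (G (?s y)) \<bullet> i) has_derivative (\<lambda>h. (\<Sum>j\<in>Basis. (?s i \<bullet> j) *\<^sub>R ?s (H j (?s x))) \<bullet> h)) (at x)"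
      unfolding eq inner_sum_left inner_scaleR_left reflect_inner[of e "H _ _"]
      by (intro has_derivative_sum has_derivative_mult_right
          has_derivative_compose[OF reflect_has_derivative C2_onD(2)[OF C _ sx]])
  next
    fix i :: 'a
    have "continuous_on (?s -` D) (\<lambda>x. H j (?s x))" if "j \<in> Basis" for j
      by (rule continuous_on_compose2[OF C2_onD(3)[OF C that] reflect_continuous]) auto
    then show "continuous_on (?s -` D) (\<lambda>x. \<Sum>j\<in>Basis. (?s i \<bullet> j) *\<^sub>R ?s (H j (?s x)))"
      by (intro continuous_on_sum continuous_on_scaleR continuous_on_const continuous_on_compose2[OF reflect_continuous]) auto
  qed
  have "trace_of (\<lambda>i x. \<Sum>j\<in>Basis. (?s i \<bullet> j) *\<^sub>R ?s (H j (?s x))) x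
      = (\<Sum>i\<in>Basis. \<Sum>j\<in>Basis. (?s i \<bullet> j) * (?s (H j (?s x)) \<bullet> i))"
    by (simp add: trace_of_def inner_sum_left)
  also have "\<dots> = (\<Sum>j\<in>Basis. \<Sum>i\<in>Basis. (?s j \<bullet> i) * (?s (H j (?s x)) \<bullet> i))"
  proof -
    have "?s i \<bullet> j = ?s j \<bullet> i" for i j by (metis reflect_inner inner_commute)
    then show ?thesis by (subst sum.swap) simp
  qed
  also have "\<dots> = (\<Sum>j\<in>Basis. ?s j \<bullet> ?s (H j (?s x)))"
    by (intro sum.cong refl euclidean_inner[symmetric])
  also have "\<dots> = trace_of H (?s x)"
    by (simp add: trace_of_def reflect_inner reflect_reflect inner_commute)
  finally show "trace_of (\<lambda>i x. \<Sum>j\<in>Basis. (?s i \<bullet> j) *\<^sub>R ?s (H j (?s x))) x = trace_of H (?s x)" .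
qed

text \<open>
  The half shell is the image of the product of an interval and a half-space under
  \<open>(t, x) \<mapsto> t x / \<bar>x\<bar>\<close>.
\<close>

lemma connected_half_shell:
  fixes e :: "'a::euclidean_space"
  assumes "a \<ge> 0"
  shows "connected {x. x \<bullet> e > 0 \<and> a < norm x \<and> norm x < b}"
proof -
  let ?P = "{a<..<b} \<times> {x. e \<bullet> x > 0}"
  let ?f = "\<lambda>(t, x). (t / norm x) *\<^sub>R x"
  have "connected ?P"
    by (intro connected_Times convex_connected convex_halfspace_gt convex_real_interval)
  moreover have "continuous_on ?P ?f"
    unfolding case_prod_beta by (intro continuous_intros) auto
  ultimately have "connected (?f ` ?P)" by (intro connected_continuous_image)
  moreover have "?f ` ?P = {x. x \<bullet> e > 0 \<and> a < norm x \<and> norm x < b}"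
  proof (intro equalityI subsetI)
    fix z assume "z \<in> ?f ` ?P"
    then obtain t x where tx: "a < t" "t < b" "e \<bullet> x > 0" "z = (t / norm x) *\<^sub>R x" by auto
    then have "x \<noteq> 0" "t > 0" using assms by auto
    then show "z \<in> {x. x \<bullet> e > 0 \<and> a < norm x \<and> norm x < b}"
      using tx by (simp add: inner_commute)
  next
    fix z assume z: "z \<in> {x. x \<bullet> e > 0 \<and> a < norm x \<and> norm x < b}"
    then have "z \<noteq> 0" by auto
    then have "z = ?f (norm z, z)" by simp
    moreover have "(norm z, z) \<in> ?P" using z by (simp add: inner_commute)
    ultimately show "z \<in> ?f ` ?P" by blast
  qed
  ultimately show ?thesis by simp
qed

lemma radial_domain:
  fixes \<Omega> :: "'a::euclidean_space set"
  assumes "ball_centered_at_origin \<Omega> \<or> annulus_centered_at_origin \<Omega>"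
  shows "open \<Omega>" "bounded \<Omega>" "\<And>x y. norm x = norm y \<Longrightarrow> x \<in> \<Omega> \<Longrightarrow> y \<in> \<Omega>"
    "\<And>e. connected (\<Omega> \<inter> {x. x \<bullet> e > 0})"
proof -
  consider R where "\<Omega> = ball 0 R" | a b where "0 < a" "\<Omega> = {x. a < norm x \<and> norm x < b}"
    using assms by (auto simp: ball_centered_at_origin_def annulus_centered_at_origin_def)
  note c = this
  show "open \<Omega>"
    using c by cases (auto intro!: open_Collect_conj open_Collect_less continuous_intros)
  show "bounded \<Omega>"
    using c by cases (auto intro!: bounded_subset[OF bounded_ball, of _ 0])
  show "y \<in> \<Omega>" if "norm x = norm y" "x \<in> \<Omega>" for x y
    using c by cases (use that in auto)
  show "connected (\<Omega> \<inter> {x. x \<bullet> e > 0})" for e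
    using c
  proof cases
    case (1 R)
    have "\<Omega> \<inter> {x. x \<bullet> e > 0} = {x. x \<bullet> e > 0 \<and> 0 < norm x \<and> norm x < R}" using 1 by auto
    then show ?thesis using connected_half_shell[of 0 e R] by simp
  next
    case (2 a b)
    have "\<Omega> \<inter> {x. x \<bullet> e > 0} = {x. x \<bullet> e > 0 \<and> a < norm x \<and> norm x < b}" using 2 by auto
    then show ?thesis using connected_half_shell[of a e b] 2 by simp
  qed
qed

text \<open>
  Otherwise \<open>v\<close> is positive on the half of \<open>\<Omega>\<close> by the strong maximum principle, and Hopf's lemma applies to a
  small ball in that half which touches the hyperplane at \<open>P\<close>. Since the inequality for the
  Laplacian is two-sided, the lemma applies to \<open>v\<close> and to \<open>- v\<close>.
\<close>

lemma antisymmetric_sign_change: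
  fixes \<Omega> :: "'a::euclidean_space set"
  assumes \<Omega>: "open \<Omega>" "connected (\<Omega> \<inter> {x. x \<bullet> e > 0})" and P: "P \<in> \<Omega>" "P \<bullet> e = 0" and e: "e \<noteq> 0"
    and v: "C2_on \<Omega> v G H" and lap: "\<And>x. x \<in> \<Omega> \<Longrightarrow> \<bar>trace_of H x\<bar> \<le> L * \<bar>v x\<bar>" and L: "L \<ge> 0"
    and crit: "(v has_derivative (\<lambda>_. 0)) (at P)" "v P = 0"
    and nz: "\<exists>x\<in>\<Omega> \<inter> {x. x \<bullet> e > 0}. v x \<noteq> 0"
  shows "\<exists>x\<in>\<Omega> \<inter> {x. x \<bullet> e > 0}. v x < 0"
proof (rule ccontr)
  let ?D = "\<Omega> \<inter> {x. x \<bullet> e > 0}"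
  assume "\<not> (\<exists>x\<in>?D. v x < 0)"
  then have nn: "\<And>x. x \<in> ?D \<Longrightarrow> v x \<ge> 0" by (meson linorder_not_less)
  have oD: "open ?D" using \<Omega>(1) by (intro open_Int open_Collect_less continuous_intros)
  have sup: "trace_of H x \<le> L * v x" if "x \<in> ?D" for x
    using lap[of x] nn[OF that] that by auto
  have pos: "v x > 0" if "x \<in> ?D" for x
    by (rule strong_maximum_principle[OF oD \<Omega>(2) C2_on_subset[OF v] nn sup L nz that]) auto
  obtain \<rho> where \<rho>: "\<rho> > 0" "cball P \<rho> \<subseteq> \<Omega>" using \<Omega>(1) P open_contains_cball by blast
  define R where "R = \<rho> / 2"
  define c where "c = P + (R / norm e) *\<^sub>R e"
  have R: "R > 0" using \<rho> by (simp add: R_def)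
  have dcP: "dist c P = R" using R e by (simp add: c_def dist_norm)
  have cb: "cball c R \<subseteq> \<Omega>"
  proof
    fix x assume "x \<in> cball c R"
    then have "dist P x \<le> \<rho>" using dist_triangle[of P x c] dcP by (simp add: R_def dist_commute)
    then show "x \<in> \<Omega>" using \<rho> by auto
  qed
  have ce: "c \<bullet> e = R * norm e" using e P(2)
    by (simp add: c_def inner_add_left power2_norm_eq_inner[symmetric] power2_eq_square)
  have bD: "ball c R \<subseteq> ?D"
  proof
    fix x assume x: "x \<in> ball c R"
    have "\<bar>(c - x) \<bullet> e\<bar> \<le> norm (c - x) * norm e" by (rule Cauchy_Schwarz_ineq2)
    also have "\<dots> < R * norm e" using x e by (intro mult_strict_right_mono) (auto simp: dist_norm)
    finally have "x \<bullet> e > 0" using ce by (simp add: inner_diff_left)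
    then show "x \<in> ?D" using x cb by auto
  qed
  show False
    by (rule hopf_boundary_point[OF R dcP C2_on_subset[OF v] continuous_on_subset[OF C2_on_continuous[OF v]] _ crit(2) _ L crit(1)])
      (use cb subsetD[OF bD] pos sup in auto)
qed


section \<open>Superposition operators and primitives\<close>

lemma floor_approx_tendsto:
  fixes t :: real
  shows "(\<lambda>n. real_of_int \<lfloor>real (Suc n) * t\<rfloor> / real (Suc n)) \<longlonglongrightarrow> t"
proof (rule Lim_transform2[where f = "\<lambda>_. t"])
  show "(\<lambda>n. t - real_of_int \<lfloor>real (Suc n) * t\<rfloor> / real (Suc n)) \<longlonglongrightarrow> 0"
  proof (rule Lim_null_comparison[OF always_eventually LIMSEQ_inverse_real_of_nat], rule allI)
    fix n
    let ?a = "real (Suc n)"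
    have "\<bar>?a * t - real_of_int \<lfloor>?a * t\<rfloor>\<bar> \<le> 1" by linarith
    then have "\<bar>?a * t - real_of_int \<lfloor>?a * t\<rfloor>\<bar> / ?a \<le> 1 / ?a" by (intro divide_right_mono) auto
    moreover have "t - real_of_int \<lfloor>?a * t\<rfloor> / ?a = (?a * t - real_of_int \<lfloor>?a * t\<rfloor>) / ?a"
      by (simp add: diff_divide_distrib del: of_nat_Suc)
    ultimately show "norm (t - real_of_int \<lfloor>?a * t\<rfloor> / ?a) \<le> inverse ?a"
      by (simp add: inverse_eq_divide del: of_nat_Suc)
  qed
qed simp

text \<open>
  Rounding \<open>T\<close> to multiples of \<open>1 / (n + 1)\<close> leaves countably many values of the second argument of \<open>f\<close>;
  continuity in that argument gives the limit. The extra map \<open>X\<close> covers product spaces as well.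
\<close>

lemma caratheodory_comp_measurable:
  fixes f :: "'x \<Rightarrow> real \<Rightarrow> real"
  assumes f: "\<And>t. (\<lambda>x. f x t) \<in> borel_measurable M'" and cont: "\<And>x. x \<in> space M' \<Longrightarrow> continuous_on UNIV (f x)"
    and X: "X \<in> measurable N M'" and T: "T \<in> borel_measurable N"
  shows "(\<lambda>w. f (X w) (T w)) \<in> borel_measurable N"
proof (rule borel_measurable_LIMSEQ_real)
  fix w assume "w \<in> space N"
  then have "X w \<in> space M'" using X by (rule measurable_space[rotated])
  then have "isCont (f (X w)) (T w)" using cont by (simp add: continuous_on_eq_continuous_at)
  from isCont_tendsto_compose[OF this floor_approx_tendsto]
  show "(\<lambda>n. f (X w) (real_of_int \<lfloor>real (Suc n) * T w\<rfloor> / real (Suc n))) \<longlonglongrightarrow> f (X w) (T w)" .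
next
  fix n
  show "(\<lambda>w. f (X w) (real_of_int \<lfloor>real (Suc n) * T w\<rfloor> / real (Suc n))) \<in> borel_measurable N"
  proof (rule measurable_compose_countable[where f = "\<lambda>i w. f (X w) (real_of_int i / real (Suc n))"])
    show "(\<lambda>w. f (X w) (real_of_int i / real (Suc n))) \<in> borel_measurable N" for i
      by (rule measurable_compose[OF X f])
    show "(\<lambda>w. \<lfloor>real (Suc n) * T w\<rfloor>) \<in> measurable N (count_space UNIV)"
      using T by measurable
  qed
qed

lemma primitive_eq_integral:
  "primitive f x t = (\<integral>s. (indicator {0<..<t} s - indicator {t<..<0} s) * f x s \<partial>lborel)"
proof (cases "0 \<le> t")
  case True
  then have "primitive f x t = (LINT s:{0<..<t}|lborel. f x s)"
    by (simp add: primitive_def interval_lebesgue_integral_def einterval_eq)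
  then show ?thesis using True by (simp add: set_lebesgue_integral_def)
next
  case False
  then have "primitive f x t = - (LINT s:{t<..<0}|lborel. f x s)"
    by (simp add: primitive_def interval_lebesgue_integral_def einterval_eq)
  then show ?thesis using False by (simp add: set_lebesgue_integral_def)
qed

text \<open>
  The oriented integral is an integral over the whole line with a difference of indicator functions as weight, so that
  Fubini's measurability statement applies.
\<close>

lemma primitive_measurable:
  fixes f :: "'x \<Rightarrow> real \<Rightarrow> real"
  assumes f: "\<And>t. (\<lambda>x. f x t) \<in> borel_measurable N" and cont: "\<And>x. x \<in> space N \<Longrightarrow> continuous_on UNIV (f x)"
    and T[measurable]: "T \<in> borel_measurable N"
  shows "(\<lambda>x. primitive f x (T x)) \<in> borel_measurable N"
proof -
  have 1[measurable]: "(\<lambda>p. f (fst p) (snd p)) \<in> borel_measurable (N \<Otimes>\<^sub>M lborel)"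
    by (rule caratheodory_comp_measurable[OF f cont]) auto
  have 2[measurable]: "(\<lambda>p. indicator {0<..<T (fst p)} (snd p) :: real) \<in> borel_measurable (N \<Otimes>\<^sub>M lborel)"
    unfolding indicator_def greaterThanLessThan_iff by measurable
  have 3[measurable]: "(\<lambda>p. indicator {T (fst p)<..<0} (snd p) :: real) \<in> borel_measurable (N \<Otimes>\<^sub>M lborel)"
    unfolding indicator_def greaterThanLessThan_iff by measurable
  have "(\<lambda>(x, s). (indicator {0<..<T x} s - indicator {T x<..<0} s) * f x s) \<in> borel_measurable (N \<Otimes>\<^sub>M lborel)"
    unfolding case_prod_beta by measurable
  from lborel.borel_measurable_lebesgue_integral[OF this]
  show ?thesis by (simp add: primitive_eq_integral)
qed

lemma primitive_deriv:
  assumes "continuous_on UNIV (f x)"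
  shows "(primitive f x has_real_derivative f x t) (at t)"
proof -
  let ?a = "- \<bar>t\<bar> - 1" and ?b = "\<bar>t\<bar> + 1"
  have "((\<lambda>u. LBINT y=ereal 0..ereal u. f x y) has_vector_derivative f x t) (at t within {?a..?b})"
    by (rule interval_integral_FTC2) (use assms continuous_on_subset in auto)
  moreover have "at t within {?a..?b} = at t" by (rule at_within_Icc_at) auto
  moreover have "(\<lambda>u. LBINT y=ereal 0..ereal u. f x y) = primitive f x" by (rule ext) (simp add: primitive_def)
  ultimately show ?thesis by (simp add: has_real_derivative_iff_has_vector_derivative)
qed

lemma primitive_zero: "primitive f x 0 = 0" by (simp add: primitive_eq_integral)

lemma primitive_diff_bound:
  assumes c: "continuous_on UNIV (f x)" and B: "\<And>s. \<bar>s\<bar> \<le> A \<Longrightarrow> \<bar>f x s\<bar> \<le> B" and t: "\<bar>t\<bar> \<le> A"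
  shows "\<bar>primitive f x t\<bar> \<le> B * A"
proof -
  have "norm (primitive f x t - primitive f x 0) \<le> B * norm (t - 0)"
  proof (rule field_differentiable_bound[where S = "{-A..A}"])
    show "(primitive f x has_field_derivative f x z) (at z within {-A..A})" for z
      using primitive_deriv[where f = f and x = x, OF c] has_field_derivative_at_within by blast
    show "norm (f x z) \<le> B" if "z \<in> {-A..A}" for z using B[of z] that by auto
  qed (use t in auto)
  also have "\<dots> \<le> B * A"
  proof (rule mult_left_mono)
    have "A \<ge> 0" using t by linarith
    then have "\<bar>f x 0\<bar> \<le> B" using B[of 0] by simp
    then show "0 \<le> B" by linarith
  qed (use t in simp)
  finally show ?thesis by (simp add: primitive_zero)
qed

text \<open>
  Convexity compares \<open>g\<close> with its secant \<open>l\<close> through \<open>(b, g b)\<close> and \<open>(a, g a)\<close>: \<open>g\<close> lies above \<open>l\<close> beyond \<open>a\<close>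
  and below it on \<open>[b, a]\<close>. Integrating this from \<open>a\<close> to \<open>a + c (a - b)\<close>, and the sign of the orientation, give
  the same inequality for both signs of \<open>c\<close>. The integral of the secant is the left-hand side. All points used are at least \<open>b\<close>,
  so the half-line is as good as the line.
\<close>

lemma convex_primitive_gap:
  fixes F g :: "real \<Rightarrow> real"
  assumes F: "\<And>t. (F has_real_derivative g t) (at t)" and I: "I = UNIV \<or> I = {0..}"
    and conv: "convex_on I g" and ab: "a \<in> I" "b \<in> I" "b < a" and c: "\<bar>c\<bar> \<le> 1"
  shows "g a * (c * (a - b)) + 1 / 2 * c\<^sup>2 * ((g a - g b) * (a - b)) \<le> F (a + c * (a - b)) - F a"
    and "strictly_convex_on I g \<Longrightarrow> c \<noteq> 0 \<Longrightarrow>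
      g a * (c * (a - b)) + 1 / 2 * c\<^sup>2 * ((g a - g b) * (a - b)) < F (a + c * (a - b)) - F a"
proof -
  define v where "v = a - b"
  have v: "v > 0" using ab by (simp add: v_def)
  define \<psi> where "\<psi> s = F (a + s * v) - F a - g a * (s * v) - 1 / 2 * s\<^sup>2 * ((g a - g b) * v)" for s
  define \<psi>' where "\<psi>' s = v * (g (a + s * v) - g a - s * (g a - g b))" for s
  have d: "(\<psi> has_real_derivative \<psi>' s) (at s)" for s
    unfolding \<psi>_def \<psi>'_def
    by (auto intro!: derivative_eq_intros DERIV_chain2[OF F] simp: field_simps)
  have inI: "a + s * v \<in> I" if "s > 0" for s
    using I ab(1) v that by auto
  have nn: "s / (1 + s) * A + 1 / (1 + s) * A' = (s * A + A') / (1 + s)" if "s > 0" for s A A' :: real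
    by (simp add: add_divide_distrib)
  have r: "(s / (1 + s)) * b + (1 / (1 + s)) * (a + s * v) = a" "s / (1 + s) + 1 / (1 + s) = 1" if "s > 0" for s
  proof -
    have "s * b + (a + s * v) = (1 + s) * a" by (simp add: v_def algebra_simps)
    then show "(s / (1 + s)) * b + (1 / (1 + s)) * (a + s * v) = a" using nn[OF that] that by simp
    show "s / (1 + s) + 1 / (1 + s) = 1" using that by (simp add: field_simps)
  qed
  have l: "(1 + s) * a + (- s) * b = a + s * v" for s by (simp add: v_def algebra_simps)
  have z: "\<psi> 0 = 0" by (simp add: \<psi>_def)
  have mvt: "\<exists>s. 0 < s \<and> \<psi> c = c * \<psi>' s" if "c > 0"
    using MVT2[of 0 c \<psi> \<psi>'] d z that by auto
  have mvt': "\<exists>s. - 1 < s \<and> s < 0 \<and> \<psi> c = c * \<psi>' s" if c0: "c < 0"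
  proof -
    obtain s where "c < s" "s < 0" "\<psi> 0 - \<psi> c = (0 - c) * \<psi>' s" using MVT2[OF c0 d] by blast
    then show ?thesis using c z by (intro exI[of _ s]) auto
  qed
  have pos: "\<psi>' s \<ge> 0" if "0 < s" for s
  proof -
    have "g ((s / (1 + s)) *\<^sub>R b + (1 / (1 + s)) *\<^sub>R (a + s * v)) \<le> s / (1 + s) * g b + 1 / (1 + s) * g (a + s * v)"
      by (rule conv[unfolded convex_on_def, THEN conjunct2, rule_format]) (use that ab inI r in auto)
    then have "g a \<le> (s * g b + g (a + s * v)) / (1 + s)" using r(1)[OF that] nn[OF that] by simp
    then have "0 \<le> g (a + s * v) - g a - s * (g a - g b)" using that by (simp add: field_simps)
    then show ?thesis using v by (simp add: \<psi>'_def)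
  qed
  have neg: "\<psi>' s \<le> 0" if "- 1 < s" "s < 0" for s
  proof -
    have "g ((1 + s) *\<^sub>R a + (- s) *\<^sub>R b) \<le> (1 + s) * g a + (- s) * g b"
      by (rule conv[unfolded convex_on_def, THEN conjunct2, rule_format]) (use that ab in auto)
    then have "g (a + s * v) \<le> (1 + s) * g a + (- s) * g b" using l by simp
    then have "g (a + s * v) - g a - s * (g a - g b) \<le> 0" by (simp add: algebra_simps)
    then show ?thesis using v by (simp add: \<psi>'_def mult_nonneg_nonpos)
  qed
  have "\<psi> c \<ge> 0"
    using mvt mvt' pos neg z by (cases c "0 :: real" rule: linorder_cases) (auto simp: mult_nonpos_nonpos)
  then show "g a * (c * (a - b)) + 1 / 2 * c\<^sup>2 * ((g a - g b) * (a - b)) \<le> F (a + c * (a - b)) - F a"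
    by (simp add: \<psi>_def v_def)
  assume sc: "strictly_convex_on I g" and c0: "c \<noteq> 0"
  note sc' = sc[unfolded strictly_convex_on_def, THEN conjunct2, rule_format]
  have pos': "\<psi>' s > 0" if "0 < s" for s
  proof -
    have "b \<noteq> a + s * v" using ab(3) v that by (smt (verit) mult_pos_pos)
    then have "g ((s / (1 + s)) * b + (1 / (1 + s)) * (a + s * v)) < s / (1 + s) * g b + 1 / (1 + s) * g (a + s * v)"
      using that ab(2) inI[OF that] r(2)[OF that] by (intro sc') auto
    then have "g a < (s * g b + g (a + s * v)) / (1 + s)" using r(1)[OF that] nn[OF that] by simp
    then have "0 < g (a + s * v) - g a - s * (g a - g b)" using that by (simp add: field_simps)
    then show ?thesis using v by (simp add: \<psi>'_def)
  qed
  have neg': "\<psi>' s < 0" if "- 1 < s" "s < 0" for s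
  proof -
    have "g ((1 + s) * a + (- s) * b) < (1 + s) * g a + (- s) * g b"
      using that ab by (intro sc') auto
    then have "g (a + s * v) < (1 + s) * g a + (- s) * g b" using l by simp
    then have "g (a + s * v) - g a - s * (g a - g b) < 0" by (simp add: algebra_simps)
    then show ?thesis using v by (simp add: \<psi>'_def mult_pos_neg)
  qed
  have "\<psi> c > 0"
    using mvt mvt' pos' neg' c0 by (cases c "0 :: real" rule: linorder_cases) (auto simp: mult_neg_neg)
  then show "g a * (c * (a - b)) + 1 / 2 * c\<^sup>2 * ((g a - g b) * (a - b)) < F (a + c * (a - b)) - F a"
    by (simp add: \<psi>_def v_def)
qed

section \<open>Local maximality on spans of disjointly supported functions\<close>

lemma sum_single:
  fixes h :: "nat \<Rightarrow> 'b::comm_monoid_add"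
  assumes "k < d" "\<And>i. i < d \<Longrightarrow> i \<noteq> k \<Longrightarrow> h i = 0"
  shows "(\<Sum>i<d. h i) = h k"
  using assms by (subst sum.remove[of _ k]) (auto intro!: sum.neutral)

context bounded_domain begin

lemma AE_open_witness:
  assumes "AE x in M. Q x" "open U" "U \<subseteq> \<Omega>" "U \<noteq> {}"
  shows "\<exists>x\<in>U. Q x"
proof (rule ccontr)
  assume no: "\<not> (\<exists>x\<in>U. Q x)"
  have "AE x in lebesgue. x \<in> \<Omega> \<longrightarrow> Q x" using assms(1) by (simp add: AE_restrict_space_iff)
  then have "AE x in lebesgue. x \<notin> U"
    by eventually_elim (use no assms(3) in auto)
  then have "U \<in> null_sets lebesgue" using assms(2) by (simp add: AE_iff_null_sets borel_open)
  then show False using open_not_negligible[OF assms(2,4)] by (simp add: negligible_iff_null_sets)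
qed

text \<open>
  The exceptional null set is removed by setting \<open>f\<close> to zero on it.
\<close>

lemma caratheodory_measurable_M:
  assumes f: "caratheodory_on \<Omega> f" and T: "T \<in> borel_measurable M"
  shows "(\<lambda>x. primitive f x (T x)) \<in> borel_measurable M"
proof -
  have "AE x in M. continuous_on UNIV (f x)" using f by (simp add: caratheodory_on_def)
  then obtain N where N: "N \<in> null_sets M" "{x \<in> space M. \<not> continuous_on UNIV (f x)} \<subseteq> N"
    by (auto simp: eventually_ae_filter)
  define f' where "f' x t = (if x \<in> N then 0 else f x t)" for x t
  have "(\<lambda>x. primitive f' x (T x)) \<in> borel_measurable M"
  proof (rule primitive_measurable[OF _ _ T])
    show "(\<lambda>x. f' x t) \<in> borel_measurable M" for t
      unfolding f'_def by (rule measurable_If_set) (use f N in \<open>auto simp: caratheodory_on_def\<close>)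
    show "continuous_on UNIV (f' x)" if "x \<in> space M" for x
    proof (cases "x \<in> N")
      case True
      then have "f' x = (\<lambda>_. 0)" by (auto simp: f'_def)
      then show ?thesis by simp
    next
      case False
      then have "f' x = f x" by (auto simp: f'_def)
      then show ?thesis using False N(2) that by auto
    qed
  qed
  moreover have "AE x in M. primitive f' x (T x) = primitive f x (T x)"
    using AE_not_in[OF N(1)]
  proof eventually_elim
    case (elim x)
    then have "f' x = f x" by (auto simp: f'_def)
    then show ?case by (simp add: primitive_def)
  qed
  ultimately show ?thesis by (rule measurable_cong_AE_M)
qed

lemma energy_eq:
  assumes f: "caratheodory_on \<Omega> f" and w: "has_weak_gradient \<Omega> w g" and ae: "AE x in M. w x = w' x"
  shows "energy \<Omega> f w = (\<integral>x. 1 / 2 * (norm (g x))\<^sup>2 - primitive f x (w' x) \<partial>M)"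
proof -
  note wg = weak_gradient_AE[OF w]
  have m: "w \<in> borel_measurable M" using w by (auto simp: has_weak_gradient_def L2_def)
  note m' = measurable_cong_AE_M[OF m ae]
  note [measurable] = caratheodory_measurable_M[OF f m] caratheodory_measurable_M[OF f m']
  have [measurable]: "g \<in> borel_measurable M" "weak_gradient \<Omega> w \<in> borel_measurable M"
    using w wg(1) by (auto simp: has_weak_gradient_def L2_def)
  have "AE x in M. 1 / 2 * (norm (weak_gradient \<Omega> w x))\<^sup>2 - primitive f x (w x) = 1 / 2 * (norm (g x))\<^sup>2 - primitive f x (w' x)"
    using wg(2) ae by eventually_elim simp
  then show ?thesis unfolding energy_def by (intro integral_cong_AE) measurable
qed

lemma has_weak_gradient_zero: "has_weak_gradient \<Omega> (\<lambda>x. 0) (\<lambda>x. 0)"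
  by (simp add: has_weak_gradient_def L2_def)

lemma zero_H10: "(\<lambda>x. 0) \<in> H10 \<Omega>"
proof -
  have "(\<lambda>x::'a. 0::real) \<in> test_functions \<Omega>"
  proof -
    have "smooth (\<lambda>x::'a. 0::real)"
      by (rule smooth_coinduct[where Q = "\<lambda>w. w = (\<lambda>x. 0)"]) (auto simp: partial_deriv_def frechet_derivative_const)
    then show ?thesis by (auto simp: test_functions_def smooth_def)
  qed
  moreover have "grad (\<lambda>x::'a. 0::real) x = 0" for x by (rule grad_eqI) simp
  ultimately show ?thesis unfolding H10_iff[OF has_weak_gradient_zero] by (auto intro!: bexI[of _ "\<lambda>x. 0"])
qed

lemma H10_sum:
  fixes z :: "nat \<Rightarrow> 'a \<Rightarrow> real"
  assumes "\<And>i. i < d \<Longrightarrow> z i \<in> H10 \<Omega>" "\<And>i. i < d \<Longrightarrow> has_weak_gradient \<Omega> (z i) (g i)"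
  shows "(\<lambda>x. \<Sum>i<d. c i * z i x) \<in> H10 \<Omega> \<and> has_weak_gradient \<Omega> (\<lambda>x. \<Sum>i<d. c i * z i x) (\<lambda>x. \<Sum>i<d. c i *\<^sub>R g i x)"
  using assms
proof (induction d)
  case 0
  then show ?case using zero_H10 has_weak_gradient_zero by simp
next
  case (Suc d)
  then have IH: "(\<lambda>x. \<Sum>i<d. c i * z i x) \<in> H10 \<Omega>" "has_weak_gradient \<Omega> (\<lambda>x. \<Sum>i<d. c i * z i x) (\<lambda>x. \<Sum>i<d. c i *\<^sub>R g i x)"
    by auto
  show ?case
    using H10_lincomb[OF IH(1) Suc.prems(1)[of d], of 1 "c d"] has_weak_gradient_lincomb[OF IH(2) Suc.prems(2)[of d], of 1 "c d"]
    by simp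
qed

text \<open>
  At each point at most one of the functions \<open>z i\<close> and their gradients is nonzero, so the energy increment along
  \<open>\<Sum>i<d. c i * z i\<close> splits into a sum over \<open>i\<close>. The hypotheses \<open>weak\<close> rewrite the quadratic and mixed
  gradient terms as integrals against \<open>p\<close> and \<open>q\<close>, after which each summand has a nonpositive integrand
  by \<open>gap\<close>.
\<close>

lemma disjoint_bumps_local_maximizer:
  fixes z :: "nat \<Rightarrow> 'a \<Rightarrow> real" and g :: "nat \<Rightarrow> 'a \<Rightarrow> 'a"
  assumes f: "caratheodory_on \<Omega> f"
    and u: "u \<in> H10 \<Omega>" "has_weak_gradient \<Omega> u G"
    and z: "\<And>i. i < d \<Longrightarrow> z i \<in> H10 \<Omega>" "\<And>i. i < d \<Longrightarrow> has_weak_gradient \<Omega> (z i) (g i)"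
      "\<And>i. i < d \<Longrightarrow> \<not> (AE x in M. z i x = 0)"
    and disj: "\<And>x. x \<in> \<Omega> \<Longrightarrow> \<exists>k<d. \<forall>i<d. i \<noteq> k \<longrightarrow> z i x = 0 \<and> g i x = 0"
    and bounds: "\<And>x. x \<in> \<Omega> \<Longrightarrow> \<bar>u x\<bar> \<le> A" "\<And>i x. i < d \<Longrightarrow> x \<in> \<Omega> \<Longrightarrow> \<bar>z i x\<bar> \<le> A'"
      "AE x in M. \<forall>s. \<bar>s\<bar> \<le> A + A' \<longrightarrow> \<bar>f x s\<bar> \<le> B"
    and weak: "\<And>i. i < d \<Longrightarrow> (\<integral>x. g i x \<bullet> G x \<partial>M) = (\<integral>x. q x * z i x \<partial>M)"
      "\<And>i. i < d \<Longrightarrow> (\<integral>x. (norm (g i x))\<^sup>2 \<partial>M) = (\<integral>x. p x * z i x \<partial>M)"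
    and qp: "q \<in> L2 \<Omega>" "p \<in> L2 \<Omega>"
    and gap: "\<And>i. i < d \<Longrightarrow> AE x in M. \<forall>c. \<bar>c\<bar> \<le> 1 \<longrightarrow>
        q x * (c * z i x) + 1 / 2 * c\<^sup>2 * (p x * z i x) \<le> primitive f x (u x + c * z i x) - primitive f x (u x)"
    and V: "V = {v. \<exists>c :: nat \<Rightarrow> real. AE x in M. v x = (\<Sum>i<d. c i * z i x)}"
  shows "local_maximizer_on \<Omega> (energy \<Omega> f) (translate_by u V) u"
    and "(\<And>i. i < d \<Longrightarrow> AE x in M. \<forall>c. z i x \<noteq> 0 \<longrightarrow> c \<noteq> 0 \<longrightarrow> \<bar>c\<bar> \<le> 1 \<longrightarrow>
        q x * (c * z i x) + 1 / 2 * c\<^sup>2 * (p x * z i x) < primitive f x (u x + c * z i x) - primitive f x (u x))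
      \<Longrightarrow> strict_local_maximizer_on \<Omega> (energy \<Omega> f) (translate_by u V) u"
proof -
  have zL2: "z i \<in> L2 \<Omega>" "g i \<in> L2 \<Omega>" if "i < d" for i
    using z(2)[OF that] by (auto simp: has_weak_gradient_def)
  have uL2: "u \<in> L2 \<Omega>" "G \<in> L2 \<Omega>" using u(2) by (auto simp: has_weak_gradient_def)
  have sumz: "(\<lambda>x. \<Sum>i<d. c i * z i x) \<in> H10 \<Omega> \<and>
      has_weak_gradient \<Omega> (\<lambda>x. \<Sum>i<d. c i * z i x) (\<lambda>x. \<Sum>i<d. c i *\<^sub>R g i x)" for c
    by (rule H10_sum) (use z in auto)
  define W where "W c x = u x + (\<Sum>i<d. c i * z i x)" for c x
  define GW where "GW c x = G x + (\<Sum>i<d. c i *\<^sub>R g i x)" for c x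
  have W: "W c \<in> H10 \<Omega>" "has_weak_gradient \<Omega> (W c) (GW c)" for c
    using H10_lincomb[OF u(1) sumz[of c, THEN conjunct1], where a = 1 and b = 1]
      has_weak_gradient_lincomb[OF u(2) sumz[of c, THEN conjunct2], where a = 1 and b = 1]
    by (simp_all add: W_def[abs_def] GW_def[abs_def])
  define E where "E c = energy \<Omega> f (W c)" for c
  have repr: "\<exists>c. (AE x in M. w x = W c x)" if "w \<in> translate_by u V" for w
  proof -
    obtain v c where "w = (\<lambda>x. u x + v x)" "AE x in M. v x = (\<Sum>i<d. c i * z i x)"
      using \<open>w \<in> translate_by u V\<close> by (auto simp: translate_by_def V)
    then have "AE x in M. w x = W c x" by (auto simp: W_def elim: eventually_mono)
    then show ?thesis by blast
  qed
  have sub: "translate_by u V \<subseteq> H10 \<Omega>"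
  proof
    fix w assume "w \<in> translate_by u V"
    then obtain c where "AE x in M. w x = W c x" using repr by blast
    then have "AE x in M. W c x = w x" by (auto elim: eventually_mono)
    then show "w \<in> H10 \<Omega>" by (rule H10_cong_AE[OF W(1)])
  qed
  have "(\<lambda>x. 0) \<in> V" unfolding V by (rule CollectI, rule exI[of _ "\<lambda>_. 0"]) simp
  then have uin: "u \<in> translate_by u V" unfolding translate_by_def by force
  have energy_cong: "energy \<Omega> f w = E c" if "AE x in M. w x = W c x" for w c
  proof -
    have ae: "AE x in M. W c x = w x" using that by (auto elim: eventually_mono)
    have "energy \<Omega> f w = (\<integral>x. 1 / 2 * (norm (GW c x))\<^sup>2 - primitive f x (W c x) \<partial>M)"
      by (rule energy_eq[OF f has_weak_gradient_cong_AE[OF W(2) ae] that])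
    then show ?thesis unfolding E_def by (subst energy_eq[OF f W(2), where w' = "W c"]) auto
  qed
  have energy_u: "energy \<Omega> f u = (\<integral>x. 1 / 2 * (norm (G x))\<^sup>2 - primitive f x (u x) \<partial>M)"
    by (rule energy_eq[OF f u(2)]) simp
  \<comment> \<open>The \<open>L\<^sup>2\<close> part of the norm already bounds the coefficients; the number
    \<open>1\<close> is inserted only to make the minimum meaningful for \<open>d = 0\<close>.\<close>
  define a where "a i = (\<integral>x. (z i x)\<^sup>2 \<partial>M)" for i
  have iz2: "integrable M (\<lambda>x. (z i x)\<^sup>2)" if "i < d" for i using L2D(2)[OF zL2(1)[OF that]] by simp
  have a: "a i > 0" if "i < d" for i
  proof -
    have "a i \<noteq> 0" using integral_nonneg_eq_0_iff_AE[OF iz2[OF that]] z(3)[OF that] by (simp add: a_def)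
    then show ?thesis by (simp add: a_def less_le)
  qed
  define \<epsilon> where "\<epsilon> = sqrt (Min (insert 1 (a ` {..<d})))"
  have minpos: "Min (insert 1 (a ` {..<d})) > 0" using a by (subst Min_gr_iff) auto
  then have eps: "\<epsilon> > 0" by (simp add: \<epsilon>_def)
  have small: "\<bar>c i\<bar> \<le> 1" if n: "H1_norm \<Omega> (\<lambda>x. w x - u x) < \<epsilon>" and w: "AE x in M. w x = W c x" and i: "i < d" for w c i
  proof -
    have ae: "AE x in M. (\<Sum>i<d. c i * z i x) = w x - u x" using w by (auto simp: W_def elim: eventually_mono)
    have wg: "has_weak_gradient \<Omega> (\<lambda>x. w x - u x) (\<lambda>x. \<Sum>i<d. c i *\<^sub>R g i x)"
      by (rule has_weak_gradient_cong_AE[OF sumz[of c, THEN conjunct2] ae])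
    have "sqrt (\<integral>x. (w x - u x)\<^sup>2 + (norm (\<Sum>i<d. c i *\<^sub>R g i x))\<^sup>2 \<partial>M) < \<epsilon>"
      using n H1_norm_eq[OF wg] by simp
    then have 1: "(\<integral>x. (w x - u x)\<^sup>2 + (norm (\<Sum>i<d. c i *\<^sub>R g i x))\<^sup>2 \<partial>M) < Min (insert 1 (a ` {..<d}))"
      by (simp add: \<epsilon>_def)
    have "(c i)\<^sup>2 * a i = (\<integral>x. (c i)\<^sup>2 * (z i x)\<^sup>2 \<partial>M)" by (simp add: a_def)
    also have "\<dots> \<le> (\<integral>x. (w x - u x)\<^sup>2 + (norm (\<Sum>i<d. c i *\<^sub>R g i x))\<^sup>2 \<partial>M)"
    proof (rule integral_mono_AE)
      show "integrable M (\<lambda>x. (c i)\<^sup>2 * (z i x)\<^sup>2)" using iz2[OF i] by simp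
      show "integrable M (\<lambda>x. (w x - u x)\<^sup>2 + (norm (\<Sum>i<d. c i *\<^sub>R g i x))\<^sup>2)"
        by (rule has_weak_gradient_energy_integrable[OF wg])
      show "AE x in M. (c i)\<^sup>2 * (z i x)\<^sup>2 \<le> (w x - u x)\<^sup>2 + (norm (\<Sum>i<d. c i *\<^sub>R g i x))\<^sup>2"
        using ae AE_space
      proof eventually_elim
        case (elim x)
        then obtain k where k: "k < d" "\<And>i. i < d \<Longrightarrow> i \<noteq> k \<Longrightarrow> z i x = 0" using disj[of x] by auto
        have "(\<Sum>i<d. c i * z i x) = c k * z k x" using k by (intro sum_single) auto
        then have "(c i)\<^sup>2 * (z i x)\<^sup>2 \<le> (w x - u x)\<^sup>2"
          using elim(1) k(2)[OF i] by (cases "i = k") (auto simp: power_mult_distrib[symmetric])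
        then show ?case by (simp add: add_increasing2)
      qed
    qed
    also have "\<dots> < Min (insert 1 (a ` {..<d}))" by (rule 1)
    also have "\<dots> \<le> a i" using i by (intro Min_le) auto
    finally have "(c i)\<^sup>2 < 1" using a[OF i] by simp
    then show ?thesis by (simp add: abs_square_less_1 less_imp_le)
  qed
  \<comment> \<open>\<open>\<Theta> c i\<close> is the integrand of the energy increment in the direction \<open>c
    z\<^sub>i\<close>.\<close>
  define \<Delta> where "\<Delta> c i x = primitive f x (u x + c * z i x) - primitive f x (u x)" for c i x
  define \<Theta> where "\<Theta> c i x = q x * (c * z i x) + 1 / 2 * c\<^sup>2 * (p x * z i x) - \<Delta> c i x" for c i x
  have cont_ae: "AE x in M. continuous_on UNIV (f x)" using f by (simp add: caratheodory_on_def)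
  have iF: "integrable M (\<lambda>x. primitive f x (T x))" if T: "T \<in> borel_measurable M" "\<And>x. x \<in> \<Omega> \<Longrightarrow> \<bar>T x\<bar> \<le> A + A'" for T
  proof (rule Bochner_Integration.integrable_bound[of M "\<lambda>_. B * (A + A')"])
    show "AE x in M. norm (primitive f x (T x)) \<le> norm (B * (A + A'))"
      using cont_ae bounds(3) AE_space
    proof eventually_elim
      case (elim x)
      then have "\<bar>primitive f x (T x)\<bar> \<le> B * (A + A')" using T(2)[of x] by (intro primitive_diff_bound) auto
      then show ?case by simp
    qed
  qed (auto intro: caratheodory_measurable_M[OF f T(1)])
  have A'nn: "A' \<ge> 0" if "x \<in> \<Omega>" "i < d" for x i using bounds(2)[OF that(2,1)] by linarith
  have iF1: "integrable M (\<lambda>x. primitive f x (u x + c * z i x))" if "i < d" "\<bar>c\<bar> \<le> 1" for c i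
  proof (rule iF)
    show "(\<lambda>x. u x + c * z i x) \<in> borel_measurable M" using L2D(1)[OF uL2(1)] L2D(1)[OF zL2(1)[OF that(1)]] by measurable
    fix x assume x: "x \<in> \<Omega>"
    have "\<bar>c * z i x\<bar> \<le> 1 * A'" unfolding abs_mult using that bounds(2)[OF that(1) x] by (intro mult_mono) auto
    then show "\<bar>u x + c * z i x\<bar> \<le> A + A'" using bounds(1)[OF x] by linarith
  qed
  have iF0: "integrable M (\<lambda>x. primitive f x (u x))" if "i < d" for i
    using iF1[OF that, of 0] by simp
  have i\<Delta>: "integrable M (\<Delta> c i)" if "i < d" "\<bar>c\<bar> \<le> 1" for c i
    unfolding \<Delta>_def using iF1[OF that] iF0[OF that(1)] by simp
  have iq: "integrable M (\<lambda>x. q x * z i x)" "integrable M (\<lambda>x. p x * z i x)" if "i < d" for i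
    using L2_mult_integrable[OF qp(1) zL2(1)[OF that]] L2_mult_integrable[OF qp(2) zL2(1)[OF that]] .
  have i\<Theta>: "integrable M (\<Theta> c i)" if "i < d" "\<bar>c\<bar> \<le> 1" for c i
  proof -
    have "\<Theta> c i = (\<lambda>x. c * (q x * z i x) + 1 / 2 * c\<^sup>2 * (p x * z i x) - \<Delta> c i x)"
      by (rule ext) (simp add: \<Theta>_def)
    then show ?thesis using iq[OF that(1)] i\<Delta>[OF that] by simp
  qed
  have diff: "E c - energy \<Omega> f u = (\<Sum>i<d. \<integral>x. \<Theta> (c i) i x \<partial>M)" if c: "\<And>i. i < d \<Longrightarrow> \<bar>c i\<bar> \<le> 1" and d: "d > 0" for c
  proof -
    have bW: "\<bar>W c x\<bar> \<le> A + A'" if x: "x \<in> \<Omega>" for x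
    proof -
      obtain k where k: "k < d" "\<And>i. i < d \<Longrightarrow> i \<noteq> k \<Longrightarrow> z i x = 0" using disj[OF x] by auto
      have "(\<Sum>i<d. c i * z i x) = c k * z k x" using k by (intro sum_single) auto
      moreover have "\<bar>c k * z k x\<bar> \<le> 1 * A'" unfolding abs_mult using c[OF k(1)] bounds(2)[OF k(1) x] by (intro mult_mono) auto
      ultimately show ?thesis using bounds(1)[OF x] by (simp add: W_def) 
    qed
    have mW: "W c \<in> borel_measurable M" using W(2)[of c] by (auto simp: has_weak_gradient_def L2_def)
    have GWL: "GW c \<in> L2 \<Omega>" using W(2)[of c] by (simp add: has_weak_gradient_def)
    note ints = iF[OF mW bW] L2D(2)[OF GWL] L2D(2)[OF uL2(2)] iF0[OF d]
    have i1: "integrable M (\<lambda>x. g i x \<bullet> G x)" "integrable M (\<lambda>x. (norm (g i x))\<^sup>2)" if "i < d" for i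
      using L2_inner_integrable[OF zL2(2)[OF that] uL2(2)] L2D(2)[OF zL2(2)[OF that]] .
    have "E c - energy \<Omega> f u = (\<integral>x. (1 / 2 * (norm (GW c x))\<^sup>2 - primitive f x (W c x)) - (1 / 2 * (norm (G x))\<^sup>2 - primitive f x (u x)) \<partial>M)"
      unfolding energy_u E_def by (subst energy_eq[OF f W(2), where w' = "W c"]) (use ints in auto)
    also have "\<dots> = (\<integral>x. (\<Sum>i<d. c i * (g i x \<bullet> G x) + 1 / 2 * (c i)\<^sup>2 * (norm (g i x))\<^sup>2
        - \<Delta> (c i) i x) \<partial>M)"
    proof (rule Bochner_Integration.integral_cong[OF refl])
      fix x assume "x \<in> space M"
      then obtain k where k: "k < d" "\<And>i. i < d \<Longrightarrow> i \<noteq> k \<Longrightarrow> z i x = 0 \<and> g i x = 0" using disj[of x] by auto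
      have 1: "(\<Sum>i<d. c i * z i x) = c k * z k x" using k by (intro sum_single) auto
      have 2: "(\<Sum>i<d. c i *\<^sub>R g i x) = c k *\<^sub>R g k x" using k by (intro sum_single) auto
      have 3: "(\<Sum>i<d. c i * (g i x \<bullet> G x) + 1 / 2 * (c i)\<^sup>2 * (norm (g i x))\<^sup>2
        - \<Delta> (c i) i x)
        = c k * (g k x \<bullet> G x) + 1 / 2 * (c k)\<^sup>2 * (norm (g k x))\<^sup>2
        - \<Delta> (c k) k x" using k by (intro sum_single) (auto simp: \<Delta>_def)
      have 4: "(norm (G x + c k *\<^sub>R g k x))\<^sup>2 = (norm (G x))\<^sup>2 + 2 * c k * (g k x \<bullet> G x) + (c k)\<^sup>2 * (norm (g k x))\<^sup>2"
        using dot_norm[of "G x" "c k *\<^sub>R g k x"] by (simp add: inner_commute power_mult_distrib)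
      show "(1 / 2 * (norm (GW c x))\<^sup>2 - primitive f x (W c x)) - (1 / 2 * (norm (G x))\<^sup>2 - primitive f x (u x)) =
        (\<Sum>i<d. c i * (g i x \<bullet> G x) + 1 / 2 * (c i)\<^sup>2 * (norm (g i x))\<^sup>2
        - \<Delta> (c i) i x)"
        unfolding 3 GW_def W_def 1 2 4 by (simp add: \<Delta>_def algebra_simps)
    qed
    also have "\<dots> = (\<Sum>i<d. \<integral>x. c i * (g i x \<bullet> G x) + 1 / 2 * (c i)\<^sup>2 * (norm (g i x))\<^sup>2
        - \<Delta> (c i) i x \<partial>M)"
      by (rule Bochner_Integration.integral_sum) (use i1 i\<Delta> c in auto)
    also have "\<dots> = (\<Sum>i<d. \<integral>x. \<Theta> (c i) i x \<partial>M)"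
    proof (rule sum.cong[OF refl])
      fix i assume "i \<in> {..<d}"
      then have i: "i < d" by simp
      have "(\<integral>x. c i * (g i x \<bullet> G x) + 1 / 2 * (c i)\<^sup>2 * (norm (g i x))\<^sup>2
        - \<Delta> (c i) i x \<partial>M)
        = c i * (\<integral>x. q x * z i x \<partial>M) + 1 / 2 * (c i)\<^sup>2 * (\<integral>x. p x * z i x \<partial>M)
         - (\<integral>x. \<Delta> (c i) i x \<partial>M)"
        using i1[OF i] i\<Delta>[OF i c[OF i]] weak[OF i] by simp
      also have "\<dots> = (\<integral>x. c i * (q x * z i x) + 1 / 2 * (c i)\<^sup>2 * (p x * z i x)
        - \<Delta> (c i) i x \<partial>M)"
        using iq[OF i] i\<Delta>[OF i c[OF i]] by simp
      also have "\<dots> = (\<integral>x. \<Theta> (c i) i x \<partial>M)"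
        by (rule Bochner_Integration.integral_cong) (simp_all add: \<Theta>_def)
      finally show "(\<integral>x. c i * (g i x \<bullet> G x) + 1 / 2 * (c i)\<^sup>2 * (norm (g i x))\<^sup>2
        - \<Delta> (c i) i x \<partial>M) = (\<integral>x. \<Theta> (c i) i x \<partial>M)" .
    qed
    finally show ?thesis .
  qed
  have \<Theta>le: "AE x in M. \<Theta> c i x \<le> 0" if "i < d" "\<bar>c\<bar> \<le> 1" for c i
    using gap[OF that(1)] by eventually_elim (use that(2) in \<open>simp add: \<Theta>_def \<Delta>_def\<close>)
  have \<Theta>int: "(\<integral>x. \<Theta> c i x \<partial>M) \<le> 0" if "i < d" "\<bar>c\<bar> \<le> 1" for c i
    using integral_mono_AE[OF i\<Theta>[OF that] _ \<Theta>le[OF that]] by simp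
  have E0: "E c = energy \<Omega> f u" if "d = 0" for c
    using that energy_cong[of u c] by (simp add: W_def)
  show "local_maximizer_on \<Omega> (energy \<Omega> f) (translate_by u V) u"
    unfolding local_maximizer_on_def
  proof (intro conjI sub uin exI[of _ \<epsilon>] eps ballI impI)
    fix w assume w: "w \<in> translate_by u V" and n: "H1_norm \<Omega> (\<lambda>x. w x - u x) < \<epsilon>"
    obtain c where c: "AE x in M. w x = W c x" using repr[OF w] by blast
    note le1 = small[OF n c]
    have "E c \<le> energy \<Omega> f u"
    proof (cases "d = 0")
      case False
      have "(\<Sum>i<d. \<integral>x. \<Theta> (c i) i x \<partial>M) \<le> 0" by (intro sum_nonpos) (use \<Theta>int le1 in auto)
      then show ?thesis using diff[of c] le1 False by simp
    qed (use E0 in simp)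
    then show "energy \<Omega> f w \<le> energy \<Omega> f u" using energy_cong[OF c] by simp
  qed
  assume strict: "\<And>i. i < d \<Longrightarrow> AE x in M. \<forall>c. z i x \<noteq> 0 \<longrightarrow> c \<noteq> 0 \<longrightarrow> \<bar>c\<bar> \<le> 1 \<longrightarrow>
        q x * (c * z i x) + 1 / 2 * c\<^sup>2 * (p x * z i x) < primitive f x (u x + c * z i x) - primitive f x (u x)"
  show "strict_local_maximizer_on \<Omega> (energy \<Omega> f) (translate_by u V) u"
    unfolding strict_local_maximizer_on_def
  proof (intro conjI sub uin exI[of _ \<epsilon>] eps ballI impI)
    fix w assume w: "w \<in> translate_by u V" and n: "H1_norm \<Omega> (\<lambda>x. w x - u x) < \<epsilon> \<and> \<not> (AE x in M. w x = u x)"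
    obtain c where c: "AE x in M. w x = W c x" using repr[OF w] by blast
    have le1: "\<And>i. i < d \<Longrightarrow> \<bar>c i\<bar> \<le> 1" using small[OF _ c] n by blast
    have "\<exists>j<d. c j \<noteq> 0"
    proof (rule ccontr)
      assume "\<not> (\<exists>j<d. c j \<noteq> 0)"
      then have "W c = u" by (auto simp: W_def)
      then show False using c n by simp
    qed
    then obtain j where j: "j < d" "c j \<noteq> 0" by blast
    have "(\<integral>x. \<Theta> (c j) j x \<partial>M) \<noteq> 0"
    proof
      assume 0: "(\<integral>x. \<Theta> (c j) j x \<partial>M) = 0"
      have int: "integrable M (\<lambda>x. - \<Theta> (c j) j x)" using i\<Theta>[OF j(1) le1[OF j(1)]] by simp
      have nonneg: "AE x in M. 0 \<le> - \<Theta> (c j) j x" using \<Theta>le[OF j(1) le1[OF j(1)]] by simp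
      have "AE x in M. - \<Theta> (c j) j x = 0"
        using integral_nonneg_eq_0_iff_AE[OF int nonneg] 0 by simp
      then have "AE x in M. z j x = 0" using strict[OF j(1)]
        by eventually_elim (use j(2) le1[OF j(1)] in \<open>force simp: \<Theta>_def \<Delta>_def\<close>)
      then show False using z(3)[OF j(1)] by simp
    qed
    then have jneg: "(\<integral>x. \<Theta> (c j) j x \<partial>M) < 0" using \<Theta>int[OF j(1) le1[OF j(1)]] by simp
    have "(\<Sum>i<d. \<integral>x. \<Theta> (c i) i x \<partial>M) = (\<integral>x. \<Theta> (c j) j x \<partial>M) + (\<Sum>i\<in>{..<d} - {j}. \<integral>x. \<Theta> (c i) i x \<partial>M)"
      using j by (intro sum.remove) auto
    moreover have "(\<Sum>i\<in>{..<d} - {j}. \<integral>x. \<Theta> (c i) i x \<partial>M) \<le> 0"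
      by (intro sum_nonpos) (use \<Theta>int le1 in auto)
    ultimately have "E c - energy \<Omega> f u < 0" using diff[OF le1] j(1) jneg by simp
    then show "energy \<Omega> f w < energy \<Omega> f u" using energy_cong[OF c] by simp
  qed
qed

end


section \<open>The local maximizer\<close>

lemma zero_extension_continuous:
  fixes u :: "'a::euclidean_space \<Rightarrow> real"
  assumes "open \<Omega>" "continuous_on (closure \<Omega>) u" "\<And>x. x \<in> frontier \<Omega> \<Longrightarrow> u x = 0"
  shows "continuous_on UNIV (\<lambda>x. if x \<in> \<Omega> then u x else 0)"
proof -
  have "continuous_on (closure \<Omega> \<union> - \<Omega>) (\<lambda>x. if x \<in> \<Omega> then u x else 0)"
  proof (rule continuous_on_cases[OF _ _ assms(2) continuous_on_const])
    show "\<forall>x. x \<in> closure \<Omega> \<and> x \<notin> \<Omega> \<or> x \<in> - \<Omega> \<and> x \<in> \<Omega> \<longrightarrow> u x = 0"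
      using assms(1,3) by (auto simp: frontier_def interior_open)
  qed (use assms(1) in auto)
  moreover have "closure \<Omega> \<union> - \<Omega> = UNIV" using closure_subset by auto
  ultimately show ?thesis by simp
qed

lemma half_space_positive_part_continuous:
  fixes v :: "'a::euclidean_space \<Rightarrow> real"
  assumes v: "continuous_on UNIV v" and zero: "\<And>x. x \<bullet> e = 0 \<Longrightarrow> v x = 0"
  shows "continuous_on UNIV (\<lambda>x. if x \<bullet> e > 0 then max 0 (v x) else 0)"
proof -
  have c: "continuous_on {x. 0 \<le> x \<bullet> e} (\<lambda>x. max 0 (v x))"
    by (intro continuous_intros continuous_on_subset[OF v]) auto
  have "continuous_on ({x. 0 \<le> x \<bullet> e} \<union> {x. x \<bullet> e \<le> 0}) (\<lambda>x. if x \<bullet> e > 0 then max 0 (v x) else 0)"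
  proof (rule continuous_on_cases[OF _ _ c continuous_on_const])
    show "closed {x. 0 \<le> x \<bullet> e}" "closed {x. x \<bullet> e \<le> 0}"
      by (intro closed_Collect_le continuous_intros)+
    show "\<forall>x. x \<in> {x. 0 \<le> x \<bullet> e} \<and> \<not> 0 < x \<bullet> e \<or> x \<in> {x. x \<bullet> e \<le> 0} \<and> 0 < x \<bullet> e \<longrightarrow> max 0 (v x) = 0"
      using zero by auto
  qed
  moreover have "{x. 0 \<le> x \<bullet> e} \<union> {x. x \<bullet> e \<le> 0} = UNIV" by auto
  ultimately show ?thesis by simp
qed

text \<open>
  A single orthogonal map \<open>T\<close> with \<open>u (T x) \<noteq> u x\<close> and \<open>T P = P\<close> is traded for the reflection that swaps
  \<open>x\<close> and \<open>T x\<close>: it also fixes \<open>P\<close>, as \<open>P \<bullet> T x = T P \<bullet> T x = P \<bullet> x\<close>.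
\<close>

lemma asymmetry_swap:
  fixes P :: "'a::euclidean_space"
  assumes "P \<noteq> 0 \<and> \<not> axially_symmetric_on \<Omega> u P \<or> P = 0 \<and> \<not> radially_symmetric_on \<Omega> u"
    and \<Omega>: "\<And>x y. norm x = norm y \<Longrightarrow> x \<in> \<Omega> \<Longrightarrow> y \<in> \<Omega>"
  shows "\<exists>x\<in>\<Omega>. \<exists>y\<in>\<Omega>. norm x = norm y \<and> u x \<noteq> u y \<and> P \<bullet> (y - x) = 0"
  using assms(1)
proof (elim disjE conjE)
  assume "\<not> axially_symmetric_on \<Omega> u P"
  then obtain T x where T: "orthogonal_transformation T" "T P = P" "x \<in> \<Omega>" "u (T x) \<noteq> u x"
    by (auto simp: axially_symmetric_on_def)
  have n: "norm x = norm (T x)" using T(1) by (simp add: orthogonal_transformation_norm)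
  have "T P \<bullet> T x = P \<bullet> x" using T(1) by (simp add: orthogonal_transformation_def)
  then have "P \<bullet> (T x - x) = 0" using T(2) by (simp add: inner_diff_right)
  with T n \<Omega>[OF n] show ?thesis by metis
next
  assume "P = 0" "\<not> radially_symmetric_on \<Omega> u"
  then show ?thesis by (auto simp: radially_symmetric_on_def)
qed

theorem corollary2p6:
  fixes \<Omega> :: "'a::euclidean_space set"
    and f :: "'a \<Rightarrow> real \<Rightarrow> real"
    and u\<^sub>0 :: "'a \<Rightarrow> real"
    and P :: 'a
    and C r :: real
    and I :: "real set"
  assumes dim: "DIM('a) \<ge> 2"
    and domain: "ball_centered_at_origin \<Omega> \<or> annulus_centered_at_origin \<Omega>"
    and caratheodory: "caratheodory_on \<Omega> f"
    and radial: "\<And>t. radially_symmetric_on \<Omega> (\<lambda>x. f x t)"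
    and exponents: "C > 0" "r > 1" "DIM('a) \<ge> 3 \<Longrightarrow> r < 2 * real DIM('a) / (real DIM('a) - 2)"
    and growth: "AE x in lebesgue_on \<Omega>. \<forall>t. \<bar>f x t\<bar> \<le> C * (\<bar>t\<bar> powr (r - 1) + 1)"
    and lipschitz: "\<And>M. M > 0 \<Longrightarrow> \<exists>C\<^sub>M>0. AE x in lebesgue_on \<Omega>.
          \<forall>s\<in>{-M..M}. \<forall>t\<in>{-M..M}. \<bar>f x s - f x t\<bar> \<le> C\<^sub>M * \<bar>s - t\<bar>"
    and range: "I = UNIV \<or> (\<forall>x\<in>\<Omega>. u\<^sub>0 x \<ge> 0) \<and> I = {0..}"
    and convexity: "AE x in lebesgue_on \<Omega>. convex_on I (f x)"
    and solution: "classical_dirichlet_solution \<Omega> f u\<^sub>0"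
    and nonzero: "\<exists>x\<in>\<Omega>. u\<^sub>0 x \<noteq> 0"
    and critical: "P \<in> \<Omega>" "critical_point u\<^sub>0 P"
    and asymmetry: "P \<noteq> 0 \<and> \<not> axially_symmetric_on \<Omega> u\<^sub>0 P \<or>
                    P = 0 \<and> \<not> radially_symmetric_on \<Omega> u\<^sub>0"
  shows "\<exists>V. H10_subspace_of_dim \<Omega> V 2 \<and> (\<exists>v\<in>V. sign_definite_on \<Omega> v) \<and>
           local_maximizer_on \<Omega> (energy \<Omega> f) (translate_by u\<^sub>0 V) u\<^sub>0 \<and>
           ((AE x in lebesgue_on \<Omega>. strictly_convex_on I (f x)) \<longrightarrow>
              strict_local_maximizer_on \<Omega> (energy \<Omega> f) (translate_by u\<^sub>0 V) u\<^sub>0)"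
proof -
  note rd = radial_domain[OF domain]
  interpret bounded_domain \<Omega> by unfold_locales (fact rd)+
  \<comment> \<open>Only values on the closure of the domain are meaningful; the extension by zero is continuous
    everywhere.\<close>
  define u where "u = (\<lambda>x. if x \<in> \<Omega> then u\<^sub>0 x else 0)"
  have u_in: "u x = u\<^sub>0 x" if "x \<in> \<Omega>" for x using that by (simp add: u_def)
  have u_out: "u x = 0" if "x \<notin> \<Omega>" for x using that by (simp add: u_def)
  have sol: "Ck_on 2 \<Omega> u\<^sub>0" "continuous_on (closure \<Omega>) u\<^sub>0" "\<And>x. x \<in> \<Omega> \<Longrightarrow> - laplacian u\<^sub>0 x = f x (u\<^sub>0 x)"
    "\<And>x. x \<in> frontier \<Omega> \<Longrightarrow> u\<^sub>0 x = 0"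
    using solution by (auto simp: classical_dirichlet_solution_def)
  have u_cont: "continuous_on UNIV u"
    unfolding u_def by (rule zero_extension_continuous[OF rd(1) sol(2,4)])
  define G where "G = grad u\<^sub>0"
  define H where "H = (\<lambda>i. grad (partial_deriv i u\<^sub>0))"
  have u_C2: "C2_on \<Omega> u G H"
    unfolding G_def H_def by (rule C2_on_cong[OF Ck_on_2_C2_on(1)[OF sol(1)] rd(1)]) (simp add: u_in)
  have lap: "trace_of H x = - f x (u x)" if "x \<in> \<Omega>" for x
    using sol(3)[OF that] Ck_on_2_C2_on(2)[OF sol(1)] u_in[OF that] by (simp add: H_def)
  obtain A where A: "A > 0" "\<And>x. \<bar>u x\<bar> \<le> A"
  proof -
    have "u x = 0" if "x \<notin> closure \<Omega>" for x using that u_out closure_subset[of \<Omega>] by auto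
    moreover have "compact (closure \<Omega>)" using rd(2) by (simp add: compact_closure)
    ultimately obtain A where "A > 0" "\<And>x. norm (u x) \<le> A"
      using compact_support_bounded[OF u_cont] by blast
    then show ?thesis using that[of A] by auto
  qed
  \<comment> \<open>The values \<open>u + c z\<^sub>i\<close> with \<open>\<bar>c\<bar> \<le> 1\<close> lie in \<open>[-
    3 A, 3 A]\<close>, as \<open>\<bar>z\<^sub>i\<bar> \<le> 2 A\<close>.\<close>
  define B where "B = C * ((3 * A) powr (r - 1) + 1)"
  have f_bound: "AE x in M. \<forall>s. \<bar>s\<bar> \<le> A + 2 * A \<longrightarrow> \<bar>f x s\<bar> \<le> B"
    using growth
  proof eventually_elim
    case (elim x)
    show ?case
    proof (intro allI impI)
      fix s assume s: "\<bar>s\<bar> \<le> A + 2 * A"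
      have "C * (\<bar>s\<bar> powr (r - 1) + 1) \<le> B"
        unfolding B_def using exponents s by (intro mult_left_mono add_right_mono powr_mono2) auto
      then show "\<bar>f x s\<bar> \<le> B" using elim order_trans by blast
    qed
  qed
  have lap_bound: "\<bar>trace_of H x\<bar> \<le> B" if "x \<in> \<Omega>" for x
  proof -
    have "\<bar>trace_of H x\<bar> - B \<le> 0"
    proof (rule continuous_AE_le_imp_le[OF _ _ that])
      show "continuous_on \<Omega> (\<lambda>x. \<bar>trace_of H x\<bar> - B)"
        by (intro continuous_intros C2_on_continuous_trace[OF u_C2])
      show "AE x in M. \<bar>trace_of H x\<bar> - B \<le> 0"
        using f_bound AE_space
      proof eventually_elim
        case (elim x)
        have "\<bar>u x\<bar> \<le> A + 2 * A" using A(1) A(2)[of x] by linarith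
        then have "\<bar>f x (u x)\<bar> \<le> B" using elim by blast
        then show ?case using elim lap[of x] by simp
      qed
    qed
    then show ?thesis by simp
  qed
  obtain x0 y0 where xy: "x0 \<in> \<Omega>" "y0 \<in> \<Omega>" "norm x0 = norm y0" "u\<^sub>0 x0 \<noteq> u\<^sub>0 y0" "P \<bullet> (y0 - x0) = 0"
    using asymmetry_swap[OF asymmetry] rd(3) by blast
  define e where "e = y0 - x0"
  have e: "e \<noteq> 0" "P \<bullet> e = 0" using xy by (auto simp: e_def)
  let ?s = "reflect e"
  have s_in: "?s x \<in> \<Omega> \<longleftrightarrow> x \<in> \<Omega>" for x using rd(3)[of x "?s x"] rd(3)[of "?s x" x] by (auto simp: reflect_norm)
  have s_vim: "?s -` \<Omega> = \<Omega>" using s_in by auto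
  define v where "v = (\<lambda>x. u x - u (?s x))"
  define v' where "v' = (\<lambda>x. u (?s x) - u x)"
  note refl = C2_on_reflect[OF u_C2, of e, unfolded s_vim]
  define Gs where "Gs = (\<lambda>x. ?s (G (?s x)))"
  define Hs where "Hs = (\<lambda>i x. \<Sum>j\<in>Basis. (?s i \<bullet> j) *\<^sub>R ?s (H j (?s x)))"
  have us_C2: "C2_on \<Omega> (\<lambda>x. u (?s x)) Gs Hs" using refl(1) by (simp add: Gs_def Hs_def)
  have trs: "trace_of Hs x = trace_of H (?s x)" for x using refl(2) by (simp add: Hs_def)
  define Gv where "Gv = (\<lambda>x. G x - Gs x)"
  define Hv where "Hv = (\<lambda>i x. H i x - Hs i x)"
  have v_C2: "C2_on \<Omega> v Gv Hv" and trv: "\<And>x. trace_of Hv x = trace_of H x - trace_of H (?s x)"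
    using C2_on_diff[OF u_C2 us_C2] by (auto simp: v_def Gv_def Hv_def trs)
  have v'_C2: "C2_on \<Omega> v' (\<lambda>x. Gs x - G x) (\<lambda>i x. Hs i x - H i x)"
    and trv': "\<And>x. trace_of (\<lambda>i x. Hs i x - H i x) x = - trace_of Hv x"
    using C2_on_diff[OF us_C2 u_C2] by (auto simp: v'_def trs trv)
  have lapv: "trace_of Hv x = - (f x (u x) - f x (u (?s x)))" if "x \<in> \<Omega>" for x
  proof -
    have "f (?s x) t = f x t" for t
      by (rule radial[of t, unfolded radially_symmetric_on_def, rule_format])
        (simp_all add: that s_in reflect_norm)
    moreover have "trace_of H (?s x) = - f (?s x) (u (?s x))" by (rule lap) (simp add: that s_in)
    ultimately show ?thesis using lap[OF that] trv[of x] by simp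
  qed
  have lapv_bound: "\<bar>trace_of Hv x\<bar> \<le> 2 * B" if "x \<in> \<Omega>" for x
    using lap_bound[OF that] lap_bound[of "?s x"] that s_in[of x] by (simp add: trv)
  obtain L where L: "L > 0" "\<And>x. x \<in> \<Omega> \<Longrightarrow> \<bar>trace_of Hv x\<bar> \<le> L * \<bar>v x\<bar>"
  proof -
    obtain L where L: "L > 0" "AE x in M. \<forall>s\<in>{-A..A}. \<forall>t\<in>{-A..A}. \<bar>f x s - f x t\<bar> \<le> L * \<bar>s - t\<bar>"
      using lipschitz[OF A(1)] by blast
    have "\<bar>trace_of Hv x\<bar> - L * \<bar>v x\<bar> \<le> 0" if "x \<in> \<Omega>" for x
    proof (rule continuous_AE_le_imp_le[OF _ _ that])
      show "continuous_on \<Omega> (\<lambda>x. \<bar>trace_of Hv x\<bar> - L * \<bar>v x\<bar>)"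
        by (intro continuous_intros C2_on_continuous_trace[OF v_C2] C2_on_continuous[OF v_C2])
      show "AE x in M. \<bar>trace_of Hv x\<bar> - L * \<bar>v x\<bar> \<le> 0"
        using L(2) AE_space
      proof eventually_elim
        case (elim x)
        have "u x \<in> {-A..A}" "u (?s x) \<in> {-A..A}" using A(2)[of x] A(2)[of "?s x"] by (auto simp: abs_le_iff)
        then have "\<bar>f x (u x) - f x (u (?s x))\<bar> \<le> L * \<bar>u x - u (?s x)\<bar>" using elim by blast
        moreover have "\<bar>trace_of Hv x\<bar> = \<bar>f x (u x) - f x (u (?s x))\<bar>" using lapv[of x] elim by simp
        ultimately show ?case by (simp add: v_def)
      qed
    qed
    then show ?thesis using that[of L] L(1) by force
  qed
  have v_anti: "v (?s x) = - v x" for x by (simp add: v_def reflect_reflect)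
  have v_plane: "v x = 0" if "x \<bullet> e = 0" for x using that by (simp add: v_def reflect_fixed)
  have v_out: "v x = 0" if "x \<notin> \<Omega>" for x using that s_in[of x] by (simp add: v_def u_out)
  have v_cont: "continuous_on UNIV v"
    unfolding v_def by (intro continuous_intros u_cont continuous_on_compose2[OF u_cont reflect_continuous]) auto
  have vP: "v P = 0" "v' P = 0" using v_plane[OF e(2)] by (auto simp: v_def v'_def)
  have GP: "G P = 0" using critical(2) unfolding critical_point_def G_def by (intro grad_eqI) simp
  have "Gs P = 0" using GP reflect_fixed[OF e(2)] by (simp add: Gs_def) (simp add: reflect_def)
  then have crit: "(v has_derivative (\<lambda>_. 0)) (at P)" "(v' has_derivative (\<lambda>_. 0)) (at P)"
    using C2_onD(1)[OF v_C2 critical(1)] C2_onD(1)[OF v'_C2 critical(1)] GP by (auto simp: Gv_def)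
  have nz: "\<exists>x\<in>\<Omega> \<inter> {x. x \<bullet> e > 0}. v x \<noteq> 0"
  proof -
    have sx: "?s x0 = y0" using reflect_swap[OF xy(3)] by (simp add: e_def)
    then have vx: "v x0 \<noteq> 0" using xy by (simp add: v_def u_in)
    then have "x0 \<bullet> e \<noteq> 0" using v_plane by blast
    then consider "x0 \<bullet> e > 0" | "?s x0 \<bullet> e > 0"
      by (cases "x0 \<bullet> e > 0") (auto simp: reflect_normal)
    then show ?thesis
    proof cases
      case 1
      then show ?thesis using vx xy(1) by blast
    next
      case 2
      moreover have "v (?s x0) \<noteq> 0" using vx v_anti by simp
      ultimately show ?thesis using xy(1) s_in by blast
    qed
  qed
  have L0: "L \<ge> 0" using L(1) by simp
  obtain p where p: "p \<in> \<Omega>" "p \<bullet> e > 0" "v p < 0"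
    using antisymmetric_sign_change[OF rd(1,4) critical(1) e(2,1) v_C2 L(2) L0 crit(1) vP(1) nz] by blast
  have v'v: "v' x = - v x" for x by (simp add: v_def v'_def)
  have nz': "\<exists>x\<in>\<Omega> \<inter> {x. x \<bullet> e > 0}. v' x \<noteq> 0" using nz by (simp add: v'v)
  have L': "\<bar>trace_of (\<lambda>i x. Hs i x - H i x) x\<bar> \<le> L * \<bar>v' x\<bar>" if "x \<in> \<Omega>" for x
    unfolding trv' v'v using L(2)[OF that] by simp
  obtain q where q: "q \<in> \<Omega>" "q \<bullet> e > 0" "v' q < 0"
    using antisymmetric_sign_change[OF rd(1,4) critical(1) e(2,1) v'_C2 L' L0 crit(2) vP(2) nz'] by blast
  \<comment> \<open>The positive part of \<open>v\<close> on the side of the mirror that \<open>d\<close> points to, for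
    \<open>d = e\<close> and \<open>d = - e\<close>.\<close>
  define zz where "zz = (\<lambda>d x. if x \<bullet> d > 0 then max 0 (v x) else 0)"
  have zz_trunc: "truncation \<Omega> (zz d) Gv Hv (2 * B)" if d: "d = e \<or> d = - e" for d
  proof unfold_locales
    show c: "continuous_on UNIV (zz d)"
      unfolding zz_def by (rule half_space_positive_part_continuous[OF v_cont]) (use d v_plane in auto)
    have zv: "zz d x = v x" if "zz d x \<noteq> 0" for x using that by (auto simp: zz_def max_def split: if_splits)
    show sub: "{x. zz d x \<noteq> 0} \<subseteq> \<Omega>" using v_out zv by force
    have op: "open {x. zz d x \<noteq> 0}" by (rule open_Collect_neq[OF c]) simp
    show "C2_on {x. zz d x \<noteq> 0} (zz d) Gv Hv"
      by (rule C2_on_cong[OF C2_on_subset[OF v_C2 sub] op]) (use zv in auto)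
    show "\<bar>trace_of Hv x\<bar> \<le> 2 * B" if "zz d x \<noteq> 0" for x using lapv_bound sub that by auto
  qed
  interpret T0: truncation \<Omega> u G H B
  proof unfold_locales
    show sub: "{x. u x \<noteq> 0} \<subseteq> \<Omega>" using u_out by auto
    show "C2_on {x. u x \<noteq> 0} u G H" by (rule C2_on_subset[OF u_C2 sub])
    show "\<bar>trace_of H x\<bar> \<le> B" if "u x \<noteq> 0" for x using lap_bound sub that by auto
  qed (rule u_cont)
  interpret T1: truncation \<Omega> "zz e" Gv Hv "2 * B" by (rule zz_trunc) simp
  interpret T2: truncation \<Omega> "zz (- e)" Gv Hv "2 * B" by (rule zz_trunc) simp
  have GL2: "G \<in> L2 \<Omega>"
  proof -
    have m: "G \<in> borel_measurable M" by (rule continuous_measurable_M[OF C2_on_continuous_grad[OF u_C2]])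
    have "AE x in M. T0.zgrad x = G x"
      by (rule has_weak_gradient_classical[OF T0.z_weak_gradient C2_onD(1)[OF u_C2] C2_on_continuous_grad[OF u_C2]])
    then have "integrable M (\<lambda>x. (norm (G x))\<^sup>2)"
      by (intro integrable_cong_AE_imp[OF T0.zgrad_energy(1)]) (use m in \<open>auto elim: eventually_mono\<close>)
    then show ?thesis using m by (simp add: L2_def)
  qed
  have u_wg: "has_weak_gradient \<Omega> u G"
    unfolding has_weak_gradient_def
  proof (intro conjI ballI T0.z_L2 GL2)
    fix \<phi> and i :: 'a assume \<phi>: "\<phi> \<in> test_functions \<Omega>" and i: "i \<in> Basis"
    obtain K where K: "C1c K \<phi> (grad \<phi>)" "K \<subseteq> \<Omega>" using test_function_C1c[OF \<phi>] .
    show "(\<integral>x. u x * partial_deriv i \<phi> x \<partial>M) = - (\<integral>x. (G x \<bullet> i) * \<phi> x \<partial>M)"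
      using C1c_integration_by_parts(1)[OF K C2_onD(1)[OF u_C2] C2_on_continuous_grad[OF u_C2] rd(1) subset_refl, of i] i
      by (simp add: grad_inner_Basis)
  qed
  define z where "z i = (if i = 0 then zz e else zz (- e))" for i :: nat
  define g where "g i = (if i = 0 then T1.zgrad else T2.zgrad)" for i :: nat
  define V where "V = {w. \<exists>c :: nat \<Rightarrow> real. AE x in M. w x = (\<Sum>i<2. c i * z i x)}"
  have z_H10: "z i \<in> H10 \<Omega>" and z_wg: "has_weak_gradient \<Omega> (z i) (g i)" for i
    using T1.z_H10 T2.z_H10 T1.z_weak_gradient T2.z_weak_gradient by (auto simp: z_def g_def)
  have z_val: "z i x \<noteq> 0 \<Longrightarrow> z i x = v x \<and> v x > 0 \<and> x \<in> \<Omega>" for i x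
    using v_out[of x] by (auto simp: z_def zz_def max_def split: if_splits)
  have z_nn: "z i x \<ge> 0" for i x by (simp add: z_def zz_def)
  have g0: "g i x = 0" if "z i x = 0" for i x
    using that by (auto simp: z_def g_def T1.zgrad_def T2.zgrad_def split: if_splits)
  have z_disj: "z 0 x = 0 \<or> z 1 x = 0" for x by (auto simp: z_def zz_def)
  \<comment> \<open>The sets where \<open>z i\<close> is positive are open and nonempty, hence not null: one contains
    \<open>q\<close>, the other the mirror image of \<open>p\<close>.\<close>
  have z_pos: "\<exists>y\<in>\<Omega>. z i y > 0 \<and> Q y" if "AE x in M. Q x" for i Q
  proof -
    have c: "continuous_on UNIV (z i)" using T1.z_cont T2.z_cont by (auto simp: z_def)
    have "open {x. z i x > 0}" by (rule open_Collect_less[OF continuous_on_const c])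
    moreover have "{x. z i x > 0} \<subseteq> \<Omega>"
    proof
      fix x assume "x \<in> {x. z i x > 0}"
      then have "z i x \<noteq> 0" by simp
      then show "x \<in> \<Omega>" using z_val by blast
    qed
    moreover have "{x. z i x > 0} \<noteq> {}"
    proof (cases "i = 0")
      case True
      then have "z i q > 0" using q by (simp add: z_def zz_def v'v)
      then show ?thesis by blast
    next
      case False
      then have "z i (?s p) > 0" using p by (simp add: z_def zz_def v_anti reflect_normal)
      then show ?thesis by blast
    qed
    ultimately show ?thesis using AE_open_witness[OF that] by blast
  qed
  have indep: "\<forall>i<2. c i = 0" if c: "AE x in M. (\<Sum>i<2. c i * z i x) = 0" for c :: "nat \<Rightarrow> real"
  proof (intro allI impI)
    fix i :: nat assume "i < 2"
    then have i: "i = 0 \<or> i = 1" by auto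
    obtain y where y: "z i y > 0" "(\<Sum>i<2. c i * z i y) = 0" using z_pos[OF c] by blast
    have "c i * z i y = 0" using y i z_disj[of y] by (auto simp: numeral_2_eq_2)
    then show "c i = 0" using y(1) by simp
  qed
  have sub: "H10_subspace_of_dim \<Omega> V 2"
    unfolding H10_subspace_of_dim_def V_def using z_H10 indep by (intro exI[of _ z]) auto
  have z0V: "z 0 \<in> V"
    unfolding V_def by (rule CollectI, rule exI[of _ "\<lambda>i. if i = 0 then 1 else 0"]) (simp add: numeral_2_eq_2)
  have z_nonzero: "\<not> (AE x in M. z i x = 0)" for i
  proof
    assume "AE x in M. z i x = 0"
    from z_pos[OF this, of i] show False by auto
  qed
  have sd: "sign_definite_on \<Omega> (z 0)"
    using z_nonzero z_nn by (simp add: sign_definite_on_def)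
  have cont_ae: "AE x in M. continuous_on UNIV (f x)" using caratheodory by (simp add: caratheodory_on_def)
  have Irange: "I = UNIV \<or> I = {0..}" using range by auto
  have inI: "u x \<in> I" for x using range u_def by auto
  define Q where "Q = (\<lambda>x. - trace_of H x)"
  define R where "R = (\<lambda>x. - trace_of Hv x)"
  have Q: "Q x = f x (u x)" and R: "R x = f x (u x) - f x (u (?s x))" if "x \<in> \<Omega>" for x
    using lap[OF that] lapv[OF that] by (auto simp: Q_def R_def)
  have QR_L2: "Q \<in> L2 \<Omega>" "R \<in> L2 \<Omega>"
  proof -
    show "Q \<in> L2 \<Omega>" unfolding Q_def
      by (rule bounded_L2[OF continuous_measurable_M[OF continuous_on_minus[OF C2_on_continuous_trace[OF u_C2]]], of B])
        (use lap_bound in auto)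
    show "R \<in> L2 \<Omega>" unfolding R_def
      by (rule bounded_L2[OF continuous_measurable_M[OF continuous_on_minus[OF C2_on_continuous_trace[OF v_C2]]], of "2 * B"])
        (use lapv_bound in auto)
  qed
  have weak1: "(\<integral>x. g i x \<bullet> G x \<partial>M) = (\<integral>x. Q x * z i x \<partial>M)" for i
    using T1.green_weak[OF u_C2 GL2 lap_bound] T2.green_weak[OF u_C2 GL2 lap_bound] by (simp add: g_def z_def Q_def)
  have weak2: "(\<integral>x. (norm (g i x))\<^sup>2 \<partial>M) = (\<integral>x. R x * z i x \<partial>M)" for i
    using T1.zgrad_energy(2) T2.zgrad_energy(2) by (simp add: g_def z_def R_def)
  have disj: "\<exists>k<2. \<forall>i<2. i \<noteq> k \<longrightarrow> z i x = 0 \<and> g i x = 0" for x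
  proof (cases "z 0 x = 0")
    case True
    then show ?thesis using g0[of 0 x] by (intro exI[of _ 1]) (auto simp: less_2_cases_iff)
  next
    case False
    then have "z 1 x = 0" using z_disj[of x] by blast
    then show ?thesis using g0[of 1 x] by (intro exI[of _ 0]) (auto simp: less_2_cases_iff)
  qed
  have z_bound: "\<bar>z i x\<bar> \<le> 2 * A" for i x
  proof (cases "z i x = 0")
    case False
    then have "z i x = u x - u (?s x)" using z_val[OF False] by (simp add: v_def)
    then show ?thesis using A(2)[of x] A(2)[of "?s x"] by linarith
  qed (use A in simp)
  have gap: "AE x in M. \<forall>c. \<bar>c\<bar> \<le> 1 \<longrightarrow>
      Q x * (c * z i x) + 1 / 2 * c\<^sup>2 * (R x * z i x) \<le> primitive f x (u\<^sub>0 x + c * z i x) - primitive f x (u\<^sub>0 x)" for i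
    using cont_ae convexity AE_space
  proof eventually_elim
    case (elim x)
    show ?case
    proof (intro allI impI)
      fix c :: real assume c: "\<bar>c\<bar> \<le> 1"
      show "Q x * (c * z i x) + 1 / 2 * c\<^sup>2 * (R x * z i x) \<le> primitive f x (u\<^sub>0 x + c * z i x) - primitive f x (u\<^sub>0 x)"
      proof (cases "z i x = 0")
        case False
        have zv: "z i x = u x - u (?s x)" "u (?s x) < u x" using z_val[OF False] by (auto simp: v_def)
        show ?thesis
          using convex_primitive_gap(1)[OF primitive_deriv[where f = f and x = x] Irange elim(2) inI inI zv(2) c] elim Q[of x] R[of x] u_in[of x]
          by (simp add: zv(1))
      qed simp
    qed
  qed
  have gap_strict: "AE x in M. \<forall>c. z i x \<noteq> 0 \<longrightarrow> c \<noteq> 0 \<longrightarrow> \<bar>c\<bar> \<le> 1 \<longrightarrow>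
      Q x * (c * z i x) + 1 / 2 * c\<^sup>2 * (R x * z i x) < primitive f x (u\<^sub>0 x + c * z i x) - primitive f x (u\<^sub>0 x)"
    if sc: "AE x in M. strictly_convex_on I (f x)" for i
    using cont_ae convexity sc AE_space
  proof eventually_elim
    case (elim x)
    show ?case
    proof (intro allI impI)
      fix c :: real assume c: "\<bar>c\<bar> \<le> 1" "c \<noteq> 0" and nz: "z i x \<noteq> 0"
      have zv: "z i x = u x - u (?s x)" "u (?s x) < u x" using z_val[OF nz] by (auto simp: v_def)
      show "Q x * (c * z i x) + 1 / 2 * c\<^sup>2 * (R x * z i x) < primitive f x (u\<^sub>0 x + c * z i x) - primitive f x (u\<^sub>0 x)"
        using convex_primitive_gap(2)[OF primitive_deriv[where f = f and x = x] Irange elim(2) inI inI zv(2) c(1) elim(3) c(2)] elim Q[of x] R[of x] u_in[of x]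
        by (simp add: zv(1))
    qed
  qed
  have ae0: "AE x in M. u x = u\<^sub>0 x" using u_in by (intro AE_M_I) auto
  have u0_H10: "u\<^sub>0 \<in> H10 \<Omega>" by (rule H10_cong_AE[OF T0.z_H10 ae0])
  have u0_wg: "has_weak_gradient \<Omega> u\<^sub>0 G" by (rule has_weak_gradient_cong_AE[OF u_wg ae0])
  have u0_bound: "\<bar>u\<^sub>0 x\<bar> \<le> A" if "x \<in> \<Omega>" for x using A(2)[of x] u_in[OF that] by simp
  note maximizer = disjoint_bumps_local_maximizer[OF caratheodory u0_H10 u0_wg z_H10 z_wg z_nonzero disj u0_bound z_bound f_bound
      weak1 weak2 QR_L2 gap V_def]
  show ?thesis using sub z0V sd maximizer gap_strict by blast
qed

end
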